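(* Let $X$ be one of the types $A_{-1}$, $B$, $D$ (where type $X_n$ with $X=A_{-1}$ means type $A_{n-1}$), and let $\mathcal{H}(X_n)$ be the corresponding Iwahori-Hecke algebra over $\mathcal{A}=\mathbb{Q}(v)$. Let $\mathcal{R}=\mathcal{A}(a)$ with the involution $\overline{v}=v^{-1}$, $\overline{a}=a^{-1}$, and let $$\zeta_n=\prod_{i=1}^n\bigl(1+a^{-1}J_i^X\bigr)\in \mathcal{H}(X_n)\otimes_{\mathcal{A}}\mathcal{R}.$$ Then the family of functionals $\mathrm{tr}_{\zeta_n}:\mathcal{H}(X_n)\to\mathcal{R}$, $\mathrm{tr}_{\zeta_n}(h)=\langle \zeta_n,h\rangle$, is a Markov trace with constants $\rho=1+a$, $\mu=v-v^{-1}$.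
   Context: **Hecke algebras.** $\mathcal{A}=\mathbb{Q}(v)$. For a Coxeter system $(W,S)$ with Coxeter matrix $(m_{st})$, $\mathcal{H}(W,S)$ is the unital $\mathcal{A}$-algebra with generators $t_s$ ($s\in S$), the braid relations ($t_st_{s'}t_s\cdots=t_{s'}t_st_{s'}\cdots$ with $m_{ss'}$ factors on each side, for $s\ne s'$), and $(t_s-v)(t_s+v^{-1})=0$. For a reduced expression $w=s_{1}\cdots s_{r}$ put $t_w=t_{s_1}\cdots t_{s_r}$; both $\{t_w\}_{w\in W}$ and $\{t_w^{-1}\}_{w\in W}$ are $\mathcal{A}$-bases. **Types.** Write $\mathcal{H}(X_n)$ for the algebra of type $X_n$ and $t_i$ for $t_{s_i}$. Generators: type $A_{n-1}$: $t_1,\dots,t_{n-1}$ (path $1-2-\cdots-(n-1)$); type $B_n$: $t_0,t_1,\dots,t_{n-1}$ (path $0-1-\cdots-(n-1)$ with $m_{01}=4$ and all other edges having $m=3$); type $D_n$, $n\ge2$: $t_1,t_{1'},t_2,\dots,t_{n-1}$ (path $1-2-\cdots-(n-1)$ together with a vertex $1'$ joined only to $2$; $D_2=A_1\times A_1$). All parameters equal $v$. $\iota:\mathcal{H}(X_{n-1})\to\mathcal{H}(X_n)$ is the natural embedding induced by inclusion of labels of generators. **Pairing.** The bar involution is the $\mathbb{Q}$-algebra involution with $\overline{v}=v^{-1}$, $\overline{t_w}=t_{w^{-1}}^{-1}$. Let $i$ be the $\mathcal{A}$-linear anti-involution with $i(t_w)=t_{w^{-1}}$. Let $\tau(h)$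 be the coefficient of $t_e^{-1}=1$ of $h$ in the basis $\{t_w^{-1}\}$. Put $\langle h,h'\rangle=\tau(i(\overline{h})h')$, extended to $\mathcal{H}\otimes_{\mathcal{A}}\mathcal{R}$, antilinearly (with respect to the involution of $\mathcal{R}$) in the first argument and linearly in the second. **Jucys-Murphy elements.** For finite $W$ with longest element $w_0$, $\mathbb{S}(W,S)=t_{w_0}^{-2}$, written $\mathbb{S}(X_n)$ in type $X_n$. For $n\ge2$, $J_n^X=\mathbb{S}(X_n)^{-1}\mathbb{S}(X_{n-1})$ (so for $X=A_{-1}$, $J_n^A=\mathbb{S}(A_{n-1})^{-1}\mathbb{S}(A_{n-2})$), where $A_0$ is the trivial type and, in type $D$, $\mathbb{S}(D_1)=1$. Also $J_1^A=1$, $J_1^B=t_0^2$, $J_1^D=1$. Explicitly, $J_i^A=t_{i-1}\cdots t_1t_1\cdots t_{i-1}$; $J_i^B=(t_{i-1}\cdots t_1t_0t_1\cdots t_{i-1})^2$; $J_i^D=(t_{i-1}\cdots t_2t_{1'}t_1t_2\cdots t_{i-1})^2$ for $i\ge2$. Elements of $\mathcal{H}(X_m)$, $m<n$, are regarded in $\mathcal{H}(X_n)$ via the embeddings. **Markov trace.** A family $(\phi_n)$ of $\mathcal{A}$-linear functionals $\phi_n:\mathcal{H}(X_n)\to\mathcal{R}$, for $n\ge1$ (for $n\ge2$ in type $D$), is a Markov trace with constants $\rho,\mu\in\mathcal{R}$ if: (M1) $\phi_n(hh')=\phi_n(h'h)$ for all $h,h'\in\mathcal H(X_n)$; and, for all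 $n\ge2$ ($n\ge3$ in type $D$) and all $h\in\mathcal{H}(X_{n-1})$: (U1) $\phi_n(\iota(h))=\rho\,\phi_{n-1}(h)$; (M2) $\phi_n(\iota(h)t_{n-1})=\mu\,\phi_{n-1}(h)$. *)

theory Defs
  imports
    "HOL-Algebra.QuotRing"
    "HOL-Library.Poly_Mapping"
    "HOL-Computational_Algebra.Polynomial"
    "HOL-Computational_Algebra.Fraction_Field"
begin

section \<open>The coefficient fields\<close>

text \<open>\<open>qv\<close> is the field Q(v), written A below, and \<open>qva\<close> is R = A(a).\<close>

type_synonym qv = "rat poly fract"
type_synonym qva = "qv poly fract"

definition const_fract :: "'k::field \<Rightarrow> 'k poly fract" where
  "const_fract c = Fract [:c:] 1"

definition indet :: "'k::field poly fract" where
  "indet = Fract [:0, 1:] 1"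

definition var_v :: qv where
  "var_v = indet"

abbreviation A_to_R :: "qv \<Rightarrow> qva" where
  "A_to_R \<equiv> const_fract"

definition var_a :: qva where
  "var_a = indet"

text \<open>The value at \<open>x\<close> of a rational function whose coefficients are mapped along the field
  homomorphism \<open>f\<close>. It is well defined whenever \<open>x\<close> is transcendental over the image of \<open>f\<close>,
  as in both uses below.\<close>

definition fract_eval :: "('k::field \<Rightarrow> 'l::field) \<Rightarrow> 'l \<Rightarrow> 'k poly fract \<Rightarrow> 'l" where
  "fract_eval f x r =
     (THE y. \<exists>p q. q \<noteq> 0 \<and> r = Fract p q \<and> y = poly (map_poly f p) x / poly (map_poly f q) x)"

definition bar_A :: "qv \<Rightarrow> qv" where
  "bar_A = fract_eval const_fract (inverse var_v)"

definition bar_R :: "qva \<Rightarrow> qva" where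
  "bar_R = fract_eval (\<lambda>c. A_to_R (bar_A c)) (inverse var_a)"


section \<open>Coxeter groups\<close>

text \<open>The Coxeter group of a matrix \<open>m\<close> on the label set \<open>S\<close>, presented by \<open>(st)\<^bsup>m s t\<^esup> = 1\<close> for
  \<open>s, t \<in> S\<close>. As \<open>m s s = 1\<close>, the generators are involutions, so no formal inverses are needed and the group
  elements are congruence classes of words over \<open>S\<close>. An infinite entry of the matrix is encoded as 0;
  the corresponding relation is then trivial.\<close>

inductive cox_eq :: "'s set \<Rightarrow> ('s \<Rightarrow> 's \<Rightarrow> nat) \<Rightarrow> 's list \<Rightarrow> 's list \<Rightarrow> bool"
  for S :: "'s set" and m :: "'s \<Rightarrow> 's \<Rightarrow> nat" where
  refl: "xs \<in> lists S \<Longrightarrow> cox_eq S m xs xs"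
| sym: "cox_eq S m xs ys \<Longrightarrow> cox_eq S m ys xs"
| trans: "cox_eq S m xs ys \<Longrightarrow> cox_eq S m ys zs \<Longrightarrow> cox_eq S m xs zs"
| rel: "us \<in> lists S \<Longrightarrow> vs \<in> lists S \<Longrightarrow> s \<in> S \<Longrightarrow> t \<in> S \<Longrightarrow>
    cox_eq S m (us @ concat (replicate (m s t) [s, t]) @ vs) (us @ vs)"

definition cox_class :: "'s set \<Rightarrow> ('s \<Rightarrow> 's \<Rightarrow> nat) \<Rightarrow> 's list \<Rightarrow> 's list set" where
  "cox_class S m xs = {ys. cox_eq S m xs ys}"

definition coxeter_group :: "'s set \<Rightarrow> ('s \<Rightarrow> 's \<Rightarrow> nat) \<Rightarrow> 's list set monoid" where
  "coxeter_group S m =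
     \<lparr>carrier = cox_class S m ` lists S,
      monoid.mult = (\<lambda>x y. \<Union>xs\<in>x. \<Union>ys\<in>y. cox_class S m (xs @ ys)),
      one = cox_class S m []\<rparr>"

definition cox_length :: "'s list set \<Rightarrow> nat" where
  "cox_length w = (LEAST k. k \<in> length ` w)"

definition reduced_expression :: "'s list \<Rightarrow> 's list set \<Rightarrow> bool" where
  "reduced_expression xs w \<longleftrightarrow> xs \<in> w \<and> length xs = cox_length w"

definition longest_element :: "'s set \<Rightarrow> ('s \<Rightarrow> 's \<Rightarrow> nat) \<Rightarrow> 's list set" where
  "longest_element S m = arg_max cox_length (\<lambda>w. w \<in> carrier (coxeter_group S m))"


section \<open>Monoid algebras\<close>

abbreviation (input) keys :: "('a \<Rightarrow>\<^sub>0 'b::zero) \<Rightarrow> 'a set" where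
  "keys \<equiv> Poly_Mapping.keys"

abbreviation (input) lookup :: "('a \<Rightarrow>\<^sub>0 'b::zero) \<Rightarrow> 'a \<Rightarrow> 'b" where
  "lookup \<equiv> Poly_Mapping.lookup"

abbreviation (input) single :: "'a \<Rightarrow> 'b \<Rightarrow> 'a \<Rightarrow>\<^sub>0 'b::zero" where
  "single \<equiv> Poly_Mapping.single"

definition monoid_algebra :: "('g, 'b) monoid_scheme \<Rightarrow> ('g \<Rightarrow>\<^sub>0 'k::comm_ring_1) ring" where
  "monoid_algebra G =
     \<lparr>carrier = {f. keys f \<subseteq> carrier G},
      monoid.mult = (\<lambda>f g. \<Sum>x\<in>keys f. \<Sum>y\<in>keys g.
        single (x \<otimes>\<^bsub>G\<^esub> y) (lookup f x * lookup g y)),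
      one = single \<one>\<^bsub>G\<^esub> 1,
      zero = 0,
      add = (+)\<rparr>"

definition free_monoid :: "'s set \<Rightarrow> 's list monoid" where
  "free_monoid S = \<lparr>carrier = lists S, monoid.mult = (@), one = []\<rparr>"

abbreviation free_algebra :: "'s set \<Rightarrow> ('s list \<Rightarrow>\<^sub>0 'k::comm_ring_1) ring" where
  "free_algebra S \<equiv> monoid_algebra (free_monoid S)"


section \<open>Hecke algebras\<close>

fun alternating_word :: "'s \<Rightarrow> 's \<Rightarrow> nat \<Rightarrow> 's list" where
  "alternating_word s t 0 = []"
| "alternating_word s t (Suc k) = s # alternating_word t s k"

definition hecke_relations :: "'s set \<Rightarrow> ('s \<Rightarrow> 's \<Rightarrow> nat) \<Rightarrow> ('s list \<Rightarrow>\<^sub>0 qv) set" where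
  "hecke_relations S m =
     {single (alternating_word s t (m s t)) 1 - single (alternating_word t s (m s t)) 1
        | s t. s \<in> S \<and> t \<in> S \<and> s \<noteq> t} \<union>
     {(single [s] 1 - single [] var_v) \<otimes>\<^bsub>free_algebra S\<^esub>
        (single [s] 1 + single [] (inverse var_v))
        | s. s \<in> S}"

definition hecke_ideal :: "'s set \<Rightarrow> ('s \<Rightarrow> 's \<Rightarrow> nat) \<Rightarrow> ('s list \<Rightarrow>\<^sub>0 qv) set" where
  "hecke_ideal S m = Idl\<^bsub>free_algebra S\<^esub> (hecke_relations S m)"

definition hecke :: "'s set \<Rightarrow> ('s \<Rightarrow> 's \<Rightarrow> nat) \<Rightarrow> ('s list \<Rightarrow>\<^sub>0 qv) set ring" where
  "hecke S m = free_algebra S Quot hecke_ideal S m"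

definition hecke_scale ::
    "'s set \<Rightarrow> ('s \<Rightarrow> 's \<Rightarrow> nat) \<Rightarrow> qv \<Rightarrow> ('s list \<Rightarrow>\<^sub>0 qv) set \<Rightarrow> ('s list \<Rightarrow>\<^sub>0 qv) set" where
  "hecke_scale S m c h =
     (hecke_ideal S m +>\<^bsub>free_algebra S\<^esub> single [] c) \<otimes>\<^bsub>hecke S m\<^esub> h"

definition hecke_gen :: "'s set \<Rightarrow> ('s \<Rightarrow> 's \<Rightarrow> nat) \<Rightarrow> 's \<Rightarrow> ('s list \<Rightarrow>\<^sub>0 qv) set" where
  "hecke_gen S m s = hecke_ideal S m +>\<^bsub>free_algebra S\<^esub> single [s] 1"

text \<open>The element \<open>t\<^sub>w\<close>; it does not depend on the chosen reduced expression.\<close>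

definition hecke_T ::
    "'s set \<Rightarrow> ('s \<Rightarrow> 's \<Rightarrow> nat) \<Rightarrow> 's list set \<Rightarrow> ('s list \<Rightarrow>\<^sub>0 qv) set" where
  "hecke_T S m w =
     foldr (\<lambda>s h. hecke_gen S m s \<otimes>\<^bsub>hecke S m\<^esub> h)
       (SOME xs. reduced_expression xs w) \<one>\<^bsub>hecke S m\<^esub>"

text \<open>The map induced by an inclusion of label sets, into the algebra with label set \<open>S\<close>.\<close>

definition hecke_incl ::
    "'s set \<Rightarrow> ('s \<Rightarrow> 's \<Rightarrow> nat) \<Rightarrow> ('s list \<Rightarrow>\<^sub>0 qv) set \<Rightarrow> ('s list \<Rightarrow>\<^sub>0 qv) set" where
  "hecke_incl S m h = (\<Union>f\<in>h. hecke_ideal S m +>\<^bsub>free_algebra S\<^esub> f)"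


subsection \<open>The pairing\<close>

text \<open>The coordinates of \<open>h\<close> in a basis \<open>b\<close> indexed by the elements of the Coxeter group.\<close>

definition hecke_coords ::
    "'s set \<Rightarrow> ('s \<Rightarrow> 's \<Rightarrow> nat) \<Rightarrow> ('s list set \<Rightarrow> ('s list \<Rightarrow>\<^sub>0 qv) set) \<Rightarrow>
      ('s list \<Rightarrow>\<^sub>0 qv) set \<Rightarrow> 's list set \<Rightarrow>\<^sub>0 qv" where
  "hecke_coords S m b h =
     (THE c. keys c \<subseteq> carrier (coxeter_group S m) \<and>
        h = (\<Oplus>\<^bsub>hecke S m\<^esub>w\<in>keys c. hecke_scale S m (lookup c w) (b w)))"

definition hecke_bar ::
    "'s set \<Rightarrow> ('s \<Rightarrow> 's \<Rightarrow> nat) \<Rightarrow> ('s list \<Rightarrow>\<^sub>0 qv) set \<Rightarrow> ('s list \<Rightarrow>\<^sub>0 qv) set" where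
  "hecke_bar S m h = (let c = hecke_coords S m (hecke_T S m) h in
     \<Oplus>\<^bsub>hecke S m\<^esub>w\<in>keys c. hecke_scale S m (bar_A (lookup c w))
       (inv\<^bsub>hecke S m\<^esub> (hecke_T S m (inv\<^bsub>coxeter_group S m\<^esub> w))))"

definition hecke_anti ::
    "'s set \<Rightarrow> ('s \<Rightarrow> 's \<Rightarrow> nat) \<Rightarrow> ('s list \<Rightarrow>\<^sub>0 qv) set \<Rightarrow> ('s list \<Rightarrow>\<^sub>0 qv) set" where
  "hecke_anti S m h = (let c = hecke_coords S m (hecke_T S m) h in
     \<Oplus>\<^bsub>hecke S m\<^esub>w\<in>keys c. hecke_scale S m (lookup c w)
       (hecke_T S m (inv\<^bsub>coxeter_group S m\<^esub> w)))"

definition hecke_tau ::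
    "'s set \<Rightarrow> ('s \<Rightarrow> 's \<Rightarrow> nat) \<Rightarrow> ('s list \<Rightarrow>\<^sub>0 qv) set \<Rightarrow> qv" where
  "hecke_tau S m h =
     lookup (hecke_coords S m (\<lambda>w. inv\<^bsub>hecke S m\<^esub> (hecke_T S m w)) h)
       \<one>\<^bsub>coxeter_group S m\<^esub>"

definition hecke_pairing ::
    "'s set \<Rightarrow> ('s \<Rightarrow> 's \<Rightarrow> nat) \<Rightarrow>
      ('s list \<Rightarrow>\<^sub>0 qv) set \<Rightarrow> ('s list \<Rightarrow>\<^sub>0 qv) set \<Rightarrow> qv" where
  "hecke_pairing S m h h' =
     hecke_tau S m (hecke_anti S m (hecke_bar S m h) \<otimes>\<^bsub>hecke S m\<^esub> h')"


subsection \<open>Extension of scalars\<close>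

text \<open>The tensor product of the Hecke algebra with R over A: the free R-module on the set of
  elements \<open>h\<close> of the Hecke algebra (the basis vector \<open>single h 1\<close> becomes \<open>h \<otimes> 1\<close>), with the
  product of basis vectors taken in the Hecke algebra, modulo the relations that make
  \<open>h \<mapsto> h \<otimes> 1\<close> an A-linear map.\<close>

definition tensor_relations ::
    "'s set \<Rightarrow> ('s \<Rightarrow> 's \<Rightarrow> nat) \<Rightarrow> (('s list \<Rightarrow>\<^sub>0 qv) set \<Rightarrow>\<^sub>0 qva) set" where
  "tensor_relations S m =
     {single (h \<oplus>\<^bsub>hecke S m\<^esub> h') 1 - single h 1 - single h' 1
        | h h'. h \<in> carrier (hecke S m) \<and> h' \<in> carrier (hecke S m)} \<union>
     {single (hecke_scale S m c h) 1 - single h (A_to_R c)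
        | c h. h \<in> carrier (hecke S m)}"

definition tensor_ideal ::
    "'s set \<Rightarrow> ('s \<Rightarrow> 's \<Rightarrow> nat) \<Rightarrow> (('s list \<Rightarrow>\<^sub>0 qv) set \<Rightarrow>\<^sub>0 qva) set" where
  "tensor_ideal S m = Idl\<^bsub>monoid_algebra (hecke S m)\<^esub> (tensor_relations S m)"

definition hecke_R ::
    "'s set \<Rightarrow> ('s \<Rightarrow> 's \<Rightarrow> nat) \<Rightarrow> (('s list \<Rightarrow>\<^sub>0 qv) set \<Rightarrow>\<^sub>0 qva) set ring" where
  "hecke_R S m = monoid_algebra (hecke S m) Quot tensor_ideal S m"

definition tensor ::
    "'s set \<Rightarrow> ('s \<Rightarrow> 's \<Rightarrow> nat) \<Rightarrow> ('s list \<Rightarrow>\<^sub>0 qv) set \<Rightarrow> qva \<Rightarrow>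
      (('s list \<Rightarrow>\<^sub>0 qv) set \<Rightarrow>\<^sub>0 qva) set" where
  "tensor S m h r = tensor_ideal S m +>\<^bsub>monoid_algebra (hecke S m)\<^esub> single h r"

text \<open>The extended pairing, antilinear in the first argument and linear in the second. It does not
  depend on the representatives of the two elements of the tensor product.\<close>

definition hecke_R_pairing ::
    "'s set \<Rightarrow> ('s \<Rightarrow> 's \<Rightarrow> nat) \<Rightarrow> (('s list \<Rightarrow>\<^sub>0 qv) set \<Rightarrow>\<^sub>0 qva) set \<Rightarrow>
      (('s list \<Rightarrow>\<^sub>0 qv) set \<Rightarrow>\<^sub>0 qva) set \<Rightarrow> qva" where
  "hecke_R_pairing S m x y = (let f = (SOME f. f \<in> x); g = (SOME g. g \<in> y) in
     \<Sum>h\<in>keys f. \<Sum>h'\<in>keys g.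
       bar_R (lookup f h) * lookup g h' * A_to_R (hecke_pairing S m h h'))"


section \<open>The types A, B and D\<close>

text \<open>\<open>TypeA\<close> with index \<open>n\<close> stands for the Coxeter type \<open>A\<^bsub>n-1\<^esub>\<close>.\<close>

datatype cox_type = TypeA | TypeB | TypeD

text \<open>\<open>Prime1\<close> is the label 1' of type D.\<close>

datatype label = Node nat | Prime1

fun labels :: "cox_type \<Rightarrow> nat \<Rightarrow> label set" where
  "labels TypeA n = Node ` {1..<n}"
| "labels TypeB n = Node ` {0..<n}"
| "labels TypeD n = (if n \<ge> 2 then insert Prime1 (Node ` {1..<n}) else {})"

fun cox_matrix :: "cox_type \<Rightarrow> label \<Rightarrow> label \<Rightarrow> nat" where
  "cox_matrix X (Node i) (Node j) =
     (if i = j then 1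
      else if i = Suc j \<or> j = Suc i then (if X = TypeB \<and> (i = 0 \<or> j = 0) then 4 else 3)
      else 2)"
| "cox_matrix X (Node i) Prime1 = (if i = 2 then 3 else 2)"
| "cox_matrix X Prime1 (Node j) = (if j = 2 then 3 else 2)"
| "cox_matrix X Prime1 Prime1 = 1"

type_synonym hecke_elt = "(label list \<Rightarrow>\<^sub>0 qv) set"
type_synonym hecke_R_elt = "(hecke_elt \<Rightarrow>\<^sub>0 qva) set"

abbreviation Hecke :: "cox_type \<Rightarrow> nat \<Rightarrow> hecke_elt ring" where
  "Hecke X n \<equiv> hecke (labels X n) (cox_matrix X)"

abbreviation gen :: "cox_type \<Rightarrow> nat \<Rightarrow> label \<Rightarrow> hecke_elt" where
  "gen X n \<equiv> hecke_gen (labels X n) (cox_matrix X)"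

abbreviation incl :: "cox_type \<Rightarrow> nat \<Rightarrow> hecke_elt \<Rightarrow> hecke_elt" where
  "incl X n \<equiv> hecke_incl (labels X n) (cox_matrix X)"

abbreviation HeckeR :: "cox_type \<Rightarrow> nat \<Rightarrow> hecke_R_elt ring" where
  "HeckeR X n \<equiv> hecke_R (labels X n) (cox_matrix X)"

abbreviation tens :: "cox_type \<Rightarrow> nat \<Rightarrow> hecke_elt \<Rightarrow> qva \<Rightarrow> hecke_R_elt" where
  "tens X n \<equiv> tensor (labels X n) (cox_matrix X)"

text \<open>The inverse square of \<open>t\<^sub>w\<close> for \<open>w\<close> the longest element. For \<open>TypeD\<close> with index 1 the label
  set is empty and this is 1.\<close>

definition bbS :: "cox_type \<Rightarrow> nat \<Rightarrow> hecke_elt" where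
  "bbS X n = inv\<^bsub>Hecke X n\<^esub>
     (hecke_T (labels X n) (cox_matrix X) (longest_element (labels X n) (cox_matrix X))
        [^]\<^bsub>Hecke X n\<^esub> (2::nat))"

text \<open>The Jucys-Murphy element \<open>J\<^sub>i\<close>, as an element of the algebra of index \<open>i \<ge> 1\<close>.\<close>

definition jucys_murphy :: "cox_type \<Rightarrow> nat \<Rightarrow> hecke_elt" where
  "jucys_murphy X i =
     (if i \<ge> 2 then inv\<^bsub>Hecke X i\<^esub> (bbS X i) \<otimes>\<^bsub>Hecke X i\<^esub> incl X i (bbS X (i - 1))
      else if X = TypeB then gen X 1 (Node 0) [^]\<^bsub>Hecke X 1\<^esub> (2::nat)
      else \<one>\<^bsub>Hecke X 1\<^esub>)"

definition zeta :: "cox_type \<Rightarrow> nat \<Rightarrow> hecke_R_elt" where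
  "zeta X n =
     foldr (\<lambda>i z. (\<one>\<^bsub>HeckeR X n\<^esub> \<oplus>\<^bsub>HeckeR X n\<^esub> tens X n (incl X n (jucys_murphy X i)) (inverse var_a))
                    \<otimes>\<^bsub>HeckeR X n\<^esub> z)
       [1..<Suc n] \<one>\<^bsub>HeckeR X n\<^esub>"

definition tr_zeta :: "cox_type \<Rightarrow> nat \<Rightarrow> hecke_elt \<Rightarrow> qva" where
  "tr_zeta X n h = hecke_R_pairing (labels X n) (cox_matrix X) (zeta X n) (tens X n h 1)"


section \<open>Markov traces\<close>

definition first_index :: "cox_type \<Rightarrow> nat" where
  "first_index X = (if X = TypeD then 2 else 1)"

definition A_linear :: "cox_type \<Rightarrow> nat \<Rightarrow> (hecke_elt \<Rightarrow> qva) \<Rightarrow> bool" where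
  "A_linear X n \<phi> \<longleftrightarrow>
     (\<forall>h\<in>carrier (Hecke X n). \<forall>h'\<in>carrier (Hecke X n). \<phi> (h \<oplus>\<^bsub>Hecke X n\<^esub> h') = \<phi> h + \<phi> h') \<and>
     (\<forall>c. \<forall>h\<in>carrier (Hecke X n).
        \<phi> (hecke_scale (labels X n) (cox_matrix X) c h) = A_to_R c * \<phi> h)"

definition markov_trace ::
    "cox_type \<Rightarrow> (nat \<Rightarrow> hecke_elt \<Rightarrow> qva) \<Rightarrow> qva \<Rightarrow> qva \<Rightarrow> bool" where
  "markov_trace X \<phi> \<rho> \<mu> \<longleftrightarrow>
     (\<forall>n\<ge>first_index X. A_linear X n (\<phi> n)) \<and>
     (\<forall>n\<ge>first_index X. \<forall>h\<in>carrier (Hecke X n). \<forall>h'\<in>carrier (Hecke X n).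
        \<phi> n (h \<otimes>\<^bsub>Hecke X n\<^esub> h') = \<phi> n (h' \<otimes>\<^bsub>Hecke X n\<^esub> h)) \<and>
     (\<forall>n>first_index X. \<forall>h\<in>carrier (Hecke X (n - 1)).
        \<phi> n (incl X n h) = \<rho> * \<phi> (n - 1) h) \<and>
     (\<forall>n>first_index X. \<forall>h\<in>carrier (Hecke X (n - 1)).
        \<phi> n (incl X n h \<otimes>\<^bsub>Hecke X n\<^esub> gen X n (Node (n - 1))) = \<mu> * \<phi> (n - 1) h)"

end

theory Submission
  imports Defs
begin

text \<open>Let \<open>\<tau>\<close> be the trace of the pairing. Since \<open>i\<close> composed with the bar involution is the
  antilinear antiautomorphism with \<open>t\<^sub>s \<mapsto> t\<^sub>s\<^sup>-\<^sup>1\<close>, the functional of the theorem is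
  \<open>h \<mapsto> \<tau>(\<Prod>(1 + a J\<^sub>i\<^sup>-\<^sup>1) h)\<close>.

  It is a trace because the product is central: \<open>J\<^sub>i\<close> commutes with the algebra of index \<open>i - 1\<close>, and
  \<open>t\<^sub>i\<close> commutes with the symmetric functions of \<open>J\<^sub>i\<close> and \<open>J\<^sub>i\<^sub>+\<^sub>1\<close>, because \<open>x \<mapsto> t\<^sub>i x t\<^sub>i\<close> maps
  \<open>J\<^sub>i\<close> to \<open>J\<^sub>i\<^sub>+\<^sub>1\<close> in type A, and a square root of \<open>J\<^sub>i\<close> to one of \<open>J\<^sub>i\<^sub>+\<^sub>1\<close> in types B and D.

  For the Markov properties, write the longest element of index \<open>n\<close> as \<open>w d\<close> with \<open>w\<close> the longest
  element of index \<open>n - 1\<close> and \<open>d\<close> of minimal length in its coset. Then \<open>J\<^sub>n\<close> is the product of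
  \<open>t\<^sub>d\<close> and \<open>t\<^bsub>d'\<^esub>\<close> with \<open>d'\<close> the inverse of \<open>d\<close>. Now \<open>\<tau>(t\<^sub>x\<^sup>-\<^sup>1 t\<^sub>y\<^sup>-\<^sup>1)\<close> is 1 if \<open>x y = 1\<close> and 0
  otherwise, and lengths are additive on the coset of \<open>d\<close>; this gives \<open>\<tau>(J\<^sub>n\<^sup>-\<^sup>1 h) = \<tau>(h)\<close> and
  \<open>\<tau>(J\<^sub>n\<^sup>-\<^sup>1 h t\<^sub>n\<^sub>-\<^sub>1) = 0\<close> for \<open>h\<close> in the algebra of index \<open>n - 1\<close>, while
  \<open>\<tau>(h t\<^sub>n\<^sub>-\<^sub>1) = (v - v\<^sup>-\<^sup>1) \<tau>(h)\<close>.

  That the \<open>t\<^sub>w\<close> form a basis follows from the exchange condition and Matsumoto's theorem, by letting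
  the Hecke algebra act on functions on the group.\<close>

section \<open>The coefficient fields and their involutions\<close>

text \<open>Elements of the Hecke algebra and of its scalar extension are cosets of generated
  ideals, and coordinates and representatives are picked by description and choice. The recurring
  obstacle is therefore to obtain well-defined functionals. Both times the common annihilator of a
  family of functionals that is stable under left and right multiplication is an ideal, and it
  contains the relations.

  Since \<open>tau\<close> reads a coefficient in the basis of the t_w^-1, it is not directly
  adapted to products of reduced words. The bar involution exchanges that basis with the t_w, so
  \<open>tau\<close> is conjugate to the coefficient \<open>tau0\<close> in the basis t_w; this is
  why elements are barred before they are evaluated.

  Centrality is used in the form that t_s may be moved from the left to the right of the argument of
  \<open>prod_trace\<close>, one factor or one neighbouring pair of factors at a time.

  The constants come from the last factor 1 + a J_n^-1: for the element h its two terms give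
  \<tau>(h) and a \<tau>(h), hence 1 + a; for h t_(n-1) the first term gives (v - v^-1) \<tau>(h)
  and the second vanishes.\<close>

locale field_embedding =
  fixes \<sigma> :: "'k::field \<Rightarrow> 'l::field"
  assumes add: "\<sigma> (x + y) = \<sigma> x + \<sigma> y"
    and mult: "\<sigma> (x * y) = \<sigma> x * \<sigma> y"
    and one: "\<sigma> 1 = 1"
begin

lemma zero: "\<sigma> 0 = 0"
  using add[of 0 0] by (metis add_0 add_cancel_right_right)

lemma minus: "\<sigma> (- x) = - \<sigma> x"
  using add[of x "- x"] zero by (simp add: eq_neg_iff_add_eq_0 add.commute)

lemma diff: "\<sigma> (x - y) = \<sigma> x - \<sigma> y"
  using add[of x "- y"] minus by simp

lemma nonzero: "x \<noteq> 0 \<Longrightarrow> \<sigma> x \<noteq> 0"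
  using mult[of x "inverse x"] one by auto

lemma inverse: "\<sigma> (inverse x) = inverse (\<sigma> x)"
proof (cases "x = 0")
  case False
  then have "\<sigma> x * \<sigma> (inverse x) = 1"
    using mult[of x "inverse x"] one by simp
  then show ?thesis using inverse_unique by metis
qed (simp add: zero)

lemma divide: "\<sigma> (x / y) = \<sigma> x / \<sigma> y"
  by (simp add: divide_inverse mult inverse)

lemma map_poly_add: "map_poly \<sigma> (p + q) = map_poly \<sigma> p + map_poly \<sigma> q"
  by (intro poly_eqI) (simp add: coeff_map_poly zero add)

lemma map_poly_smult': "map_poly \<sigma> (smult c p) = smult (\<sigma> c) (map_poly \<sigma> p)"
  by (rule map_poly_smult) (auto simp: zero mult)

lemma map_poly_mult: "map_poly \<sigma> (p * q) = map_poly \<sigma> p * map_poly \<sigma> q"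
  by (induction p) (simp_all add: map_poly_pCons zero map_poly_add map_poly_smult')

lemma map_poly_nonzero: "p \<noteq> 0 \<Longrightarrow> map_poly \<sigma> p \<noteq> 0"
  by (metis coeff_map_poly leading_coeff_neq_0 nonzero zero coeff_0)

end

lemma const_fract_embedding: "field_embedding (const_fract :: 'k::field \<Rightarrow> 'k poly fract)"
  by unfold_locales (simp_all add: const_fract_def One_fract_def mult.commute flip: one_pCons)

interpretation const_fract: field_embedding "const_fract :: 'k::field \<Rightarrow> 'k poly fract"
  by (rule const_fract_embedding)

lemma poly_const_fract_indet: "poly (map_poly const_fract p) indet = Fract p (1 :: 'k::field poly)"
proof (induction p)
  case 0
  then show ?case by (simp add: Zero_fract_def)
next
  case (pCons c p)
  have "Fract [:c:] 1 + Fract [:0, 1:] 1 * Fract p 1 = Fract (pCons c p) 1"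
    by simp
  then show ?case
    using pCons by (simp add: map_poly_pCons const_fract.zero) (simp add: const_fract_def indet_def)
qed

lemma indet_nonzero: "indet \<noteq> (0 :: 'k::field poly fract)"
  by (simp add: indet_def Zero_fract_def eq_fract)

text \<open>Reversing the coefficients turns a root at the inverse of the indeterminate into a root
  at the indeterminate, where the reversed polynomial evaluates to itself as a fraction and so
  cannot vanish.\<close>

lemma poly_const_fract_inverse_indet:
  fixes p :: "'k::field poly"
  assumes "p \<noteq> 0"
  shows "poly (map_poly const_fract p) (inverse indet) \<noteq> 0"
proof
  assume *: "poly (map_poly const_fract p) (inverse indet) = 0"
  have r: "reflect_poly (map_poly const_fract p) = map_poly const_fract (reflect_poly p)"
    by (intro poly_eqI)
      (simp add: coeff_map_poly coeff_reflect_poly const_fract.zero degree_map_poly const_fract.nonzero)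
  have "poly (reflect_poly (map_poly const_fract p)) indet = 0"
    using * by (simp add: poly_reflect_poly_nz indet_nonzero)
  then have "Fract (reflect_poly p) 1 = 0"
    by (simp add: r poly_const_fract_indet)
  then show False using assms by (simp add: Zero_fract_def eq_fract)
qed

text \<open>The assumption \<open>nz\<close> is transcendence of \<open>x\<close> over the image of
  \<open>f\<close>: no denominator vanishes at \<open>x\<close>, so the description in
  \<open>fract_eval\<close> has a unique value.\<close>

locale transcendental_evaluation =
  fixes f :: "'k::field \<Rightarrow> 'l::field" and x :: 'l
  assumes embedding: "field_embedding f"
    and nz: "p \<noteq> 0 \<Longrightarrow> poly (map_poly f p) x \<noteq> 0"
begin

interpretation field_embedding f by (rule embedding)

lemma fract_eval_Fract:
  assumes "q \<noteq> 0"
  shows "fract_eval f x (Fract p q) = poly (map_poly f p) x / poly (map_poly f q) x"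
  unfolding fract_eval_def
proof (rule the_equality)
  fix y
  assume "\<exists>p' q'. q' \<noteq> 0 \<and> Fract p q = Fract p' q' \<and> y = poly (map_poly f p') x / poly (map_poly f q') x"
  then obtain p' q' where *: "q' \<noteq> 0" "Fract p q = Fract p' q'"
    "y = poly (map_poly f p') x / poly (map_poly f q') x" by blast
  have "p * q' = p' * q" using * assms by (simp add: eq_fract)
  then have "poly (map_poly f p) x * poly (map_poly f q') x = poly (map_poly f p') x * poly (map_poly f q) x"
    by (metis map_poly_mult poly_mult)
  then show "y = poly (map_poly f p) x / poly (map_poly f q) x"
    using nz[OF assms] nz[OF *(1)] *(3) by (simp add: frac_eq_eq)
qed (use assms in blast)

lemma fract_eval_embedding: "field_embedding (fract_eval f x)"
proof
  fix a b :: "'k poly fract"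
  obtain p q where a: "a = Fract p q" "q \<noteq> 0" by (cases a)
  obtain p' q' where b: "b = Fract p' q'" "q' \<noteq> 0" by (cases b)
  show "fract_eval f x (a + b) = fract_eval f x a + fract_eval f x b"
    using a b nz[of q] nz[of q']
    by (simp add: fract_eval_Fract map_poly_add map_poly_mult field_simps)
  show "fract_eval f x (a * b) = fract_eval f x a * fract_eval f x b"
    using a b by (simp add: fract_eval_Fract map_poly_mult)
next
  show "fract_eval f x 1 = 1"
    by (simp add: One_fract_def fract_eval_Fract one)
qed

lemma fract_eval_const: "fract_eval f x (const_fract c) = f c"
  by (simp add: const_fract_def fract_eval_Fract one map_poly_pCons zero)

lemma fract_eval_indet: "fract_eval f x indet = x"
  by (simp add: indet_def fract_eval_Fract one map_poly_pCons zero)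

end

text \<open>One statement serves both involutions: \<sigma> is the identity for
  \<open>bar_A\<close>, and \<open>bar_A\<close> itself for \<open>bar_R\<close>.\<close>

lemma transcendental_evaluation_inverse_indet:
  assumes "field_embedding \<sigma>"
  shows "transcendental_evaluation (\<lambda>c. const_fract (\<sigma> c)) (inverse indet)"
proof
  interpret field_embedding \<sigma> by (rule assms)
  show "const_fract (\<sigma> (x + y)) = const_fract (\<sigma> x) + const_fract (\<sigma> y)"
    and "const_fract (\<sigma> (x * y)) = const_fract (\<sigma> x) * const_fract (\<sigma> y)"
    and "const_fract (\<sigma> 1) = 1" for x y
    by (simp_all add: add mult one const_fract.add const_fract.mult const_fract.one)
  fix p :: "'a poly" assume "p \<noteq> 0"
  moreover have "map_poly (\<lambda>c. const_fract (\<sigma> c)) p = map_poly const_fract (map_poly \<sigma> p)"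
    by (simp add: map_poly_map_poly zero const_fract.zero o_def)
  ultimately show "poly (map_poly (\<lambda>c. const_fract (\<sigma> c)) p) (inverse indet) \<noteq> 0"
    using poly_const_fract_inverse_indet map_poly_nonzero by metis
qed

interpretation id_embedding: field_embedding "\<lambda>c :: 'k::field. c"
  by unfold_locales simp_all

interpretation bar_A_eval: transcendental_evaluation "const_fract :: rat \<Rightarrow> qv" "inverse indet"
  using transcendental_evaluation_inverse_indet[OF id_embedding.field_embedding_axioms] .

interpretation bar_A: field_embedding bar_A
  unfolding bar_A_def var_v_def by (rule bar_A_eval.fract_eval_embedding)

lemma bar_A_var_v: "bar_A var_v = inverse var_v"
  by (simp add: bar_A_def bar_A_eval.fract_eval_indet var_v_def)

lemma bar_A_const: "bar_A (const_fract c) = const_fract c"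
  by (simp add: bar_A_def bar_A_eval.fract_eval_const var_v_def)

text \<open>Applied twice, the map fixes constants and the indeterminate, hence all polynomials in
  it; \<open>poly_const_fract_indet\<close> brings numerator and denominator into this form.\<close>

lemma bar_A_bar_A: "bar_A (bar_A r) = r"
proof -
  have poly: "bar_A (bar_A (poly (map_poly const_fract p) indet)) = poly (map_poly const_fract p) indet"
    for p :: "rat poly"
    by (induction p)
      (simp_all add: map_poly_pCons const_fract.zero bar_A.zero bar_A.add bar_A.mult bar_A_const
        bar_A_var_v[unfolded var_v_def] bar_A.inverse)
  obtain p q where "r = Fract p q" "q \<noteq> 0" by (cases r)
  then have "r = Fract p 1 / Fract q 1" by simp
  then show ?thesis
    using poly[of p] poly[of q] by (simp only: poly_const_fract_indet bar_A.divide)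
qed

interpretation bar_R_eval: transcendental_evaluation "\<lambda>c. A_to_R (bar_A c)" "inverse indet"
  by (rule transcendental_evaluation_inverse_indet) (rule bar_A.field_embedding_axioms)

interpretation bar_R: field_embedding bar_R
  unfolding bar_R_def var_a_def by (rule bar_R_eval.fract_eval_embedding)

lemma bar_R_A_to_R: "bar_R (A_to_R c) = A_to_R (bar_A c)"
  by (simp add: bar_R_def bar_R_eval.fract_eval_const var_a_def)

lemma bar_R_inverse_var_a: "bar_R (inverse var_a) = var_a"
  by (simp add: bar_R.inverse) (simp add: bar_R_def bar_R_eval.fract_eval_indet var_a_def)

text \<open>The coefficient q in the form t_s^2 = 1 + q t_s of the quadratic relation, and also the
  Markov constant \<mu>.\<close>

definition var_q :: qv where
  "var_q = var_v - inverse var_v"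

lemma bar_A_var_q: "bar_A var_q = - var_q"
  by (simp add: var_q_def bar_A.diff bar_A_var_v bar_A.inverse)

lemma var_v_nonzero: "var_v \<noteq> 0"
  by (simp add: var_v_def indet_nonzero)

section \<open>Monoid algebras\<close>

lemma carrier_monoid_algebra: "carrier (monoid_algebra G) = {f. keys f \<subseteq> carrier G}"
  and zero_monoid_algebra [simp]: "\<zero>\<^bsub>monoid_algebra G\<^esub> = 0"
  and one_monoid_algebra: "\<one>\<^bsub>monoid_algebra G\<^esub> = single \<one>\<^bsub>G\<^esub> 1"
  and add_monoid_algebra [simp]: "f \<oplus>\<^bsub>monoid_algebra G\<^esub> g = f + g"
  by (simp_all add: monoid_algebra_def)

text \<open>Supports may shrink under addition; with common finite index sets, bilinearity becomes
  distributivity of sums.\<close>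

lemma mult_monoid_algebra_superset:
  assumes "finite A" "finite B" "keys f \<subseteq> A" "keys g \<subseteq> B"
  shows "f \<otimes>\<^bsub>monoid_algebra G\<^esub> g = (\<Sum>x\<in>A. \<Sum>y\<in>B. single (x \<otimes>\<^bsub>G\<^esub> y) (lookup f x * lookup g y))"
proof -
  have "f \<otimes>\<^bsub>monoid_algebra G\<^esub> g =
      (\<Sum>x\<in>keys f. \<Sum>y\<in>keys g. single (x \<otimes>\<^bsub>G\<^esub> y) (lookup f x * lookup g y))"
    by (simp add: monoid_algebra_def)
  also have "\<dots> = (\<Sum>x\<in>keys f. \<Sum>y\<in>B. single (x \<otimes>\<^bsub>G\<^esub> y) (lookup f x * lookup g y))"
    by (intro sum.cong refl sum.mono_neutral_left) (use assms in \<open>auto simp: in_keys_iff\<close>)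
  also have "\<dots> = (\<Sum>x\<in>A. \<Sum>y\<in>B. single (x \<otimes>\<^bsub>G\<^esub> y) (lookup f x * lookup g y))"
    by (intro sum.mono_neutral_left) (use assms in \<open>auto simp: in_keys_iff\<close>)
  finally show ?thesis .
qed

lemma mult_monoid_algebra_add_left:
  "(f + f') \<otimes>\<^bsub>monoid_algebra G\<^esub> g = f \<otimes>\<^bsub>monoid_algebra G\<^esub> g + f' \<otimes>\<^bsub>monoid_algebra G\<^esub> g"
proof -
  let ?A = "keys f \<union> keys f' \<union> keys (f + f')" and ?B = "keys g"
  show ?thesis
    by (subst (1 2 3) mult_monoid_algebra_superset[of ?A ?B])
      (auto simp: lookup_add distrib_right single_add sum.distrib)
qed

lemma mult_monoid_algebra_add_right:
  "g \<otimes>\<^bsub>monoid_algebra G\<^esub> (f + f') = g \<otimes>\<^bsub>monoid_algebra G\<^esub> f + g \<otimes>\<^bsub>monoid_algebra G\<^esub> f'"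
proof -
  let ?A = "keys f \<union> keys f' \<union> keys (f + f')" and ?B = "keys g"
  show ?thesis
    by (subst (1 2 3) mult_monoid_algebra_superset[of ?B ?A])
      (auto simp: lookup_add distrib_left single_add sum.distrib)
qed

lemma mult_monoid_algebra_single:
  "single x a \<otimes>\<^bsub>monoid_algebra G\<^esub> single y b = single (x \<otimes>\<^bsub>G\<^esub> y) (a * b)"
  by (simp add: mult_monoid_algebra_superset[of "{x}" "{y}"])

lemma single_carrier_monoid_algebra: "x \<in> carrier G \<Longrightarrow> single x a \<in> carrier (monoid_algebra G)"
  by (simp add: carrier_monoid_algebra)

lemma add_carrier_monoid_algebra:
  "f \<in> carrier (monoid_algebra G) \<Longrightarrow> g \<in> carrier (monoid_algebra G) \<Longrightarrow> f + g \<in> carrier (monoid_algebra G)"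
  using Poly_Mapping.keys_add[of f g] by (auto simp: carrier_monoid_algebra)

text \<open>Zero needs no case of its own, being \<open>single x 0\<close> for some \<open>x\<close>
  in \<open>C\<close>; this is where \<open>C\<close> must be inhabited.\<close>

lemma poly_mapping_carrier_induct [consumes 2, case_names single add]:
  assumes f: "keys f \<subseteq> C" and ne: "C \<noteq> {}"
    and single: "\<And>x a. x \<in> C \<Longrightarrow> P (single x a)"
    and add: "\<And>f g. keys f \<subseteq> C \<Longrightarrow> keys g \<subseteq> C \<Longrightarrow> P f \<Longrightarrow> P g \<Longrightarrow> P (f + g)"
  shows "P (f :: 'a \<Rightarrow>\<^sub>0 'b::comm_monoid_add)"
proof -
  have "keys (\<Sum>x\<in>A. single x (lookup f x)) \<subseteq> C \<and> P (\<Sum>x\<in>A. single x (lookup f x))"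
    if "finite A" "A \<subseteq> C" for A
    using that
  proof (induction A)
    case empty
    then show ?case using ne single[of _ 0] by (auto simp: single_zero)
  next
    case (insert x A)
    have "keys (single x (lookup f x) + (\<Sum>x\<in>A. single x (lookup f x))) \<subseteq> C"
      using Poly_Mapping.keys_add[of "single x (lookup f x)" "\<Sum>x\<in>A. single x (lookup f x)"] insert
      by (auto split: if_splits)
    then show ?case using insert by (auto intro!: add single split: if_splits)
  qed
  moreover have "(\<Sum>x\<in>keys f. single x (lookup f x)) = f"
    by (rule poly_mapping_eqI) (simp add: lookup_sum lookup_single when_def in_keys_iff)
  ultimately show ?thesis using f by (metis finite_keys)
qed

context monoid
begin

lemma mult_carrier_monoid_algebra:
  assumes f: "f \<in> carrier (monoid_algebra G)" and g: "g \<in> carrier (monoid_algebra G)"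
  shows "f \<otimes>\<^bsub>monoid_algebra G\<^esub> g \<in> carrier (monoid_algebra G)"
proof -
  have ne: "carrier G \<noteq> {}" by auto
  from f have "keys f \<subseteq> carrier G" by (simp add: carrier_monoid_algebra)
  then show ?thesis
    using ne
  proof (induction f rule: poly_mapping_carrier_induct)
    case (single x a)
    from g have "keys g \<subseteq> carrier G" by (simp add: carrier_monoid_algebra)
    then show ?case
      using ne
    proof (induction g rule: poly_mapping_carrier_induct)
      case (single y b)
      then show ?case using \<open>x \<in> carrier G\<close>
        by (simp add: mult_monoid_algebra_single single_carrier_monoid_algebra)
    qed (simp add: mult_monoid_algebra_add_right add_carrier_monoid_algebra)
  qed (simp add: mult_monoid_algebra_add_left add_carrier_monoid_algebra)
qed

lemma mult_assoc_monoid_algebra: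
  assumes "f \<in> carrier (monoid_algebra G)" "g \<in> carrier (monoid_algebra G)" "h \<in> carrier (monoid_algebra G)"
  shows "f \<otimes>\<^bsub>monoid_algebra G\<^esub> g \<otimes>\<^bsub>monoid_algebra G\<^esub> h = f \<otimes>\<^bsub>monoid_algebra G\<^esub> (g \<otimes>\<^bsub>monoid_algebra G\<^esub> h)"
proof -
  have ne: "carrier G \<noteq> {}" by auto
  have "keys f \<subseteq> carrier G" "keys g \<subseteq> carrier G" "keys h \<subseteq> carrier G"
    using assms by (simp_all add: carrier_monoid_algebra)
  from this(1) ne show ?thesis
  proof (induction f rule: poly_mapping_carrier_induct)
    case (single x a)
    from \<open>keys g \<subseteq> carrier G\<close> ne show ?case
    proof (induction g rule: poly_mapping_carrier_induct)
      case (single y b)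
      from \<open>keys h \<subseteq> carrier G\<close> ne show ?case
      proof (induction h rule: poly_mapping_carrier_induct)
        case (single z c)
        then show ?case using \<open>x \<in> carrier G\<close> \<open>y \<in> carrier G\<close>
          by (simp add: mult_monoid_algebra_single m_assoc mult.assoc)
      qed (simp add: mult_monoid_algebra_add_right)
    qed (simp add: mult_monoid_algebra_add_left mult_monoid_algebra_add_right)
  qed (simp add: mult_monoid_algebra_add_left)
qed

lemma monoid_algebra_one_left:
  assumes "f \<in> carrier (monoid_algebra G)"
  shows "\<one>\<^bsub>monoid_algebra G\<^esub> \<otimes>\<^bsub>monoid_algebra G\<^esub> f = f"
proof -
  have "keys f \<subseteq> carrier G" "carrier G \<noteq> {}"
    using assms one_closed by (auto simp: carrier_monoid_algebra simp del: one_closed)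
  then show ?thesis
    by (induction f rule: poly_mapping_carrier_induct)
      (simp_all add: one_monoid_algebra mult_monoid_algebra_single mult_monoid_algebra_add_right)
qed

lemma monoid_algebra_one_right:
  assumes "f \<in> carrier (monoid_algebra G)"
  shows "f \<otimes>\<^bsub>monoid_algebra G\<^esub> \<one>\<^bsub>monoid_algebra G\<^esub> = f"
proof -
  have "keys f \<subseteq> carrier G" "carrier G \<noteq> {}"
    using assms one_closed by (auto simp: carrier_monoid_algebra simp del: one_closed)
  then show ?thesis
    by (induction f rule: poly_mapping_carrier_induct)
      (simp_all add: one_monoid_algebra mult_monoid_algebra_single mult_monoid_algebra_add_left)
qed

lemma ring_monoid_algebra: "ring (monoid_algebra G :: ('a \<Rightarrow>\<^sub>0 'k::comm_ring_1) ring)"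
proof (rule ringI)
  show "abelian_group (monoid_algebra G :: ('a \<Rightarrow>\<^sub>0 'k) ring)"
  proof (rule abelian_groupI)
    fix x :: "'a \<Rightarrow>\<^sub>0 'k" assume "x \<in> carrier (monoid_algebra G)"
    then show "\<exists>y\<in>carrier (monoid_algebra G). y \<oplus>\<^bsub>monoid_algebra G\<^esub> x = \<zero>\<^bsub>monoid_algebra G\<^esub>"
      by (intro bexI[of _ "- x"]) (simp_all add: carrier_monoid_algebra)
  qed (auto simp: add_carrier_monoid_algebra carrier_monoid_algebra[of G] add.assoc add.commute
      intro: add_carrier_monoid_algebra[unfolded carrier_monoid_algebra, simplified, THEN subsetD])
  show "monoid (monoid_algebra G :: ('a \<Rightarrow>\<^sub>0 'k) ring)"
    by (rule monoidI) (fact mult_carrier_monoid_algebra mult_assoc_monoid_algebra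
        monoid_algebra_one_left monoid_algebra_one_right
      | simp add: single_carrier_monoid_algebra one_monoid_algebra[of G])+
qed (simp_all add: mult_monoid_algebra_add_left mult_monoid_algebra_add_right)

end

lemma carrier_free_monoid [simp]: "carrier (free_monoid S) = lists S"
  and mult_free_monoid [simp]: "x \<otimes>\<^bsub>free_monoid S\<^esub> y = x @ y"
  and one_free_monoid [simp]: "\<one>\<^bsub>free_monoid S\<^esub> = []"
  by (simp_all add: free_monoid_def)

lemma monoid_free_monoid: "monoid (free_monoid S)"
  by unfold_locales auto

lemma ring_free_algebra: "ring (free_algebra S :: ('s list \<Rightarrow>\<^sub>0 'k::comm_ring_1) ring)"
  by (rule monoid.ring_monoid_algebra[OF monoid_free_monoid])

subsection \<open>Semilinear functionals\<close>

text \<open>The twist \<beta> is the identity for linear functionals and \<open>bar_R\<close> for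
  the antilinear slot of the extended pairing.\<close>

definition extend_semilinear :: "('k \<Rightarrow> 'l) \<Rightarrow> ('g \<Rightarrow> 'l) \<Rightarrow> ('g \<Rightarrow>\<^sub>0 'k::zero) \<Rightarrow> 'l::comm_ring_1" where
  "extend_semilinear \<beta> \<phi> f = (\<Sum>x\<in>keys f. \<beta> (lookup f x) * \<phi> x)"

lemma extend_semilinear_single: "\<beta> 0 = 0 \<Longrightarrow> extend_semilinear \<beta> \<phi> (single x a) = \<beta> a * \<phi> x"
  by (auto simp: extend_semilinear_def)

lemma extend_semilinear_add:
  assumes "\<beta> 0 = 0" "\<And>a b. \<beta> (a + b) = \<beta> a + \<beta> b"
  shows "extend_semilinear \<beta> \<phi> (f + g) = extend_semilinear \<beta> \<phi> f + extend_semilinear \<beta> \<phi> g"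
proof -
  have superset: "extend_semilinear \<beta> \<phi> h = (\<Sum>x\<in>A. \<beta> (lookup h x) * \<phi> x)" if "finite A" "keys h \<subseteq> A" for A h
    unfolding extend_semilinear_def
    by (intro sum.mono_neutral_left) (use that assms in \<open>auto simp: in_keys_iff\<close>)
  let ?A = "keys f \<union> keys g \<union> keys (f + g)"
  show ?thesis
    by (subst (1 2 3) superset[of ?A]) (auto simp: lookup_add assms distrib_right sum.distrib)
qed

lemma extend_semilinear_zero: "extend_semilinear \<beta> \<phi> 0 = 0"
  by (simp add: extend_semilinear_def)

section \<open>Words in Coxeter groups\<close>

declare in_listsD [rule del] in_listsI [rule del]

section \<open>Alternating words and braid moves\<close>

lemma rev_in_lists [simp]: "rev x \<in> lists S \<longleftrightarrow> x \<in> lists S"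
  by (simp add: in_lists_conv_set)

lemma alternating_word_double: "alternating_word s t (2 * k) = concat (replicate k [s, t])"
  by (induction k) simp_all

lemma length_alternating_word [simp]: "length (alternating_word s t k) = k"
  by (induction k arbitrary: s t) simp_all

lemma alternating_word_lists: "s \<in> S \<Longrightarrow> t \<in> S \<Longrightarrow> alternating_word s t k \<in> lists S"
  by (induction k arbitrary: s t) simp_all

lemma set_alternating_word: "k \<ge> 2 \<Longrightarrow> set (alternating_word s t k) = {s, t}"
proof (induction k arbitrary: s t)
  case (Suc k)
  then show ?case
    by (cases "k = 1") auto
qed simp

lemma alternating_word_append:
  "alternating_word s t (2 * k + l) = alternating_word s t (2 * k) @ alternating_word s t l"
  by (induction k) simp_all

lemma alternating_word_odd_snoc:
  "alternating_word s t (Suc (Suc (2 * k))) = alternating_word s t (Suc (2 * k)) @ [t]"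
  by (induction k arbitrary: s t) simp_all

lemma alternating_word_snoc:
  "alternating_word s t (Suc k) = alternating_word s t k @ [if even k then s else t]"
  by (induction k arbitrary: s t) auto

lemma rev_alternating_word:
  "rev (alternating_word s t k) = (if even k then alternating_word t s k else alternating_word s t k)"
proof (induction k arbitrary: s t)
  case (Suc k)
  show ?case
    using Suc[of t s] Suc[of s t] alternating_word_snoc[of s t k] alternating_word_snoc[of t s k] by auto
qed simp

text \<open>No label set occurs, and the bound 2 makes both sides of a move use the same two
  letters. A chain of moves therefore never leaves the alphabet of its first word, which is what the
  parabolic arguments rely on.\<close>

inductive braid_eq :: "('s \<Rightarrow> 's \<Rightarrow> nat) \<Rightarrow> 's list \<Rightarrow> 's list \<Rightarrow> bool" for m where
  refl: "braid_eq m x x"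
| sym: "braid_eq m x y \<Longrightarrow> braid_eq m y x"
| trans: "braid_eq m x y \<Longrightarrow> braid_eq m y z \<Longrightarrow> braid_eq m x z"
| rel: "s \<noteq> t \<Longrightarrow> m s t \<ge> 2 \<Longrightarrow> braid_eq m (u @ alternating_word s t (m s t) @ v) (u @ alternating_word t s (m s t) @ v)"

lemma braid_eq_context: "braid_eq m x y \<Longrightarrow> braid_eq m (u @ x @ v) (u @ y @ v)"
proof (induction rule: braid_eq.induct)
  case (rel s t u' v')
  then show ?case
    using braid_eq.rel[of s t m "u @ u'" "v' @ v"] by simp
qed (blast intro: braid_eq.refl braid_eq.sym braid_eq.trans)+

lemma braid_eq_append: "braid_eq m x x' \<Longrightarrow> braid_eq m y y' \<Longrightarrow> braid_eq m (x @ y) (x' @ y')"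
  using braid_eq_context[of m x x' "[]" y] braid_eq_context[of m y y' x' "[]"]
  by (auto intro: braid_eq.trans)

lemma braid_eq_Cons: "braid_eq m x y \<Longrightarrow> braid_eq m (s # x) (s # y)"
  using braid_eq_context[of m x y "[s]" "[]"] by simp

lemma braid_eq_set: "braid_eq m x y \<Longrightarrow> set x = set y"
  by (induction rule: braid_eq.induct) (auto simp: set_alternating_word)

lemma braid_eq_lists: "braid_eq m x y \<Longrightarrow> x \<in> lists S \<Longrightarrow> y \<in> lists S"
  using braid_eq_set by (metis in_lists_conv_set)

lemma braid_eq_length: "braid_eq m x y \<Longrightarrow> length x = length y"
  by (induction rule: braid_eq.induct) auto

text \<open>The assumption \<open>order\<close> makes the entry m s t the exact order of st, where
  the presentation by itself only makes it a multiple. By \<open>m_ge_2\<close> no entry is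
  infinite.\<close>

locale coxeter_words =
  fixes S :: "'s set" and m :: "'s \<Rightarrow> 's \<Rightarrow> nat"
  assumes m_diag: "s \<in> S \<Longrightarrow> m s s = 1"
    and m_sym: "s \<in> S \<Longrightarrow> t \<in> S \<Longrightarrow> m s t = m t s"
    and m_ge_2: "s \<in> S \<Longrightarrow> t \<in> S \<Longrightarrow> s \<noteq> t \<Longrightarrow> m s t \<ge> 2"
    and order: "s \<in> S \<Longrightarrow> t \<in> S \<Longrightarrow> s \<noteq> t \<Longrightarrow> 0 < i \<Longrightarrow> i < m s t \<Longrightarrow>
      \<not> cox_eq S m (alternating_word s t (2 * i)) []"
begin

abbreviation eq :: "'s list \<Rightarrow> 's list \<Rightarrow> bool" (infix "\<approx>" 50) where
  "x \<approx> y \<equiv> cox_eq S m x y"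

section \<open>The congruence on words given by the presentation\<close>

lemma eq_lists: "x \<approx> y \<Longrightarrow> x \<in> lists S \<and> y \<in> lists S"
proof (induction rule: cox_eq.induct)
  case (rel us vs s t)
  then show ?case
    using alternating_word_lists[of s S t "2 * m s t"] by (simp add: alternating_word_double)
qed auto

lemma eq_lists1: "x \<approx> y \<Longrightarrow> x \<in> lists S" and eq_lists2: "x \<approx> y \<Longrightarrow> y \<in> lists S"
  using eq_lists by auto

lemma eq_context: "x \<approx> y \<Longrightarrow> u \<in> lists S \<Longrightarrow> v \<in> lists S \<Longrightarrow> u @ x @ v \<approx> u @ y @ v"
proof (induction rule: cox_eq.induct)
  case (refl xs)
  then show ?case by (auto intro: cox_eq.refl)
next
  case (rel us vs s t)
  then show ?case
    using cox_eq.rel[of "u @ us" S "vs @ v" s t m] by simp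
qed (blast intro: cox_eq.sym cox_eq.trans)+

lemma eq_append: "x \<approx> x' \<Longrightarrow> y \<approx> y' \<Longrightarrow> x @ y \<approx> x' @ y'"
  using eq_context[of x x' "[]" y] eq_context[of y y' x' "[]"] eq_lists[of x x'] eq_lists[of y y']
  by (auto intro: cox_eq.trans)

lemma eq_append_left: "x \<approx> y \<Longrightarrow> u \<in> lists S \<Longrightarrow> u @ x \<approx> u @ y"
  by (simp add: cox_eq.refl eq_append)

lemma eq_append_right: "x \<approx> y \<Longrightarrow> u \<in> lists S \<Longrightarrow> x @ u \<approx> y @ u"
  by (simp add: cox_eq.refl eq_append)

lemma eq_Cons: "x \<approx> y \<Longrightarrow> s \<in> S \<Longrightarrow> s # x \<approx> s # y"
  using eq_append_left[of x y "[s]"] by simp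

lemma eq_square: "s \<in> S \<Longrightarrow> x \<in> lists S \<Longrightarrow> s # s # x \<approx> x"
  using cox_eq.rel[of "[]" S x s s m] by (simp add: m_diag)

lemma eq_rev_append: "x \<in> lists S \<Longrightarrow> rev x @ x \<approx> []"
proof (induction x)
  case (Cons s x)
  have "rev x @ (s # s # x) \<approx> rev x @ x"
    using Cons by (intro eq_append_left eq_square) auto
  then show ?case using Cons by (auto intro: cox_eq.trans)
qed (auto intro: cox_eq.refl)

lemma eq_append_rev: "x \<in> lists S \<Longrightarrow> x @ rev x \<approx> []"
  using eq_rev_append[of "rev x"] by simp

lemma eq_append_cancel:
  assumes "u @ x \<approx> u @ y"
  shows "x \<approx> y"
proof -
  have l: "u \<in> lists S" "x \<in> lists S" "y \<in> lists S" using eq_lists[OF assms] by auto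
  then have "rev u @ (u @ x) \<approx> rev u @ (u @ y)"
    using eq_append_left[OF assms, of "rev u"] by simp
  moreover have "rev u @ u @ x \<approx> x" "rev u @ u @ y \<approx> y"
    using eq_append_right[OF eq_rev_append[of u], of x] eq_append_right[OF eq_rev_append[of u], of y] l
    by simp_all
  ultimately show ?thesis by (blast intro: cox_eq.sym cox_eq.trans)
qed

lemma eq_append_cancel_right:
  assumes "x @ u \<approx> y @ u"
  shows "x \<approx> y"
proof -
  have l: "u \<in> lists S" "x \<in> lists S" "y \<in> lists S" using eq_lists[OF assms] by auto
  then have "(x @ u) @ rev u \<approx> (y @ u) @ rev u"
    using eq_append_right[OF assms, of "rev u"] by simp
  moreover have "(x @ u) @ rev u \<approx> x" "(y @ u) @ rev u \<approx> y"
    using eq_append_left[OF eq_append_rev[of u], of x] eq_append_left[OF eq_append_rev[of u], of y] l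
    by simp_all
  ultimately show ?thesis by (blast intro: cox_eq.sym cox_eq.trans)
qed

lemma eq_Cons_swap:
  assumes "s # x \<approx> y"
  shows "x \<approx> s # y"
proof -
  have l: "s \<in> S" "x \<in> lists S" using eq_lists[OF assms] by auto
  show ?thesis using eq_Cons[OF assms l(1)] eq_square[OF l] by (blast intro: cox_eq.sym cox_eq.trans)
qed

lemma eq_snoc_swap:
  assumes "x @ [s] \<approx> y"
  shows "x \<approx> y @ [s]"
proof -
  have l: "s \<in> S" "x \<in> lists S" using eq_lists[OF assms] by auto
  have "(x @ [s]) @ [s] \<approx> x" using eq_append_left[OF eq_append_rev[of "[s]"], of x] l by simp
  then show ?thesis
    using eq_append_right[OF assms, of "[s]"] l by (auto intro: cox_eq.sym cox_eq.trans)
qed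

lemma eq_rev: "x \<approx> y \<Longrightarrow> rev x \<approx> rev y"
proof (induction rule: cox_eq.induct)
  case (rel us vs s t)
  have "rev (concat (replicate k [s, t])) = concat (replicate k [t, s])" for k
  proof (induction k)
    case (Suc k)
    have "concat (replicate (Suc k) [t, s]) = concat (replicate k [t, s] @ [[t, s]])"
      by (simp only: replicate_append_same) simp
    then show ?case using Suc by simp
  qed simp
  then show ?case
    using cox_eq.rel[of "rev vs" S "rev us" t s m] rel by (simp add: m_sym[of s t])
qed (auto intro: cox_eq.refl cox_eq.sym cox_eq.trans)

lemma eq_parity: "x \<approx> y \<Longrightarrow> even (length x) = even (length y)"
proof (induction rule: cox_eq.induct)
  case (rel us vs s t)
  have "even (length (concat (replicate (m s t) [s, t])))"
    using length_alternating_word[of s t "2 * m s t"] by (simp add: alternating_word_double)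
  then show ?case by simp
qed auto

section \<open>Length and reduced words\<close>

definition len :: "'s list \<Rightarrow> nat" where
  "len x = (LEAST k. \<exists>y. x \<approx> y \<and> length y = k)"

definition reduced :: "'s list \<Rightarrow> bool" where
  "reduced x \<longleftrightarrow> x \<in> lists S \<and> len x = length x"

lemma len_le: "x \<approx> y \<Longrightarrow> len x \<le> length y"
  unfolding len_def by (rule Least_le) auto

lemma len_cong: "x \<approx> y \<Longrightarrow> len x = len y"
proof -
  assume "x \<approx> y"
  then have "x \<approx> z \<longleftrightarrow> y \<approx> z" for z by (blast intro: cox_eq.sym cox_eq.trans)
  then show ?thesis by (simp add: len_def)
qed

lemma len_le_length: "x \<in> lists S \<Longrightarrow> len x \<le> length x"
  by (simp add: cox_eq.refl len_le)

lemma len_Nil [simp]: "len [] = 0"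
  using len_le_length[of "[]"] by simp

lemma ex_reduced:
  assumes "x \<in> lists S"
  shows "\<exists>y. x \<approx> y \<and> reduced y \<and> length y = len x"
proof -
  have "\<exists>y. x \<approx> y \<and> length y = len x"
    unfolding len_def by (rule LeastI_ex) (use assms cox_eq.refl in blast)
  then obtain y where y: "x \<approx> y" "length y = len x" by blast
  moreover have "reduced y" using y eq_lists2[OF y(1)] len_cong[OF y(1)] by (simp add: reduced_def)
  ultimately show ?thesis by blast
qed

lemma reduced_lists: "reduced x \<Longrightarrow> x \<in> lists S"
  by (simp add: reduced_def)

lemma reducedI: "x \<approx> y \<Longrightarrow> length x \<le> len y \<Longrightarrow> reduced x"
  using len_cong[of x y] len_le_length[of x] eq_lists1[of x y] by (simp add: reduced_def)

lemma reduced_transfer: "reduced x \<Longrightarrow> x \<approx> y \<Longrightarrow> length y = length x \<Longrightarrow> reduced y"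
  using len_cong[of x y] by (simp add: reduced_def eq_lists2)

lemma len_append: "x \<in> lists S \<Longrightarrow> y \<in> lists S \<Longrightarrow> len (x @ y) \<le> len x + len y"
proof -
  assume l: "x \<in> lists S" "y \<in> lists S"
  obtain x' where x': "x \<approx> x'" "length x' = len x" using ex_reduced[OF l(1)] by blast
  obtain y' where y': "y \<approx> y'" "length y' = len y" using ex_reduced[OF l(2)] by blast
  show ?thesis using len_le[OF eq_append[OF x'(1) y'(1)]] x' y' by simp
qed

lemma len_parity: "x \<in> lists S \<Longrightarrow> even (len x) = even (length x)"
proof -
  assume x: "x \<in> lists S"
  obtain y where "x \<approx> y" "length y = len x" using ex_reduced[OF x] by blast
  then show ?thesis using eq_parity[of x y] by simp
qed

lemma len_rev: "x \<in> lists S \<Longrightarrow> len (rev x) = len x"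
proof -
  have le: "len (rev x) \<le> len x" if x: "x \<in> lists S" for x
  proof -
    obtain y where "x \<approx> y" "length y = len x" using ex_reduced[OF x] by blast
    then show ?thesis using len_le[OF eq_rev, of x y] by simp
  qed
  assume "x \<in> lists S"
  then show ?thesis using le[of x] le[of "rev x"] by simp
qed

lemma reduced_rev: "reduced (rev x) \<longleftrightarrow> reduced x"
  by (auto simp: reduced_def len_rev)

lemma len_le_Cons: 
  assumes "s \<in> S" "x \<in> lists S"
  shows "len x \<le> Suc (len (s # x))" "len (s # x) \<le> Suc (len x)"
proof -
  have s: "len [s] \<le> 1" using len_le_length[of "[s]"] assms by simp
  show "len (s # x) \<le> Suc (len x)" using len_append[of "[s]" x] assms s by simp
  have "len (s # s # x) = len x" using len_cong[OF eq_square] assms by simp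
  then show "len x \<le> Suc (len (s # x))" using len_append[of "[s]" "s # x"] assms s by simp
qed

lemma len_Cons_cases:
  assumes "s \<in> S" "x \<in> lists S"
  shows "len (s # x) = Suc (len x) \<or> len x = Suc (len (s # x))"
proof -
  have "even (len (s # x)) \<noteq> even (len x)" using len_parity[of "s # x"] len_parity[of x] assms by simp
  then show ?thesis using len_le_Cons[OF assms] by (metis le_Suc_eq le_antisym)
qed

lemma len_snoc_cases:
  assumes "s \<in> S" "x \<in> lists S"
  shows "len (x @ [s]) = Suc (len x) \<or> len x = Suc (len (x @ [s]))"
  using len_Cons_cases[of s "rev x"] len_rev[of "x @ [s]"] len_rev[of x] assms by simp

lemma reduced_append:
  assumes "reduced (x @ y)"
  shows "reduced x" "reduced y"
proof -
  have l: "x \<in> lists S" "y \<in> lists S" using reduced_lists[OF assms] by auto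
  have "length x + length y \<le> len x + len y"
    using len_append[OF l] assms by (simp add: reduced_def)
  moreover have "len x \<le> length x" "len y \<le> length y" using l len_le_length by auto
  ultimately show "reduced x" "reduced y" using l by (simp_all add: reduced_def)
qed

lemma reduced_Cons: "reduced (s # x) \<Longrightarrow> reduced x"
  using reduced_append(2)[of "[s]" x] by simp

lemma reduced_Nil [simp]: "reduced []"
  by (simp add: reduced_def)

lemma reduced_eq_Nil: "reduced x \<Longrightarrow> x \<approx> [] \<longleftrightarrow> x = []"
  using len_cong[of x "[]"] by (auto simp: reduced_def cox_eq.refl)

lemma reduced_Cons_iff: "s \<in> S \<Longrightarrow> reduced x \<Longrightarrow> reduced (s # x) \<longleftrightarrow> len (s # x) > len x"
proof -
  assume *: "s \<in> S" "reduced x"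
  then have "reduced (s # x) \<longleftrightarrow> len (s # x) = Suc (len x)" by (simp add: reduced_def)
  then show ?thesis using len_Cons_cases[OF *(1) reduced_lists[OF *(2)]] by linarith
qed

text \<open>How often \<open>r\<close> occurs among the reflections \<open>u s u\<^sup>-\<^sup>1\<close>, where \<open>u s\<close> runs over the nonempty
  prefixes of \<open>x\<close>. The parity depends only on the group elements of \<open>x\<close> and \<open>r\<close>, which yields the
  exchange condition.\<close>

fun refl_count :: "'s list \<Rightarrow> 's list \<Rightarrow> nat" where
  "refl_count [] r = 0"
| "refl_count (s # x) r = (if r \<approx> [s] then 1 else 0) + refl_count x (s # r @ [s])"

lemma refl_count_cong: "r \<approx> r' \<Longrightarrow> x \<in> lists S \<Longrightarrow> refl_count x r = refl_count x r'"
proof (induction x arbitrary: r r')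
  case (Cons s x)
  have "(r \<approx> [s]) = (r' \<approx> [s])" using Cons.prems(1) by (blast intro: cox_eq.sym cox_eq.trans)
  moreover have "s # r @ [s] \<approx> s # r' @ [s]"
    using eq_context[OF Cons.prems(1), of "[s]" "[s]"] Cons.prems by simp
  ultimately show ?case using Cons by simp
qed simp

lemma refl_count_append: "refl_count (x @ y) r = refl_count x r + refl_count y (rev x @ r @ x)"
  by (induction x arbitrary: r) simp_all

lemma conj_swap: "s # r @ [s] \<approx> x \<longleftrightarrow> r \<approx> s # x @ [s]"
proof
  assume *: "s # r @ [s] \<approx> x"
  then have "r @ [s] \<approx> s # x" by (rule eq_Cons_swap)
  then show "r \<approx> s # x @ [s]" using eq_snoc_swap by fastforce
next
  assume "r \<approx> s # x @ [s]"
  then have "s # x @ [s] \<approx> r" by (rule cox_eq.sym)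
  then have "x @ [s] \<approx> s # r" by (rule eq_Cons_swap)
  then have "x \<approx> s # r @ [s]" using eq_snoc_swap by fastforce
  then show "s # r @ [s] \<approx> x" by (rule cox_eq.sym)
qed

text \<open>The reflections read off an alternating word are the alternating words of odd length:
  conjugation by the new first letter adds one letter at each end.\<close>

lemma refl_count_alternating_word:
  assumes "s \<in> S" "t \<in> S"
  shows "refl_count (alternating_word s t k) r = (\<Sum>j<k. if r \<approx> alternating_word s t (Suc (2 * j)) then 1 else 0)"
  using assms
proof (induction k arbitrary: s t r)
  case (Suc k)
  have "(s # r @ [s] \<approx> alternating_word t s (Suc (2 * j))) = (r \<approx> alternating_word s t (Suc (2 * Suc j)))" for j
  proof -
    have "s # alternating_word t s (Suc (2 * j)) @ [s] = alternating_word s t (Suc (2 * Suc j))"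
      using alternating_word_odd_snoc[of t s j] by simp
    then show ?thesis using conj_swap[of s r "alternating_word t s (Suc (2 * j))"] by simp
  qed
  then show ?case using Suc by (subst sum.lessThan_Suc_shift) simp
qed simp

text \<open>The word (st)^m has 2m reflections, and the list of them has period m, so each is
  counted an even number of times.\<close>

lemma even_refl_count_relation:
  assumes "s \<in> S" "t \<in> S"
  shows "even (refl_count (concat (replicate (m s t) [s, t])) r)"
proof -
  let ?b = "\<lambda>j. if r \<approx> alternating_word s t (Suc (2 * j)) then 1 else 0 :: nat"
  have shift: "?b (m s t + j) = ?b j" for j
  proof -
    have "concat (replicate (m s t) [s, t]) @ alternating_word s t (Suc (2 * j)) \<approx> alternating_word s t (Suc (2 * j))"
      using cox_eq.rel[of "[]" S "alternating_word s t (Suc (2 * j))" s t m] assms alternating_word_lists[of s S t]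
      by (simp del: alternating_word.simps)
    then have "alternating_word s t (Suc (2 * (m s t + j))) \<approx> alternating_word s t (Suc (2 * j))"
      using alternating_word_append[of s t "m s t" "Suc (2 * j)"]
      by (simp add: alternating_word_double algebra_simps)
    then show ?thesis by (metis cox_eq.sym cox_eq.trans)
  qed
  have "refl_count (concat (replicate (m s t) [s, t])) r = (\<Sum>j<m s t + m s t. ?b j)"
    using refl_count_alternating_word[OF assms, of "2 * m s t" r]
    unfolding alternating_word_double by (simp only: mult_2)
  also have "\<dots> = (\<Sum>j<m s t. ?b j) + (\<Sum>j<m s t. ?b (m s t + j))"
  proof -
    have "(\<Sum>j<a + b. f j) = (\<Sum>j<a. f j) + (\<Sum>j<b. f (a + j))" for a b and f :: "nat \<Rightarrow> nat"
      by (induction b) simp_all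
    then show ?thesis .
  qed
  finally show ?thesis by (simp only: shift even_add)
qed

lemma refl_count_parity: "x \<approx> y \<Longrightarrow> r \<in> lists S \<Longrightarrow> even (refl_count x r) = even (refl_count y r)"
proof (induction rule: cox_eq.induct)
  case (rel us vs s t)
  let ?w = "concat (replicate (m s t) [s, t])"
  have w: "?w \<approx> []" using cox_eq.rel[of "[]" S "[]" s t m] rel by simp
  have "rev us @ r @ us \<in> lists S" using rel by auto
  then have "rev ?w @ (rev us @ r @ us) @ ?w \<approx> rev us @ r @ us"
    using eq_append[OF eq_rev[OF w] eq_append[OF cox_eq.refl[of "rev us @ r @ us"] w]] by simp
  then have "refl_count vs (rev ?w @ (rev us @ r @ us) @ ?w) = refl_count vs (rev us @ r @ us)"
    using rel by (intro refl_count_cong) auto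
  then show ?case using even_refl_count_relation[OF rel(3,4)] by (simp add: refl_count_append)
qed auto

text \<open>Left multiplication by the reflection u a u^-1 attached to a prefix u a cancels the
  letter a.\<close>

lemma refl_count_pos:
  "x \<in> lists S \<Longrightarrow> r \<in> lists S \<Longrightarrow> refl_count x r > 0 \<Longrightarrow> \<exists>u a v. x = u @ a # v \<and> r @ x \<approx> u @ v"
proof (induction x arbitrary: r)
  case (Cons s x)
  show ?case
  proof (cases "r \<approx> [s]")
    case True
    then have "r @ s # x \<approx> [s] @ s # x" using Cons.prems by (intro eq_append_right) auto
    moreover have "[s] @ s # x \<approx> x" using eq_square Cons.prems by simp
    ultimately have "r @ s # x \<approx> [] @ x" by (auto intro: cox_eq.trans)
    then show ?thesis by blast
  next
    case False
    then obtain u a v where *: "x = u @ a # v" "(s # r @ [s]) @ x \<approx> u @ v"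
      using Cons.IH[of "s # r @ [s]"] Cons.prems by auto
    then have "r @ s # x \<approx> (s # u) @ v" using eq_Cons_swap[of s "r @ s # x" "u @ v"] by simp
    then show ?thesis using * by (metis append_Cons)
  qed
qed simp

text \<open>If the reflection of the first letter s occurred again later, s x could be written with
  two letters fewer.\<close>

lemma refl_count_le_1: "reduced x \<Longrightarrow> r \<in> lists S \<Longrightarrow> refl_count x r \<le> 1"
proof (induction x arbitrary: r)
  case (Cons s x)
  have l: "s \<in> S" "x \<in> lists S" using reduced_lists[OF Cons.prems(1)] by auto
  have IH: "refl_count x (s # r @ [s]) \<le> 1"
    using Cons.IH[of "s # r @ [s]"] Cons.prems l reduced_Cons by auto
  show ?case
  proof (rule ccontr)
    assume "\<not> ?case"
    then have r: "r \<approx> [s]" and pos: "refl_count x (s # r @ [s]) > 0" using IH by (auto split: if_splits)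
    obtain u a v where *: "x = u @ a # v" "(s # r @ [s]) @ x \<approx> u @ v"
      using refl_count_pos[OF l(2) _ pos] Cons.prems l by auto
    have "s # r @ [s] \<approx> s # [s] @ [s]" using eq_context[OF r, of "[s]" "[s]"] l by simp
    moreover have "s # [s] @ [s] \<approx> [s]" using eq_square[of s "[s]"] l by simp
    ultimately have "s # r @ [s] \<approx> [s]" by (rule cox_eq.trans)
    then have "(s # r @ [s]) @ x \<approx> [s] @ x" using eq_append_right l by blast
    then have "s # x \<approx> u @ v" using *(2) by (auto intro: cox_eq.sym cox_eq.trans)
    then have "len (s # x) \<le> length (u @ v)" by (rule len_le)
    then show False using Cons.prems *(1) by (simp add: reduced_def)
  qed
qed simp

text \<open>A reduced word of the same element that begins with s counts the reflection s exactly
  once, and the parity carries over to \<open>x\<close> even if \<open>x\<close> is not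
  reduced.\<close>

lemma refl_count_descent:
  assumes "x \<in> lists S" "s \<in> S" "len (s # x) < len x"
  shows "refl_count x [s] > 0"
proof -
  obtain y where y: "s # x \<approx> y" "reduced y" "length y = len (s # x)"
    using ex_reduced[of "s # x"] assms by auto
  have eq: "s # y \<approx> x" using eq_Cons_swap[OF y(1)] cox_eq.sym by blast
  have "reduced (s # y)" using reducedI[OF eq] assms y by simp
  then have "refl_count (s # y) [s] \<le> 1" using assms by (intro refl_count_le_1) simp_all
  moreover have "refl_count (s # y) [s] \<ge> 1" using assms by (simp add: cox_eq.refl)
  ultimately have "odd (refl_count (s # y) [s])" by (metis le_antisym odd_one)
  then show ?thesis using refl_count_parity[OF eq, of "[s]"] assms odd_pos by auto
qed

lemma exchange:
  assumes "x \<in> lists S" "s \<in> S" "len (s # x) < len x"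
  obtains u a v where "x = u @ a # v" "s # x \<approx> u @ v"
  using refl_count_pos[OF assms(1) _ refl_count_descent[OF assms]] assms that by auto

text \<open>If prepending s to the shorter word destroyed reducedness, s would be one of the
  reflections of that word. This gives (st)^(j+1) = 1 with j + 1 below the entry, against
  \<open>order\<close>.\<close>

lemma reduced_alternating_word:
  assumes "s \<in> S" "t \<in> S" "s \<noteq> t" "k \<le> m s t"
  shows "reduced (alternating_word s t k)"
  using assms
proof (induction k arbitrary: s t)
  case (Suc k)
  have red: "reduced (alternating_word t s k)" using Suc m_sym by simp
  then have l: "alternating_word t s k \<in> lists S" by (rule reduced_lists)
  show ?case
  proof (rule ccontr)
    assume "\<not> ?case"
    then have "\<not> len (s # alternating_word t s k) > len (alternating_word t s k)"
      using reduced_Cons_iff[OF Suc.prems(1) red] by simp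
    then have "len (s # alternating_word t s k) < len (alternating_word t s k)"
      using len_Cons_cases[OF Suc.prems(1) l] by linarith
    then have "refl_count (alternating_word t s k) [s] > 0"
      using refl_count_descent l Suc.prems by blast
    then have "(\<Sum>j<k. if [s] \<approx> alternating_word t s (Suc (2 * j)) then 1 else 0 :: nat) \<noteq> 0"
      unfolding refl_count_alternating_word[OF Suc.prems(2,1)] by linarith
    then obtain j where j: "j < k" "[s] \<approx> alternating_word t s (Suc (2 * j))"
      by (auto split: if_splits)
    have "s # [s] \<approx> s # alternating_word t s (Suc (2 * j))"
      using eq_Cons j Suc.prems by blast
    moreover have "s # [s] \<approx> []" using eq_square[of s "[]"] Suc.prems by simp
    ultimately have "alternating_word s t (2 * Suc j) \<approx> []"
      by (auto intro: cox_eq.sym cox_eq.trans)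
    then show False using order[of s t "Suc j"] Suc.prems j by simp
  qed
qed simp

section \<open>Braid relations and Matsumoto's theorem\<close>

lemma eq_alternating_word:
  assumes "s \<in> S" "t \<in> S"
  shows "alternating_word s t (m s t) \<approx> alternating_word t s (m s t)"
proof -
  let ?M = "m s t"
  have app: "alternating_word s t (k + l) = alternating_word s t k @
      (if even k then alternating_word s t l else alternating_word t s l)" for k l :: nat and s t :: 's
    by (induction k arbitrary: s t) auto
  have "alternating_word s t ?M @ rev (alternating_word t s ?M) = alternating_word s t (2 * ?M)"
    by (simp add: rev_alternating_word app mult_2)
  also have "\<dots> \<approx> []"
    using cox_eq.rel[of "[]" S "[]" s t m] assms by (simp add: alternating_word_double)
  finally have "alternating_word s t ?M @ rev (alternating_word t s ?M) \<approx>
      alternating_word t s ?M @ rev (alternating_word t s ?M)"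
    using eq_append_rev[of "alternating_word t s ?M"] alternating_word_lists[OF assms(2,1)]
    by (blast intro: cox_eq.sym cox_eq.trans)
  then show ?thesis by (rule eq_append_cancel_right)
qed

lemma braid_eq_imp_eq: "braid_eq m x y \<Longrightarrow> x \<in> lists S \<Longrightarrow> x \<approx> y"
proof (induction rule: braid_eq.induct)
  case (sym x y)
  from braid_eq_lists[OF braid_eq.sym[OF sym.hyps]] sym.prems have "x \<in> lists S" .
  then show ?case using sym.IH cox_eq.sym by blast
next
  case (trans x y z)
  from braid_eq_lists[OF trans.hyps(1)] trans.prems have "y \<in> lists S" .
  then show ?case using trans.IH trans.prems cox_eq.trans by blast
next
  case (rel s t u v)
  have "set (alternating_word s t (m s t)) \<subseteq> S"
    using rel by (auto simp: in_lists_conv_set)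
  then have "s \<in> S" "t \<in> S" using set_alternating_word[OF rel(2), of s t] by auto
  then show ?case using eq_context[OF eq_alternating_word, of s t u v] rel(3) by simp
qed (auto intro: cox_eq.refl)

text \<open>Exchange lengthens an alternating prefix letter by letter: the deleted letter cannot lie
  in the prefix, for then the next longer alternating word would not be reduced. Which of s and t
  leads stays open because it switches with each step.\<close>

lemma dihedral_prefix:
  assumes x: "x \<in> lists S" and st: "s \<in> S" "t \<in> S" "s \<noteq> t"
    and desc: "len (s # x) < len x" "len (t # x) < len x"
  shows "k \<le> m s t \<Longrightarrow> \<exists>u. (alternating_word s t k @ u \<approx> x \<or> alternating_word t s k @ u \<approx> x) \<and> k + length u = len x"
proof (induction k)
  case 0
  then show ?case using ex_reduced[OF x] by (auto intro: cox_eq.sym)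
next
  case (Suc k)
  have step: "\<exists>u. alternating_word t s (Suc k) @ u \<approx> x \<and> Suc k + length u = len x"
    if st: "s \<in> S" "t \<in> S" "s \<noteq> t" and desc: "len (t # x) < len x" and k: "Suc k \<le> m s t"
      and u: "alternating_word s t k @ u \<approx> x" "k + length u = len x" for s t u
  proof -
    let ?a = "alternating_word s t k @ u"
    have "t # ?a \<approx> t # x" using eq_Cons u st by blast
    then have "len (t # ?a) < len ?a" using desc len_cong u(1) by metis
    then obtain b c d where bcd: "?a = b @ c # d" "t # ?a \<approx> b @ d"
      using exchange eq_lists1[OF u(1)] st by metis
    show ?thesis
    proof (cases "length b < k")
      case True
      define d' where "d' = take (k - Suc (length b)) d"
      have "alternating_word s t k = take k (b @ c # d)" using bcd(1) by (metis append_eq_conv_conj length_alternating_word)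
      also have "\<dots> = b @ c # d'" using True by (simp add: d'_def Suc_diff_Suc[symmetric] take_Cons')
      finally have alt: "alternating_word s t k = b @ c # d'" .
      then have "d = d' @ u" using bcd(1) by simp
      then have "(t # alternating_word s t k) @ u \<approx> (b @ d') @ u" using bcd(2) by simp
      then have "t # alternating_word s t k \<approx> b @ d'" by (rule eq_append_cancel_right)
      then have "len (alternating_word t s (Suc k)) \<le> length (b @ d')"
        using len_le[of "t # alternating_word s t k" "b @ d'"] by simp
      moreover have "reduced (alternating_word t s (Suc k))"
        using reduced_alternating_word[of t s "Suc k"] st k m_sym by simp
      moreover have "length (b @ d') < k" using arg_cong[OF alt, of length] by simp
      ultimately show ?thesis by (simp add: reduced_def)
    next
      case False
      define b' where "b' = drop k b"
      have "alternating_word s t k = take k (b @ c # d)" using bcd(1) by (metis append_eq_conv_conj length_alternating_word)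
      then have b: "b = alternating_word s t k @ b'" using False by (simp add: b'_def)
      then have u': "u = b' @ c # d" using bcd(1) by simp
      have "t # x \<approx> alternating_word s t k @ b' @ d"
        using \<open>t # ?a \<approx> t # x\<close> bcd(2) b by (auto intro: cox_eq.sym cox_eq.trans)
      then have "x \<approx> alternating_word t s (Suc k) @ b' @ d" using eq_Cons_swap by fastforce
      then show ?thesis using u(2) u' cox_eq.sym by fastforce
    qed
  qed
  obtain u where u: "alternating_word s t k @ u \<approx> x \<or> alternating_word t s k @ u \<approx> x" "k + length u = len x"
    using Suc by auto
  from u(1) show ?case
    using step[OF st desc(2)] step[OF st(2,1) _ desc(1)] st Suc.prems u(2) m_sym[OF st(1,2)] by metis
qed

text \<open>Words with the same first letter are compared by induction. For different first letters
  s and t, both words are joined through words that begin with the two sides of the braid relation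
  of s and t.\<close>

theorem matsumoto: "reduced x \<Longrightarrow> reduced y \<Longrightarrow> x \<approx> y \<Longrightarrow> braid_eq m x y"
proof (induction "length x" arbitrary: x y)
  case 0
  then show ?case using reduced_eq_Nil[of y] by (auto intro: cox_eq.sym braid_eq.refl)
next
  case (Suc n)
  have len: "length y = length x" using Suc.prems len_cong by (simp add: reduced_def)
  obtain s x' where x: "x = s # x'" using Suc.hyps(2) by (cases x) auto
  obtain t y' where y: "y = t # y'" using Suc.hyps(2) len by (cases y) auto
  have l: "s \<in> S" "x' \<in> lists S" "t \<in> S" "y' \<in> lists S"
    using reduced_lists[OF Suc.prems(1)] reduced_lists[OF Suc.prems(2)] x y by auto
  have same: "braid_eq m (a # z) (a # z')" if "reduced (a # z)" "reduced (a # z')" "a # z \<approx> a # z'"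
    "length (a # z) = Suc n" for a z z'
  proof -
    have "z \<approx> z'" using that(3) eq_append_cancel[of "[a]"] by simp
    then have "braid_eq m z z'" using Suc.hyps(1)[of z z'] that reduced_Cons by auto
    then show ?thesis by (rule braid_eq_Cons)
  qed
  show ?case
  proof (cases "s = t")
    case True
    then show ?thesis using same[of s x' y'] Suc x y by simp
  next
    case False
    let ?M = "m s t"
    have desc: "len (s # x) < len x" "len (t # x) < len x"
    proof -
      have "s # x \<approx> x'" using eq_square x l by simp
      then show "len (s # x) < len x" using len_le[of "s # x" x'] Suc.prems x by (auto simp: reduced_def)
      have "t # x \<approx> t # y" using eq_Cons Suc.prems l by blast
      moreover have "t # y \<approx> y'" using eq_square y l by simp
      ultimately have "len (t # x) \<le> length y'" using len_le cox_eq.trans by metis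
      then show "len (t # x) < len x" using Suc.prems len y by (auto simp: reduced_def)
    qed
    obtain u where u: "alternating_word s t ?M @ u \<approx> x \<or> alternating_word t s ?M @ u \<approx> x" "?M + length u = len x"
      using dihedral_prefix[OF reduced_lists[OF Suc.prems(1)] l(1,3) False desc] by blast
    have "u \<in> lists S" using u(1) eq_lists by auto
    then have "alternating_word s t ?M @ u \<approx> alternating_word t s ?M @ u"
      using eq_append_right[OF eq_alternating_word] l by simp
    then have sx: "alternating_word s t ?M @ u \<approx> x" and tx: "alternating_word t s ?M @ u \<approx> x"
      using u(1) by (blast intro: cox_eq.sym cox_eq.trans)+
    have red: "reduced (alternating_word s t ?M @ u)" "reduced (alternating_word t s ?M @ u)"
      using reducedI[OF sx] reducedI[OF tx] u(2) by auto
    obtain M' where M': "?M = Suc M'" using m_ge_2[OF l(1,3) False] by (cases ?M) auto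
    have "braid_eq m x (alternating_word s t ?M @ u)"
      using same[of s x'] red(1) Suc.prems(1) Suc.hyps(2) cox_eq.sym[OF sx] by (simp add: M' x)
    moreover have "braid_eq m (alternating_word s t ?M @ u) (alternating_word t s ?M @ u)"
      using braid_eq.rel[of s t m "[]" u] False m_ge_2 l by simp
    moreover have "braid_eq m y (alternating_word t s ?M @ u)"
    proof -
      have "y \<approx> alternating_word t s ?M @ u"
        using tx Suc.prems(3) by (blast intro: cox_eq.sym cox_eq.trans)
      then show ?thesis
        using same[of t y'] red(2) Suc.prems(2) Suc.hyps(2) len by (simp add: M' y)
    qed
    ultimately show ?thesis by (blast intro: braid_eq.trans braid_eq.sym)
  qed
qed

end

lemma cox_eq_mono: "cox_eq S' m x y \<Longrightarrow> S' \<subseteq> S \<Longrightarrow> cox_eq S m x y"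
proof (induction rule: cox_eq.induct)
  case (rel us vs s t)
  then show ?case using lists_mono[of S' S] by (intro cox_eq.rel) auto
qed (use lists_mono[of S' S] in \<open>blast intro: cox_eq.refl cox_eq.sym cox_eq.trans\<close>)+

context coxeter_words
begin

text \<open>If s lengthens x, exchange of s against x t must delete the final t, since deleting a
  letter of x would shorten s x. If s shortens x, the same argument applies to s x.\<close>

lemma exchange_both_sides:
  assumes x: "x \<in> lists S" and st: "s \<in> S" "t \<in> S"
    and eq: "len (s # x @ [t]) = len x" "len (s # x) = len (x @ [t])"
  shows "s # x \<approx> x @ [t]"
proof -
  have up: "s # x \<approx> x @ [t]" if x: "reduced x" and lt: "len (s # x) > len x"
    and eq: "len (s # x @ [t]) = len x" "len (s # x) = len (x @ [t])" for x
  proof -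
    have l: "x \<in> lists S" using x by (rule reduced_lists)
    have "len (s # (x @ [t])) < len (x @ [t])" using lt eq by simp
    then obtain u a v where uv: "x @ [t] = u @ a # v" "s # x @ [t] \<approx> u @ v"
      using exchange[of "x @ [t]" s] l st by auto
    show ?thesis
    proof (cases v rule: rev_cases)
      case Nil
      then have "s # x @ [t] \<approx> x" using uv by simp
      then show ?thesis using eq_snoc_swap[of "s # x" t x] by simp
    next
      case (snoc v' b)
      then have x': "x = u @ a # v'" "b = t" using uv(1) by auto
      then have "s # x \<approx> u @ v'" using eq_append_cancel_right[of "s # x" "[t]" "u @ v'"] uv(2) snoc by simp
      then have "len (s # x) \<le> length (u @ v')" by (rule len_le)
      then have "len (s # x) < length x" using x'(1) by simp
      then show ?thesis using lt x by (simp add: reduced_def)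
    qed
  qed
  have up': "s # x \<approx> x @ [t]" if l: "x \<in> lists S" and lt: "len (s # x) > len x"
    and eq: "len (s # x @ [t]) = len x" "len (s # x) = len (x @ [t])" for x
  proof -
    obtain y where y: "x \<approx> y" "reduced y" using ex_reduced[OF l] by blast
    have e: "s # x \<approx> s # y" "x @ [t] \<approx> y @ [t]" "s # x @ [t] \<approx> s # y @ [t]"
      using y(1) eq_Cons[OF _ st(1)] eq_append_right[of _ _ "[t]"] st by auto
    have "s # y \<approx> y @ [t]"
      using up[OF y(2)] lt eq e[THEN len_cong] len_cong[OF y(1)] by simp
    then show ?thesis using e by (blast intro: cox_eq.sym cox_eq.trans)
  qed
  show ?thesis
  proof (cases "len (s # x) > len x")
    case True
    then show ?thesis using up'[OF x _ eq] by simp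
  next
    case False
    then have lt: "len (s # x) < len x" using len_Cons_cases[OF st(1) x] by linarith
    have ss: "s # s # x \<approx> x" "s # s # x @ [t] \<approx> x @ [t]"
      using eq_square[OF st(1)] x st by auto
    have "s # s # x \<approx> (s # x) @ [t]"
      using up'[of "s # x"] lt eq ss[THEN len_cong] x st by simp
    then have "x \<approx> s # x @ [t]" using ss(1) by (auto intro: cox_eq.sym cox_eq.trans)
    then have "s # x \<approx> s # s # x @ [t]" using st by (intro eq_Cons) auto
    then show ?thesis using ss(2) by (rule cox_eq.trans)
  qed
qed

subsection \<open>Parabolic subgroups\<close>

lemma coxeter_words_subset: "S' \<subseteq> S \<Longrightarrow> coxeter_words S' m"
proof
  assume S': "S' \<subseteq> S"
  show "\<not> cox_eq S' m (alternating_word s t (2 * i)) []"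
    if "s \<in> S'" "t \<in> S'" "s \<noteq> t" "0 < i" "i < m s t" for s t i
    using order[of s t i] cox_eq_mono[OF _ S'] that S' by blast
qed (auto intro: m_sym m_ge_2 simp: m_diag subset_iff)

text \<open>A shortening in the large group yields two reduced words of one element, hence by
  Matsumoto a chain of braid moves. The chain stays over \<open>S'\<close>, so the shortening would
  already happen there.\<close>

lemma parabolic_reduced:
  assumes S': "S' \<subseteq> S" and x: "coxeter_words.reduced S' m x"
  shows "reduced x"
  using x
proof (induction x)
  case (Cons s x)
  interpret P: coxeter_words S' m using S' by (rule coxeter_words_subset)
  have x: "reduced x" using Cons P.reduced_Cons by blast
  have s: "s \<in> S" using P.reduced_lists[OF Cons.prems] S' by auto
  show ?case
  proof (rule ccontr)
    assume "\<not> reduced (s # x)"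
    then have "len (s # x) < len x"
      using reduced_Cons_iff[OF s x] len_Cons_cases[OF s reduced_lists[OF x]] by linarith
    then obtain u a v where uv: "x = u @ a # v" "s # x \<approx> u @ v"
      using exchange[OF reduced_lists[OF x] s] by blast
    have eq: "x \<approx> s # u @ v" using eq_Cons_swap[OF uv(2)] .
    moreover have "reduced (s # u @ v)" using reduced_transfer[OF x eq] uv(1) by simp
    ultimately have "braid_eq m x (s # u @ v)" using matsumoto x by blast
    then have "P.eq x (s # u @ v)" using P.braid_eq_imp_eq P.reduced_lists[OF Cons.prems] by simp
    then have "P.eq (s # x) (u @ v)" using P.eq_Cons_swap cox_eq.sym by metis
    then have "P.len (s # x) \<le> length (u @ v)" by (rule P.len_le)
    then show False using Cons.prems uv(1) by (simp add: P.reduced_def)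
  qed
qed simp

text \<open>Exchange would have to delete a letter of x or of d. The former contradicts
  \<open>parabolic_reduced\<close>; the latter produces a shorter element in the coset of d.\<close>

lemma minimal_coset_reduced:
  assumes S': "S' \<subseteq> S" and d: "d \<in> lists S"
    and min: "\<And>x. x \<in> lists S' \<Longrightarrow> length d \<le> len (x @ d)"
    and x: "coxeter_words.reduced S' m x"
  shows "reduced (x @ d)"
  using x
proof (induction x)
  case Nil
  then show ?case using min[of "[]"] len_le_length[OF d] d by (simp add: reduced_def)
next
  case (Cons s x)
  interpret P: coxeter_words S' m using S' by (rule coxeter_words_subset)
  have xd: "reduced (x @ d)" using Cons P.reduced_Cons by blast
  have s: "s \<in> S'" "s \<in> S" "x \<in> lists S'" using P.reduced_lists[OF Cons.prems] S' by auto
  show ?case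
  proof (rule ccontr)
    assume "\<not> reduced ((s # x) @ d)"
    then have "len (s # (x @ d)) < len (x @ d)"
      using reduced_Cons_iff[OF s(2) xd] len_Cons_cases[OF s(2) reduced_lists[OF xd]] by simp
    then obtain u a v where uv: "x @ d = u @ a # v" "s # x @ d \<approx> u @ v"
      using exchange[OF reduced_lists[OF xd] s(2)] by blast
    from uv(1) consider (left) v1 where "x = u @ a # v1" "v = v1 @ d" | (right) u1 where "u = x @ u1" "d = u1 @ a # v"
      by (auto simp: append_eq_append_conv2 append_eq_Cons_conv)
    then show False
    proof cases
      case left
      then have "s # x \<approx> u @ v1" using eq_append_cancel_right[of "s # x" d "u @ v1"] uv(2) by simp
      then have "len (s # x) \<le> length (u @ v1)" by (rule len_le)
      then show False using parabolic_reduced[OF S' Cons.prems] left by (simp add: reduced_def)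
    next
      case right
      have l: "rev x \<in> lists S" using s lists_mono[OF S'] by auto
      then have "rev x @ s # x @ d \<approx> rev x @ u @ v" using eq_append_left[OF uv(2)] by blast
      moreover have "(rev x @ x) @ u1 @ v \<approx> u1 @ v"
        using eq_append_right[OF eq_rev_append[of x], of "u1 @ v"] l d right by simp
      ultimately have "(rev x @ s # x) @ d \<approx> u1 @ v" using right by (auto intro: cox_eq.trans)
      then have "len ((rev x @ s # x) @ d) \<le> length (u1 @ v)" by (rule len_le)
      moreover have "length d \<le> len ((rev x @ s # x) @ d)" using s by (intro min) auto
      ultimately show False using right by simp
    qed
  qed
qed

subsection \<open>The longest element\<close>

text \<open>Stated through descents so that it can be tested one generator at a time; maximality of
  the length and uniqueness are consequences.\<close>

definition longest :: "'s list \<Rightarrow> bool" where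
  "longest w \<longleftrightarrow> reduced w \<and> (\<forall>s\<in>S. len (s # w) < len w)"

text \<open>When a letter is put in front of u, exchange must delete a letter of the complement z,
  because the extended prefix is reduced.\<close>

lemma longest_decompose:
  assumes w: "longest w"
  shows "reduced u \<Longrightarrow> \<exists>z. u @ z \<approx> w \<and> length u + length z = length w"
proof (induction u)
  case Nil
  then show ?case using w cox_eq.refl by (auto simp: longest_def reduced_def)
next
  case (Cons s u)
  then obtain z where z: "u @ z \<approx> w" "length u + length z = length w" using reduced_Cons by blast
  have s: "s \<in> S" using reduced_lists[OF Cons.prems] by simp
  have "s # u @ z \<approx> s # w" using eq_Cons[OF z(1) s] .
  then have "len (s # (u @ z)) < len (u @ z)"
    using w s len_cong[OF z(1)] len_cong by (metis longest_def)
  then obtain b c d where bcd: "u @ z = b @ c # d" "s # u @ z \<approx> b @ d"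
    using exchange[OF eq_lists1[OF z(1)] s] by blast
  have w_eq: "w \<approx> s # b @ d"
    using eq_Cons_swap[OF bcd(2)] z(1) by (blast intro: cox_eq.sym cox_eq.trans)
  from bcd(1) consider (left) v1 where "u = b @ c # v1" "d = v1 @ z" | (right) u1 where "b = u @ u1" "z = u1 @ c # d"
    by (auto simp: append_eq_append_conv2 append_eq_Cons_conv)
  then show ?case
  proof cases
    case left
    then have "s # u \<approx> b @ v1" using eq_append_cancel_right[of "s # u" z "b @ v1"] bcd(2) by simp
    then have "len (s # u) \<le> length (b @ v1)" by (rule len_le)
    then show ?thesis using Cons.prems left by (simp add: reduced_def)
  next
    case right
    then show ?thesis using w_eq z(2) by (intro exI[of _ "u1 @ d"]) (auto intro: cox_eq.sym)
  qed
qed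

lemma longest_lists: "longest w \<Longrightarrow> w \<in> lists S"
  by (simp add: longest_def reduced_lists)

lemma len_le_longest:
  assumes "longest w" "u \<in> lists S"
  shows "len u \<le> length w"
proof -
  obtain u' where "u \<approx> u'" "reduced u'" "length u' = len u" using ex_reduced[OF assms(2)] by blast
  then show ?thesis using longest_decompose[OF assms(1), of u'] by auto
qed

lemma longest_unique:
  assumes "longest w" "u \<in> lists S" "len u = length w"
  shows "u \<approx> w"
proof -
  obtain u' where "u \<approx> u'" "reduced u'" "length u' = len u" using ex_reduced[OF assms(2)] by blast
  then show ?thesis using longest_decompose[OF assms(1), of u'] assms(3) by (auto intro: cox_eq.trans)
qed

lemma longest_rev: "longest w \<Longrightarrow> rev w \<approx> w"
proof -
  assume w: "longest w"
  show ?thesis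
    by (rule longest_unique[OF w]) (use w in \<open>simp_all add: len_rev longest_def reduced_def\<close>)
qed

text \<open>Right descents of w are left descents of its inverse, so \<open>rev w\<close> is
  longest; uniqueness then identifies it with w.\<close>

lemma longestI_right:
  assumes w: "reduced w" and desc: "\<And>s. s \<in> S \<Longrightarrow> len (w @ [s]) < len w"
  shows "longest w"
proof -
  have l: "w \<in> lists S" using w by (rule reduced_lists)
  have rw: "longest (rev w)"
    unfolding longest_def reduced_rev
  proof (intro conjI ballI w)
    fix s assume "s \<in> S"
    then show "len (s # rev w) < len (rev w)"
      using desc[of s] len_rev[of "w @ [s]"] len_rev[of w] l by simp
  qed
  have eq: "w \<approx> rev w" using longest_unique[OF rw l] w by (simp add: reduced_def)
  show ?thesis
    unfolding longest_def
  proof (intro conjI ballI w)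
    fix s assume s: "s \<in> S"
    then have "len (s # w) = len (s # rev w)" using len_cong[OF eq_Cons[OF eq s]] by simp
    then show "len (s # w) < len w" using rw s len_cong[OF eq] by (auto simp: longest_def)
  qed
qed

subsection \<open>The group of classes of words\<close>

abbreviation cls :: "'s list \<Rightarrow> 's list set" where
  "cls \<equiv> cox_class S m"

abbreviation W where "W \<equiv> coxeter_group S m"

lemma cls_eq_iff: "x \<in> lists S \<Longrightarrow> cls x = cls y \<longleftrightarrow> x \<approx> y"
  unfolding cox_class_def by (auto intro: cox_eq.refl cox_eq.sym cox_eq.trans)

lemma cls_eqI: "x \<approx> y \<Longrightarrow> cls x = cls y"
  unfolding cox_class_def by (auto intro: cox_eq.sym cox_eq.trans)

lemma carrier_W: "carrier W = cls ` lists S"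
  and one_W: "\<one>\<^bsub>W\<^esub> = cls []"
  by (simp_all add: coxeter_group_def)

lemma mult_W:
  assumes "x \<in> lists S" "y \<in> lists S"
  shows "cls x \<otimes>\<^bsub>W\<^esub> cls y = cls (x @ y)"
proof -
  have "cls x \<otimes>\<^bsub>W\<^esub> cls y = (\<Union>xs\<in>cls x. \<Union>ys\<in>cls y. cls (xs @ ys))"
    by (simp add: coxeter_group_def)
  also have "\<dots> = (\<Union>xs\<in>cls x. \<Union>ys\<in>cls y. cls (x @ y))"
  proof -
    have "cls (xs @ ys) = cls (x @ y)" if "xs \<in> cls x" "ys \<in> cls y" for xs ys
      by (rule cls_eqI, rule eq_append) (use that in \<open>auto simp: cox_class_def intro: cox_eq.sym\<close>)
    then show ?thesis by simp
  qed
  also have "\<dots> = cls (x @ y)"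
  proof -
    have "x \<in> cls x" "y \<in> cls y" using assms by (simp_all add: cox_class_def cox_eq.refl)
    then show ?thesis by blast
  qed
  finally show ?thesis .
qed

lemma group_W: "group W"
proof (rule groupI)
  fix x assume "x \<in> carrier W"
  then obtain xs where xs: "x = cls xs" "xs \<in> lists S" by (auto simp: carrier_W)
  then show "\<exists>y\<in>carrier W. y \<otimes>\<^bsub>W\<^esub> x = \<one>\<^bsub>W\<^esub>"
    by (intro bexI[of _ "cls (rev xs)"]) (auto simp: carrier_W mult_W one_W cls_eqI eq_rev_append)
qed (auto simp: carrier_W one_W mult_W)

lemma inv_W:
  assumes "x \<in> lists S"
  shows "inv\<^bsub>W\<^esub> (cls x) = cls (rev x)"
  by (rule group.inv_equality[OF group_W])
    (use assms in \<open>auto simp: carrier_W mult_W one_W cls_eqI eq_rev_append\<close>)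

lemma cox_length_cls: "cox_length (cls x) = len x"
  unfolding cox_length_def len_def cox_class_def by (rule arg_cong[where f = Least]) auto

text \<open>Literally the choice made inside \<open>hecke_T\<close>.\<close>

definition rep :: "'s list set \<Rightarrow> 's list" where
  "rep w = (SOME xs. reduced_expression xs w)"

lemma rep_cls:
  assumes "x \<in> lists S"
  shows "x \<approx> rep (cls x)" "reduced (rep (cls x))"
proof -
  obtain y where y: "x \<approx> y" "reduced y" "length y = len x" using ex_reduced[OF assms] by blast
  then have "reduced_expression y (cls x)"
    by (simp add: reduced_expression_def cox_length_cls) (simp add: cox_class_def)
  then have "reduced_expression (rep (cls x)) (cls x)" unfolding rep_def by (rule someI)
  then have "x \<approx> rep (cls x)" "length (rep (cls x)) = len x"
    unfolding reduced_expression_def cox_length_cls by (simp_all add: cox_class_def)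
  then show "x \<approx> rep (cls x)" "reduced (rep (cls x))"
    using len_cong eq_lists2 by (auto simp: reduced_def)
qed

lemma carrier_W_rep:
  assumes "w \<in> carrier W"
  shows "reduced (rep w)" "cls (rep w) = w"
proof -
  obtain x where x: "w = cls x" "x \<in> lists S" using assms by (auto simp: carrier_W)
  show "reduced (rep w)" "cls (rep w) = w"
    using rep_cls(2)[OF x(2)] cls_eqI[OF rep_cls(1)[OF x(2)]] x(1) by simp_all
qed

lemma longest_element_eq:
  assumes "longest w"
  shows "longest_element S m = cls w"
proof -
  have w: "cls w \<in> carrier W" using longest_lists[OF assms] by (simp add: carrier_W)
  have bound: "cox_length y \<le> length w" if y: "y \<in> carrier W" for y
  proof -
    obtain u where "y = cls u" "u \<in> lists S" using y unfolding carrier_W by blast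
    then show ?thesis using len_le_longest[OF assms] by (simp add: cox_length_cls)
  qed
  have *: "longest_element S m \<in> carrier W \<and>
      (\<forall>y. y \<in> carrier W \<longrightarrow> cox_length y \<le> cox_length (longest_element S m))"
    unfolding longest_element_def
  proof (rule arg_max_nat_lemma[where b = "Suc (length w)"])
    show "cls w \<in> carrier W" by (rule w)
    show "\<forall>y. y \<in> carrier W \<longrightarrow> cox_length y < Suc (length w)"
      by (intro allI impI le_imp_less_Suc bound)
  qed
  then obtain u where u: "longest_element S m = cls u" "u \<in> lists S" unfolding carrier_W by blast
  have "length w \<le> len u" using *[THEN conjunct2, rule_format, OF w] u(1) assms by (simp add: cox_length_cls longest_def reduced_def)
  then have "len u = length w" using len_le_longest[OF assms u(2)] by simp
  then show ?thesis using cls_eqI[OF longest_unique[OF assms u(2)]] u(1) by simp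
qed

end

section \<open>Hecke algebras\<close>

lemma (in ideal) mem_coset: "f' \<in> I +> f \<longleftrightarrow> (\<exists>i\<in>I. f' = i \<oplus> f)"
  by (auto simp: a_r_coset_def')

lemma (in ideal) coset_eqI: "i \<in> I \<Longrightarrow> f \<in> carrier R \<Longrightarrow> I +> (i \<oplus> f) = I +> f"
  using a_repr_independence[OF _ _ additive_subgroup.a_subgroup[OF is_additive_subgroup], of "i \<oplus> f" f]
  by (auto simp: mem_coset)

lemma (in ideal) carrier_quot: "carrier (R Quot I) = (+>) I ` carrier R"
  by (auto simp: FactRing_def A_RCOSETS_def')

lemma (in monoid) a_inv_monoid_algebra:
  assumes "f \<in> carrier (monoid_algebra G :: ('a \<Rightarrow>\<^sub>0 'k::comm_ring_1) ring)"
  shows "\<ominus>\<^bsub>monoid_algebra G\<^esub> f = - f"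
proof -
  interpret R: ring "monoid_algebra G :: ('a \<Rightarrow>\<^sub>0 'k) ring" by (rule ring_monoid_algebra)
  show ?thesis by (rule R.minus_equality) (use assms in \<open>simp_all add: carrier_monoid_algebra\<close>)
qed

text \<open>Stability is tested on single terms only; negation is multiplication by the single term
  with coefficient -1 at the identity.\<close>

lemma (in monoid) monoid_algebra_idealI:
  fixes K :: "('a \<Rightarrow>\<^sub>0 'k::comm_ring_1) set"
  assumes sub: "K \<subseteq> carrier (monoid_algebra G)" and zero: "0 \<in> K"
    and add: "\<And>f g. f \<in> K \<Longrightarrow> g \<in> K \<Longrightarrow> f + g \<in> K"
    and l: "\<And>x a f. x \<in> carrier G \<Longrightarrow> f \<in> K \<Longrightarrow> single x a \<otimes>\<^bsub>monoid_algebra G\<^esub> f \<in> K"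
    and r: "\<And>x a f. x \<in> carrier G \<Longrightarrow> f \<in> K \<Longrightarrow> f \<otimes>\<^bsub>monoid_algebra G\<^esub> single x a \<in> K"
  shows "ideal K (monoid_algebra G)"
proof (rule idealI)
  show ring: "ring (monoid_algebra G :: ('a \<Rightarrow>\<^sub>0 'k) ring)" by (rule ring_monoid_algebra)
  interpret R: ring "monoid_algebra G :: ('a \<Rightarrow>\<^sub>0 'k) ring" by (rule ring)
  have uminus: "- f \<in> K" if "f \<in> K" for f
  proof -
    have "single \<one> (- 1) \<otimes>\<^bsub>monoid_algebra G\<^esub> f = - f"
      using R.l_minus[of "\<one>\<^bsub>monoid_algebra G\<^esub>" f] that sub
      by (auto simp: a_inv_monoid_algebra one_monoid_algebra[symmetric] single_uminus subsetD)
    then show ?thesis using l[OF one_closed that, of "- 1"] by simp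
  qed
  show "subgroup K (add_monoid (monoid_algebra G))"
  proof (rule group.subgroupI[OF R.add.group_axioms])
    fix f assume "f \<in> K"
    then show "inv\<^bsub>add_monoid (monoid_algebra G)\<^esub> f \<in> K"
      using uminus a_inv_monoid_algebra[of f] sub by (auto simp: a_inv_def)
  qed (use sub zero add in auto)
  have ne: "carrier G \<noteq> {}" by auto
  fix f g assume f: "f \<in> K" and g: "g \<in> carrier (monoid_algebra G :: ('a \<Rightarrow>\<^sub>0 'k) ring)"
  have gk: "keys g \<subseteq> carrier G" using g by (simp add: carrier_monoid_algebra)
  from gk ne show "g \<otimes>\<^bsub>monoid_algebra G\<^esub> f \<in> K"
    by (induction g rule: poly_mapping_carrier_induct) (simp_all add: l f mult_monoid_algebra_add_left add)
  from gk ne show "f \<otimes>\<^bsub>monoid_algebra G\<^esub> g \<in> K"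
    by (induction g rule: poly_mapping_carrier_induct) (simp_all add: r f mult_monoid_algebra_add_right add)
qed

abbreviation linear_ext :: "('g \<Rightarrow> 'k) \<Rightarrow> ('g \<Rightarrow>\<^sub>0 'k) \<Rightarrow> 'k::comm_ring_1" where
  "linear_ext \<equiv> extend_semilinear (\<lambda>c. c)"

lemma linear_ext_simps:
  "linear_ext \<phi> 0 = 0" "linear_ext \<phi> (single x c) = c * \<phi> x"
  "linear_ext \<phi> (f + g) = linear_ext \<phi> f + linear_ext \<phi> g"
  by (simp_all add: extend_semilinear_zero extend_semilinear_single extend_semilinear_add)

lemma linear_ext_diff: "linear_ext \<phi> (f - g) = linear_ext \<phi> f - linear_ext \<phi> g"
  using linear_ext_simps(3)[of \<phi> "f - g" g] by simp

context coxeter_words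
begin

text \<open>A function \<open>g\<close> on the group stands for the linear functional with \<open>t\<^sub>w \<mapsto> g w\<close>;
  \<open>left_op s\<close> and \<open>right_op s\<close> are the transposes of left and right multiplication by \<open>t\<^sub>s\<close>.\<close>

definition left_op :: "'s \<Rightarrow> ('s list \<Rightarrow> qv) \<Rightarrow> 's list \<Rightarrow> qv" where
  "left_op s g x = (if x \<in> lists S then g (s # x) + (if len (s # x) < len x then var_q * g x else 0) else 0)"

definition right_op :: "'s \<Rightarrow> ('s list \<Rightarrow> qv) \<Rightarrow> 's list \<Rightarrow> qv" where
  "right_op s g x = (if x \<in> lists S then g (x @ [s]) + (if len (x @ [s]) < len x then var_q * g x else 0) else 0)"

text \<open>Vanishing outside the words over \<open>S\<close> turns identities between operators
  into equalities of functions, so that they can be rewritten inside folds.\<close>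

definition class_fun :: "('s list \<Rightarrow> qv) \<Rightarrow> bool" where
  "class_fun g \<longleftrightarrow> (\<forall>x y. x \<approx> y \<longrightarrow> g x = g y) \<and> (\<forall>x. x \<notin> lists S \<longrightarrow> g x = 0)"

lemma class_funD: "class_fun g \<Longrightarrow> x \<approx> y \<Longrightarrow> g x = g y"
  and class_fun_outside: "class_fun g \<Longrightarrow> x \<notin> lists S \<Longrightarrow> g x = 0"
  by (auto simp: class_fun_def)

lemma class_fun_left_op:
  assumes s: "s \<in> S" and g: "class_fun g"
  shows "class_fun (left_op s g)"
  unfolding class_fun_def
proof (intro conjI allI impI)
  fix x y assume xy: "x \<approx> y"
  have e: "s # x \<approx> s # y" using eq_Cons[OF xy s] .
  show "left_op s g x = left_op s g y"
    using class_funD[OF g xy] class_funD[OF g e] len_cong[OF xy] len_cong[OF e] eq_lists[OF xy]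
    by (simp add: left_op_def)
qed (simp add: left_op_def)

lemma class_fun_right_op:
  assumes s: "s \<in> S" and g: "class_fun g"
  shows "class_fun (right_op s g)"
  unfolding class_fun_def
proof (intro conjI allI impI)
  fix x y assume xy: "x \<approx> y"
  have e: "x @ [s] \<approx> y @ [s]" using eq_append_right[OF xy, of "[s]"] s by simp
  show "right_op s g x = right_op s g y"
    using class_funD[OF g xy] class_funD[OF g e] len_cong[OF xy] len_cong[OF e] eq_lists[OF xy]
    by (simp add: right_op_def)
qed (simp add: right_op_def)

lemma class_fun_fold_left: "w \<in> lists S \<Longrightarrow> class_fun g \<Longrightarrow> class_fun (fold left_op w g)"
  by (induction w arbitrary: g) (simp_all add: class_fun_left_op)

lemma class_fun_fold_right: "w \<in> lists S \<Longrightarrow> class_fun g \<Longrightarrow> class_fun (fold right_op w g)"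
  by (induction w arbitrary: g) (simp_all add: class_fun_right_op)

lemma left_op_square:
  assumes s: "s \<in> S" and g: "class_fun g"
  shows "left_op s (left_op s g) x = g x + var_q * left_op s g x"
proof (cases "x \<in> lists S")
  case x: True
  have ss: "g (s # s # x) = g x" "len (s # s # x) = len x"
    using class_funD[OF g eq_square[OF s x]] len_cong[OF eq_square[OF s x]] by auto
  consider "len (s # x) = Suc (len x)" | "len x = Suc (len (s # x))" using len_Cons_cases[OF s x] by blast
  then show ?thesis by cases (simp_all add: left_op_def x s ss)
next
  case False
  then show ?thesis using class_fun_outside[OF g] by (simp add: left_op_def)
qed

text \<open>Everything is comparison of the lengths of x, s x, x t and s x t, except when s x and x
  t are equally long and s x t is as long as x. There the correction terms agree because
  \<open>exchange_both_sides\<close> identifies s x with x t.\<close>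

lemma left_right_op_commute:
  assumes s: "s \<in> S" and t: "t \<in> S" and g: "class_fun g"
  shows "left_op s (right_op t g) = right_op t (left_op s g)"
proof
  fix x
  show "left_op s (right_op t g) x = right_op t (left_op s g) x"
  proof (cases "x \<in> lists S")
    case x: True
    have same: "g (s # x) = g (x @ [t])" if "len (s # x @ [t]) = len x" "len (s # x) = len (x @ [t])"
      using class_funD[OF g exchange_both_sides[OF x s t that]] .
    have c: "len (s # x) = Suc (len x) \<or> len x = Suc (len (s # x))"
      "len (x @ [t]) = Suc (len x) \<or> len x = Suc (len (x @ [t]))"
      "len (s # x @ [t]) = Suc (len (s # x)) \<or> len (s # x) = Suc (len (s # x @ [t]))"
      "len (s # x @ [t]) = Suc (len (x @ [t])) \<or> len (x @ [t]) = Suc (len (s # x @ [t]))"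
      using len_Cons_cases[OF s x] len_snoc_cases[OF t x] len_snoc_cases[OF t, of "s # x"]
        len_Cons_cases[OF s, of "x @ [t]"] x s t by simp_all
    have lhs: "left_op s (right_op t g) x = g (s # x @ [t])
        + (if len (s # x @ [t]) < len (s # x) then var_q * g (s # x) else 0)
        + (if len (s # x) < len x then var_q * (g (x @ [t]) + (if len (x @ [t]) < len x then var_q * g x else 0)) else 0)"
      using x s by (simp add: left_op_def right_op_def)
    have rhs: "right_op t (left_op s g) x = g (s # x @ [t])
        + (if len (s # x @ [t]) < len (x @ [t]) then var_q * g (x @ [t]) else 0)
        + (if len (x @ [t]) < len x then var_q * (g (s # x) + (if len (s # x) < len x then var_q * g x else 0)) else 0)"
      using x t by (simp add: left_op_def right_op_def)
    show ?thesis
    proof (cases "len (s # x) = len (x @ [t])")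
      case AB: True
      show ?thesis
      proof (cases "len (s # x @ [t]) = len x")
        case True
        then show ?thesis unfolding lhs rhs using AB same[OF True AB] by simp
      next
        case False
        then show ?thesis unfolding lhs rhs using AB c by (auto simp: algebra_simps)
      qed
    next
      case False
      then have "len (s # x) < len x \<longleftrightarrow> \<not> len (x @ [t]) < len x"
        "len (s # x @ [t]) < len (s # x) \<longleftrightarrow> len (x @ [t]) < len x"
        "len (s # x @ [t]) < len (x @ [t]) \<longleftrightarrow> len (s # x) < len x" using c by linarith+
      then show ?thesis unfolding lhs rhs by simp
    qed
  qed (simp add: left_op_def right_op_def)
qed

lemma fold_left_right_op_commute:
  assumes w: "w \<in> lists S" and y: "y \<in> lists S" and g: "class_fun g"
  shows "fold left_op w (fold right_op y g) = fold right_op y (fold left_op w g)"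
proof -
  have one: "fold left_op w (right_op t g) = right_op t (fold left_op w g)"
    if "t \<in> S" "w \<in> lists S" "class_fun g" for t g w
    using that by (induction w arbitrary: g) (simp_all add: left_right_op_commute class_fun_left_op)
  show ?thesis
    using y g
  proof (induction y arbitrary: g)
    case (Cons t y)
    then show ?case using one[of t w g] w by (simp add: class_fun_right_op)
  qed simp
qed

lemma fold_left_op_reduced: "reduced (w @ y) \<Longrightarrow> fold left_op w g y = g (w @ y)"
proof (induction w arbitrary: g)
  case (Cons s w)
  have red: "reduced (w @ y)" using Cons.prems reduced_Cons by simp
  have "len (s # w @ y) = Suc (len (w @ y))" using Cons.prems red by (simp add: reduced_def)
  then show ?case using Cons.IH[OF red] reduced_lists[OF red] by (simp add: left_op_def)
qed simp

lemma fold_right_op_reduced: "reduced (x @ y) \<Longrightarrow> fold right_op (rev y) g x = g (x @ y)"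
proof (induction y arbitrary: g rule: rev_induct)
  case (snoc s y)
  have red: "reduced (x @ y)" using snoc.prems reduced_append(1)[of "x @ y" "[s]"] by simp
  have "len (x @ y @ [s]) = Suc (len (x @ y))" using snoc.prems red by (simp add: reduced_def)
  then show ?case using snoc.IH[OF red] reduced_lists[OF red] by (simp add: right_op_def)
qed simp

text \<open>Evaluation at y is right multiplication by y followed by evaluation at 1. The right
  operators commute past the left ones, and what remains is a class function evaluated at w. The
  braid relations for the left operators thus follow without a rank two computation.\<close>

lemma fold_left_op_eq:
  assumes w: "reduced w" "reduced w'" "w \<approx> w'" and g: "class_fun g"
  shows "fold left_op w g = fold left_op w' g"
proof
  fix y
  have l: "w \<in> lists S" "w' \<in> lists S" using w reduced_lists by auto
  show "fold left_op w g y = fold left_op w' g y"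
  proof (cases "y \<in> lists S")
    case True
    then obtain y' where y': "y \<approx> y'" "reduced y'" using ex_reduced by blast
    have eval: "fold left_op u g y = fold right_op (rev y') g u" if u: "reduced u" for u
    proof -
      have lu: "u \<in> lists S" "rev y' \<in> lists S" using u y'(2) reduced_lists by auto
      have "fold left_op u g y = fold left_op u g y'"
        using class_funD[OF class_fun_fold_left[OF lu(1) g] y'(1)] .
      also have "\<dots> = fold right_op (rev y') (fold left_op u g) []"
        using fold_right_op_reduced[of "[]" y'] y'(2) by simp
      also have "\<dots> = fold left_op u (fold right_op (rev y') g) []"
        using fold_left_right_op_commute[OF lu g] by simp
      also have "\<dots> = fold right_op (rev y') g u"
        using fold_left_op_reduced[of u "[]"] u by simp
      finally show ?thesis .
    qed
    have "rev y' \<in> lists S" using y'(2) reduced_lists by simp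
    then show ?thesis
      using eval[OF w(1)] eval[OF w(2)] class_funD[OF class_fun_fold_right[OF _ g] w(3)] by simp
  next
    case False
    then show ?thesis
      using class_fun_outside[OF class_fun_fold_left[OF l(1) g]] class_fun_outside[OF class_fun_fold_left[OF l(2) g]]
      by simp
  qed
qed

lemma fold_left_op_linear:
  "fold left_op w (\<lambda>y. c * g y) y = c * fold left_op w g y"
  "fold left_op w (\<lambda>y. g y + g' y) y = fold left_op w g y + fold left_op w g' y"
proof -
  have "left_op s (\<lambda>y. c * g y) = (\<lambda>y. c * left_op s g y)" for s g
    by (auto simp: left_op_def fun_eq_iff algebra_simps)
  then show "fold left_op w (\<lambda>y. c * g y) y = c * fold left_op w g y"
    by (induction w arbitrary: g) simp_all
  have "left_op s (\<lambda>y. g y + g' y) = (\<lambda>y. left_op s g y + left_op s g' y)" for s g g'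
    by (auto simp: left_op_def fun_eq_iff algebra_simps)
  then show "fold left_op w (\<lambda>y. g y + g' y) y = fold left_op w g y + fold left_op w g' y"
    by (induction w arbitrary: g g') simp_all
qed

subsection \<open>Functionals on the Hecke algebra\<close>

abbreviation FA :: "('s list \<Rightarrow>\<^sub>0 qv) ring" where "FA \<equiv> free_algebra S"
abbreviation I :: "('s list \<Rightarrow>\<^sub>0 qv) set" where "I \<equiv> hecke_ideal S m"
abbreviation H :: "('s list \<Rightarrow>\<^sub>0 qv) set ring" where "H \<equiv> hecke S m"

definition act :: "('s list \<Rightarrow>\<^sub>0 qv) \<Rightarrow> ('s list \<Rightarrow> qv) \<Rightarrow> 's list \<Rightarrow> qv" where
  "act f g y = linear_ext (\<lambda>w. fold left_op w g y) f"

lemma act_single: "act (single w c) g y = c * fold left_op w g y"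
  and act_add: "act (f + f') g y = act f g y + act f' g y"
  and act_zero: "act 0 g y = 0"
  and act_diff: "act (f - f') g y = act f g y - act f' g y"
  by (simp_all add: act_def linear_ext_simps linear_ext_diff)

lemma act_single_mult:
  "f \<in> carrier FA \<Longrightarrow> act (single u c \<otimes>\<^bsub>FA\<^esub> f) g y = c * act f (fold left_op u g) y"
proof -
  assume "f \<in> carrier FA"
  then have "keys f \<subseteq> lists S" "lists S \<noteq> {}" by (auto simp: carrier_monoid_algebra)
  then show ?thesis
  proof (induction f rule: poly_mapping_carrier_induct)
    case (add f f')
    then show ?case by (simp add: mult_monoid_algebra_add_right act_add algebra_simps)
  qed (simp add: mult_monoid_algebra_single act_single)
qed

lemma act_mult_single:
  "f \<in> carrier FA \<Longrightarrow> act (f \<otimes>\<^bsub>FA\<^esub> single u c) g y = c * fold left_op u (act f g) y"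
proof -
  assume "f \<in> carrier FA"
  then have "keys f \<subseteq> lists S" "lists S \<noteq> {}" by (auto simp: carrier_monoid_algebra)
  then show ?thesis
  proof (induction f rule: poly_mapping_carrier_induct)
    case (single v d)
    have "act (single v d) g = (\<lambda>y. d * fold left_op v g y)" by (simp add: fun_eq_iff act_single)
    then show ?case by (simp add: mult_monoid_algebra_single act_single fold_left_op_linear)
  next
    case (add f f')
    have "act (f + f') g = (\<lambda>y. act f g y + act f' g y)" by (simp add: fun_eq_iff act_add)
    then show ?case using add by (simp add: mult_monoid_algebra_add_left act_add fold_left_op_linear algebra_simps)
  qed
qed

lemma quadratic_relation_expand:
  "(single [s] 1 - single [] var_v) \<otimes>\<^bsub>FA\<^esub> (single [s] 1 + single [] (inverse var_v)) =
    single [s, s] 1 - single [s] var_q - single [] 1"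
proof -
  have minus: "single [s] 1 - single [] var_v = single [s] 1 + single [] (- var_v)"
    by (simp add: single_uminus)
  have "single [s] var_q = single [s] var_v - single [s] (inverse var_v)"
    by (simp add: var_q_def single_diff)
  then show ?thesis
    unfolding minus mult_monoid_algebra_add_left mult_monoid_algebra_add_right mult_monoid_algebra_single
    by (simp add: var_v_nonzero single_uminus)
qed

lemma hecke_relations_carrier: "hecke_relations S m \<subseteq> carrier FA"
proof -
  have d: "f - f' \<in> carrier FA" if "f \<in> carrier FA" "f' \<in> carrier FA" for f f' :: "'s list \<Rightarrow>\<^sub>0 qv"
    using that keys_diff[of f f'] by (auto simp: carrier_monoid_algebra)
  have s: "single w c \<in> carrier FA" if "w \<in> lists S" for w and c :: qv
    using that by (simp add: single_carrier_monoid_algebra)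
  show ?thesis
    unfolding hecke_relations_def quadratic_relation_expand by (auto intro!: d s alternating_word_lists)
qed

sublocale FA: ring FA by (rule ring_free_algebra)

sublocale I: ideal I FA
  unfolding hecke_ideal_def by (rule FA.genideal_ideal[OF hecke_relations_carrier])

sublocale H: ring H
  unfolding hecke_def by (rule I.quotient_is_ring)

text \<open>The elements that annihilate all class functions form a two-sided ideal: a left factor
  merely replaces the class function by another one, a right factor acts afterwards, on zero. The
  relations belong to it by \<open>fold_left_op_eq\<close> and
  \<open>left_op_square\<close>.\<close>

lemma act_hecke_ideal:
  assumes f: "f \<in> I" and g: "class_fun g"
  shows "act f g y = 0"
proof -
  define K where "K = {f \<in> carrier FA. \<forall>g. class_fun g \<longrightarrow> act f g = (\<lambda>y. 0)}"
  have zero: "fold left_op u (\<lambda>y. 0) = (\<lambda>y. 0)" for u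
    using fold_left_op_linear(1)[of u 0 "\<lambda>y. 0"] by (simp add: fun_eq_iff)
  have "ideal K FA"
  proof (rule monoid.monoid_algebra_idealI[OF monoid_free_monoid])
    fix x a f assume x: "x \<in> carrier (free_monoid S)" and f: "f \<in> K"
    then have fc: "f \<in> carrier FA" and xc: "single x a \<in> carrier FA"
      by (simp_all add: K_def single_carrier_monoid_algebra)
    show "single x a \<otimes>\<^bsub>FA\<^esub> f \<in> K"
      using f x FA.m_closed[OF xc fc] by (auto simp: K_def act_single_mult class_fun_fold_left fun_eq_iff)
    have "act (f \<otimes>\<^bsub>FA\<^esub> single x a) g = (\<lambda>y. 0)" if "class_fun g" for g
    proof
      fix y
      have f0: "act f g = (\<lambda>y. 0)" using f that by (simp add: K_def)
      show "act (f \<otimes>\<^bsub>FA\<^esub> single x a) g y = 0"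
        unfolding act_mult_single[OF fc] f0 zero by simp
    qed
    then show "f \<otimes>\<^bsub>FA\<^esub> single x a \<in> K"
      using FA.m_closed[OF fc xc] by (simp add: K_def)
  next
    show "0 \<in> K" using FA.zero_closed by (simp add: K_def act_zero fun_eq_iff)
    fix f g assume "f \<in> K" "g \<in> K"
    then show "f + g \<in> K" using FA.a_closed[of f g] by (simp add: K_def fun_eq_iff act_add)
  qed (auto simp: K_def)
  moreover have "hecke_relations S m \<subseteq> K"
  proof
    fix f assume f: "f \<in> hecke_relations S m"
    then have fc: "f \<in> carrier FA" using hecke_relations_carrier by blast
    have "act f g y = 0" if g: "class_fun g" for g y
    proof -
      from f consider
        (braid) s t where "s \<in> S" "t \<in> S" "s \<noteq> t"
          "f = single (alternating_word s t (m s t)) 1 - single (alternating_word t s (m s t)) 1"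
      | (quad) s where "s \<in> S" "f = single [s, s] 1 - single [s] var_q - single [] 1"
        unfolding hecke_relations_def quadratic_relation_expand by blast
      then show ?thesis
      proof cases
        case braid
        have "fold left_op (alternating_word s t (m s t)) g = fold left_op (alternating_word t s (m s t)) g"
          using braid m_sym g
          by (intro fold_left_op_eq reduced_alternating_word eq_alternating_word) auto
        then show ?thesis by (simp add: braid act_diff act_single)
      next
        case quad
        then show ?thesis using left_op_square[OF quad(1) g, of y] by (simp add: act_diff act_single)
      qed
    qed
    then show "f \<in> K" using fc by (simp add: K_def fun_eq_iff)
  qed
  ultimately have "I \<subseteq> K" unfolding hecke_ideal_def by (rule FA.genideal_minimal)
  then show ?thesis using f g by (auto simp: K_def fun_eq_iff)
qed

section \<open>Calculation in the quotient algebra\<close>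

definition proj :: "('s list \<Rightarrow>\<^sub>0 qv) \<Rightarrow> ('s list \<Rightarrow>\<^sub>0 qv) set" where
  "proj f = I +>\<^bsub>FA\<^esub> f"

lemma carrier_H: "carrier H = proj ` carrier FA"
  unfolding hecke_def proj_def by (rule I.carrier_quot)

lemma proj_closed: "f \<in> carrier FA \<Longrightarrow> proj f \<in> carrier H"
  by (simp add: carrier_H)

lemma proj_mult: "f \<in> carrier FA \<Longrightarrow> g \<in> carrier FA \<Longrightarrow> proj (f \<otimes>\<^bsub>FA\<^esub> g) = proj f \<otimes>\<^bsub>H\<^esub> proj g"
  and proj_add: "f \<in> carrier FA \<Longrightarrow> g \<in> carrier FA \<Longrightarrow> proj (f + g) = proj f \<oplus>\<^bsub>H\<^esub> proj g"
  and proj_one: "proj (single [] 1) = \<one>\<^bsub>H\<^esub>"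
  using ring_hom_mult[OF I.rcos_ring_hom, of f g] ring_hom_add[OF I.rcos_ring_hom, of f g]
    ring_hom_one[OF I.rcos_ring_hom]
  by (simp_all add: proj_def hecke_def one_monoid_algebra)

lemma proj_eqI: "f - g \<in> I \<Longrightarrow> g \<in> carrier FA \<Longrightarrow> proj f = proj g"
  using I.coset_eqI[of "f - g" g] by (simp add: proj_def)

lemma mem_proj: "f' \<in> proj f \<longleftrightarrow> f' - f \<in> I"
  unfolding proj_def I.mem_coset by (auto simp: algebra_simps)
    (metis add.commute diff_add_cancel)

text \<open>The functional with t_w going to g(w), obtained by evaluating the transposed action at
  the empty word. These functionals later separate the t_w.\<close>

definition phi :: "('s list \<Rightarrow> qv) \<Rightarrow> ('s list \<Rightarrow>\<^sub>0 qv) set \<Rightarrow> qv" where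
  "phi g h = act (SOME f. f \<in> h) g []"

lemma phi_proj:
  assumes f: "f \<in> carrier FA" and g: "class_fun g"
  shows "phi g (proj f) = act f g []"
proof -
  have "f \<in> proj f" using I.zero_closed by (simp add: mem_proj)
  then have "(SOME f'. f' \<in> proj f) \<in> proj f" by (rule someI)
  then have "act ((SOME f'. f' \<in> proj f) - f) g [] = 0"
    by (intro act_hecke_ideal g) (simp add: mem_proj)
  then show ?thesis by (simp add: phi_def act_diff)
qed

abbreviation hmult (infixl "\<odot>" 70) where "x \<odot> y \<equiv> x \<otimes>\<^bsub>H\<^esub> y"
abbreviation hadd (infixl "\<boxplus>" 65) where "x \<boxplus> y \<equiv> x \<oplus>\<^bsub>H\<^esub> y"
abbreviation sc where "sc \<equiv> hecke_scale S m"

definition tw :: "'s list \<Rightarrow> ('s list \<Rightarrow>\<^sub>0 qv) set" where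
  "tw x = proj (single x 1)"

definition scalar :: "qv \<Rightarrow> ('s list \<Rightarrow>\<^sub>0 qv) set" where
  "scalar c = proj (single [] c)"

lemma single_FA: "x \<in> lists S \<Longrightarrow> single x c \<in> carrier FA"
  by (simp add: single_carrier_monoid_algebra)

lemma sc_eq: "sc c h = scalar c \<odot> h"
  by (simp add: hecke_scale_def scalar_def proj_def)

lemma scalar_closed [simp]: "scalar c \<in> carrier H"
  by (simp add: scalar_def proj_closed single_FA)

lemma tw_closed [simp]: "x \<in> lists S \<Longrightarrow> tw x \<in> carrier H"
  by (simp add: tw_def proj_closed single_FA)

lemma tw_Nil: "tw [] = \<one>\<^bsub>H\<^esub>"
  by (simp add: tw_def proj_one)

lemma tw_append: "x \<in> lists S \<Longrightarrow> y \<in> lists S \<Longrightarrow> tw (x @ y) = tw x \<odot> tw y"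
  by (simp add: tw_def single_FA mult_monoid_algebra_single flip: proj_mult)

lemma tw_Cons: "s \<in> S \<Longrightarrow> x \<in> lists S \<Longrightarrow> tw (s # x) = tw [s] \<odot> tw x"
  using tw_append[of "[s]" x] by simp

lemma scalar_add: "scalar (c + d) = scalar c \<boxplus> scalar d"
  and scalar_mult: "scalar (c * d) = scalar c \<odot> scalar d"
  and scalar_one: "scalar 1 = \<one>\<^bsub>H\<^esub>"
  by (simp_all add: scalar_def single_FA single_add mult_monoid_algebra_single proj_one flip: proj_add proj_mult)

lemma scalar_zero: "scalar 0 = \<zero>\<^bsub>H\<^esub>"
  using scalar_add[of 0 0] H.add.l_cancel_one'[of "scalar 0" "scalar 0"] by simp

lemma scalar_proj: "x \<in> lists S \<Longrightarrow> proj (single x c) = scalar c \<odot> tw x"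
  by (simp add: scalar_def tw_def single_FA mult_monoid_algebra_single flip: proj_mult)

lemma scalar_central:
  assumes "h \<in> carrier H"
  shows "h \<odot> scalar c = scalar c \<odot> h"
proof -
  obtain f where f: "h = proj f" "f \<in> carrier FA" using assms by (auto simp: carrier_H)
  have "f \<otimes>\<^bsub>FA\<^esub> single [] c = single [] c \<otimes>\<^bsub>FA\<^esub> f"
  proof -
    have "keys f \<subseteq> lists S" "lists S \<noteq> {}" using f by (auto simp: carrier_monoid_algebra)
    then show ?thesis
      by (induction f rule: poly_mapping_carrier_induct)
        (simp_all add: mult_monoid_algebra_single mult_monoid_algebra_add_left mult_monoid_algebra_add_right mult.commute)
  qed
  then show ?thesis using f by (simp add: scalar_def single_FA flip: proj_mult)
qed

lemma sc_closed [simp]: "h \<in> carrier H \<Longrightarrow> sc c h \<in> carrier H"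
  by (simp add: sc_eq)

lemma sc_add_right: "h \<in> carrier H \<Longrightarrow> h' \<in> carrier H \<Longrightarrow> sc c (h \<boxplus> h') = sc c h \<boxplus> sc c h'"
  by (simp add: sc_eq H.r_distr)

lemma sc_add_left: "h \<in> carrier H \<Longrightarrow> sc (c + d) h = sc c h \<boxplus> sc d h"
  by (simp add: sc_eq scalar_add H.l_distr)

lemma sc_sc: "h \<in> carrier H \<Longrightarrow> sc c (sc d h) = sc (c * d) h"
  by (simp add: sc_eq scalar_mult H.m_assoc)

lemma sc_one [simp]: "h \<in> carrier H \<Longrightarrow> sc 1 h = h"
  by (simp add: sc_eq scalar_one)

lemma sc_zero [simp]: "h \<in> carrier H \<Longrightarrow> sc 0 h = \<zero>\<^bsub>H\<^esub>"
  by (simp add: sc_eq scalar_zero)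

lemma sc_mult_left: "h \<in> carrier H \<Longrightarrow> h' \<in> carrier H \<Longrightarrow> sc c h \<odot> h' = sc c (h \<odot> h')"
  by (simp add: sc_eq H.m_assoc)

lemma sc_mult_right: "h \<in> carrier H \<Longrightarrow> h' \<in> carrier H \<Longrightarrow> h \<odot> sc c h' = sc c (h \<odot> h')"
  by (simp add: sc_eq scalar_central flip: H.m_assoc)

lemma sc_mult_one: "h \<in> carrier H \<Longrightarrow> sc c \<one>\<^bsub>H\<^esub> \<odot> h = sc c h"
  "h \<in> carrier H \<Longrightarrow> h \<odot> sc c \<one>\<^bsub>H\<^esub> = sc c h"
  by (simp_all add: sc_mult_left sc_mult_right)

lemma H_induct [consumes 1, case_names word add]:
  assumes h: "h \<in> carrier H"
    and word: "\<And>x c. x \<in> lists S \<Longrightarrow> P (sc c (tw x))"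
    and add: "\<And>h h'. h \<in> carrier H \<Longrightarrow> h' \<in> carrier H \<Longrightarrow> P h \<Longrightarrow> P h' \<Longrightarrow> P (h \<boxplus> h')"
  shows "P h"
proof -
  obtain f where f: "h = proj f" "f \<in> carrier FA" using h by (auto simp: carrier_H)
  then have "keys f \<subseteq> lists S" "lists S \<noteq> {}" by (auto simp: carrier_monoid_algebra)
  then have "P (proj f)"
  proof (induction f rule: poly_mapping_carrier_induct)
    case (single x a)
    then show ?case using word[of x a] by (simp add: scalar_proj sc_eq)
  next
    case (add f g)
    then show ?case using assms(3)[of "proj f" "proj g"] by (simp add: proj_add proj_closed carrier_monoid_algebra)
  qed
  then show ?thesis using f by simp
qed

lemma tw_square: "s \<in> S \<Longrightarrow> tw [s] \<odot> tw [s] = \<one>\<^bsub>H\<^esub> \<boxplus> sc var_q (tw [s])"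
proof -
  assume s: "s \<in> S"
  have "single [s, s] 1 - single [s] var_q - single [] 1 \<in> hecke_relations S m"
    unfolding hecke_relations_def quadratic_relation_expand using s by blast
  then have "single [s, s] 1 - (single [] 1 + single [s] var_q) \<in> I"
    using FA.genideal_self[OF hecke_relations_carrier] by (auto simp: hecke_ideal_def algebra_simps)
  then have "proj (single [s, s] 1) = proj (single [] 1 + single [s] var_q)"
    using s by (intro proj_eqI) (auto intro: FA.a_closed[simplified] single_FA)
  then have "tw [s, s] = \<one>\<^bsub>H\<^esub> \<boxplus> sc var_q (tw [s])"
    using s by (simp add: proj_add single_FA tw_def[symmetric] scalar_proj sc_eq tw_Nil)
  then show ?thesis using tw_Cons[of s "[s]"] s by simp
qed

lemma tw_braid_eq: "braid_eq m x y \<Longrightarrow> x \<in> lists S \<Longrightarrow> tw x = tw y"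
proof (induction rule: braid_eq.induct)
  case (sym x y)
  from braid_eq_lists[OF braid_eq.sym[OF sym.hyps]] sym.prems have "x \<in> lists S" .
  then show ?case using sym.IH by simp
next
  case (trans x y z)
  from braid_eq_lists[OF trans.hyps(1)] trans.prems have "y \<in> lists S" .
  then show ?case using trans.IH trans.prems by simp
next
  case (rel s t u v)
  let ?a = "alternating_word s t (m s t)" and ?b = "alternating_word t s (m s t)"
  have "set ?a \<subseteq> S" using rel by (auto simp: in_lists_conv_set)
  then have st: "s \<in> S" "t \<in> S" using set_alternating_word[OF rel(2), of s t] by auto
  then have ab: "?a \<in> lists S" "?b \<in> lists S" by (simp_all add: alternating_word_lists)
  have "single ?a 1 - single ?b 1 \<in> hecke_relations S m"
    unfolding hecke_relations_def using st rel(1) by blast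
  then have "single ?a 1 - single ?b 1 \<in> I"
    using FA.genideal_self[OF hecke_relations_carrier] by (auto simp: hecke_ideal_def)
  then have "tw ?a = tw ?b" using ab by (simp add: tw_def proj_eqI single_FA)
  then show ?case using rel(3) ab by (simp add: tw_append)
qed simp

lemma tw_eq: "reduced x \<Longrightarrow> reduced y \<Longrightarrow> x \<approx> y \<Longrightarrow> tw x = tw y"
  using tw_braid_eq matsumoto reduced_lists by blast

section \<open>The elements t_w span the algebra\<close>

lemma hecke_gen_eq: "hecke_gen S m s = tw [s]"
  by (simp add: hecke_gen_def tw_def proj_def)

lemma foldr_tw: "x \<in> lists S \<Longrightarrow> foldr (\<lambda>s h. hecke_gen S m s \<odot> h) x \<one>\<^bsub>H\<^esub> = tw x"
  by (induction x) (simp_all add: tw_Nil hecke_gen_eq tw_Cons[symmetric])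

lemma hecke_T_cls: "reduced x \<Longrightarrow> hecke_T S m (cls x) = tw x"
proof -
  assume x: "reduced x"
  have r: "x \<approx> rep (cls x)" "reduced (rep (cls x))" using rep_cls[OF reduced_lists[OF x]] by auto
  have "hecke_T S m (cls x) = tw (rep (cls x))"
    using foldr_tw[OF reduced_lists[OF r(2)]] by (simp add: hecke_T_def rep_def)
  then show ?thesis using tw_eq[OF x r(2,1)] by simp
qed

lemma hecke_T_closed: "w \<in> carrier W \<Longrightarrow> hecke_T S m w \<in> carrier H"
  using hecke_T_cls[of "rep w"] carrier_W_rep[of w] reduced_lists by simp

text \<open>Contains 1 and is stable under left multiplication by generators, hence is the whole
  algebra.\<close>

inductive_set reduced_span :: "('s list \<Rightarrow>\<^sub>0 qv) set set" where
  base: "reduced x \<Longrightarrow> sc c (tw x) \<in> reduced_span"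
| add: "h \<in> reduced_span \<Longrightarrow> h' \<in> reduced_span \<Longrightarrow> h \<boxplus> h' \<in> reduced_span"

lemma reduced_span_carrier: "h \<in> reduced_span \<Longrightarrow> h \<in> carrier H"
  by (induction rule: reduced_span.induct) (auto simp: reduced_lists)

lemma sc_reduced_span: "h \<in> reduced_span \<Longrightarrow> sc c h \<in> reduced_span"
  by (induction rule: reduced_span.induct)
    (auto simp: sc_sc reduced_lists sc_add_right reduced_span_carrier intro: reduced_span.intros)

text \<open>When s is a left descent, some reduced word of the element begins with s, and by
  Matsumoto it defines the same basis element.\<close>

lemma descent_word:
  assumes "s \<in> S" "reduced x" "\<not> reduced (s # x)"
  obtains x' where "reduced x'" "reduced (s # x')" "x \<approx> s # x'" "tw x = tw [s] \<odot> tw x'"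
proof -
  have l: "x \<in> lists S" using assms reduced_lists by blast
  obtain y where y: "s # x \<approx> y" "reduced y" "length y = len (s # x)" using ex_reduced[of "s # x"] assms l by auto
  have eq: "x \<approx> s # y" using eq_Cons_swap[OF y(1)] .
  have "len x = Suc (len (s # x))"
    using reduced_Cons_iff[OF assms(1,2)] len_Cons_cases[OF assms(1) l] assms(3) by linarith
  then have red: "reduced (s # y)"
    using reduced_transfer[OF assms(2) eq] y(3) assms(2) by (simp add: reduced_def)
  have "tw x = tw (s # y)" using tw_eq[OF assms(2) red eq] .
  then show ?thesis using that[OF y(2) red eq] tw_Cons[OF assms(1) reduced_lists[OF y(2)]] by simp
qed

lemma gen_mult_descent:
  assumes "s \<in> S" "x' \<in> lists S" "tw x = tw [s] \<odot> tw x'"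
  shows "tw [s] \<odot> tw x = tw x' \<boxplus> sc var_q (tw x)"
  using assms by (simp add: tw_square H.l_distr sc_mult_left flip: H.m_assoc)

lemma gen_mult_reduced_span:
  assumes s: "s \<in> S"
  shows "h \<in> reduced_span \<Longrightarrow> tw [s] \<odot> h \<in> reduced_span"
proof (induction rule: reduced_span.induct)
  case (base x c)
  have l: "x \<in> lists S" using base reduced_lists by blast
  have "tw [s] \<odot> tw x \<in> reduced_span"
  proof (cases "reduced (s # x)")
    case True
    then show ?thesis using reduced_span.base[OF True, of 1] tw_Cons[of s x] s l by simp
  next
    case False
    obtain x' where x': "reduced x'" "tw x = tw [s] \<odot> tw x'" using descent_word[OF s base False] by blast
    show ?thesis
      using gen_mult_descent[OF s _ x'(2)] reduced_lists[OF x'(1)]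
        reduced_span.add[OF reduced_span.base[OF x'(1), of 1] reduced_span.base[OF base, of var_q]] by simp
  qed
  then show ?case using sc_reduced_span s l by (simp add: sc_mult_right)
next
  case (add h h')
  then show ?case using s by (simp add: H.r_distr reduced_span_carrier reduced_span.add)
qed

lemma carrier_reduced_span: "h \<in> carrier H \<Longrightarrow> h \<in> reduced_span"
proof (induction h rule: H_induct)
  case (word x c)
  then have "tw x \<in> reduced_span"
  proof (induction x)
    case Nil
    then show ?case using reduced_span.base[OF reduced_Nil, of 1] by simp
  next
    case (Cons s x)
    then show ?case using gen_mult_reduced_span[of s "tw x"] tw_Cons[of s x] by simp
  qed
  then show ?case by (rule sc_reduced_span)
qed (rule reduced_span.add)

lemma H_reduced_induct [consumes 1, case_names word add]:
  assumes h: "h \<in> carrier H"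
    and word: "\<And>x c. reduced x \<Longrightarrow> P (sc c (tw x))"
    and add: "\<And>h h'. h \<in> carrier H \<Longrightarrow> h' \<in> carrier H \<Longrightarrow> P h \<Longrightarrow> P h' \<Longrightarrow> P (h \<boxplus> h')"
  shows "P h"
proof -
  have "h \<in> reduced_span" using h by (rule carrier_reduced_span)
  then show ?thesis
    by (induction rule: reduced_span.induct) (auto simp: word add reduced_span_carrier)
qed

lemma phi_add: "class_fun g \<Longrightarrow> h \<in> carrier H \<Longrightarrow> h' \<in> carrier H \<Longrightarrow> phi g (h \<boxplus> h') = phi g h + phi g h'"
  by (auto simp: carrier_H phi_proj act_add FA.a_closed[simplified] simp flip: proj_add)

lemma phi_sc_tw: "class_fun g \<Longrightarrow> x \<in> lists S \<Longrightarrow> phi g (sc c (tw x)) = c * fold left_op x g []"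
  by (simp add: sc_eq scalar_proj[symmetric] phi_proj single_FA act_single)

lemma phi_tw: "class_fun g \<Longrightarrow> x \<in> lists S \<Longrightarrow> phi g (tw x) = fold left_op x g []"
  using phi_sc_tw[of g x 1] by simp

lemma phi_reduced: "class_fun g \<Longrightarrow> reduced x \<Longrightarrow> phi g (sc c (tw x)) = c * g x"
  using phi_sc_tw[of g x c] fold_left_op_reduced[of x "[]" g] by (simp add: reduced_lists)

lemma phi_sc:
  assumes "class_fun g" "h \<in> carrier H"
  shows "phi g (sc c h) = c * phi g h"
  using assms(2)
proof (induction h rule: H_induct)
  case (word x d)
  then show ?case using assms(1) by (simp add: sc_sc phi_sc_tw)
next
  case (add h h')
  then show ?case using assms(1) by (simp add: sc_add_right phi_add algebra_simps)
qed

end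

context coxeter_words
begin

subsection \<open>Inverses of the basis elements\<close>

abbreviation tinv :: "'s list \<Rightarrow> ('s list \<Rightarrow>\<^sub>0 qv) set" where
  "tinv x \<equiv> inv\<^bsub>H\<^esub> (tw x)"

lemma tw_gen_inverse:
  assumes s: "s \<in> S"
  shows "tw [s] \<in> Units H" "tinv [s] = tw [s] \<boxplus> sc (- var_q) \<one>\<^bsub>H\<^esub>"
proof -
  let ?u = "tw [s] \<boxplus> sc (- var_q) \<one>\<^bsub>H\<^esub>"
  have t: "tw [s] \<in> carrier H" using s by simp
  have z: "sc var_q (tw [s]) \<boxplus> sc (- var_q) (tw [s]) = \<zero>\<^bsub>H\<^esub>"
    using sc_add_left[OF t, of var_q "- var_q"] t by simp
  have r: "tw [s] \<odot> ?u = \<one>\<^bsub>H\<^esub>"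
    using t z by (simp add: H.r_distr tw_square[OF s] sc_mult_one H.a_assoc)
  have l: "?u \<odot> tw [s] = \<one>\<^bsub>H\<^esub>"
    using t z by (simp add: H.l_distr tw_square[OF s] sc_mult_one H.a_assoc)
  show "tw [s] \<in> Units H" using r l t by (auto simp: Units_def)
  show "tinv [s] = ?u" using H.inv_unique'[OF t _ r l] t by simp
qed

lemma tw_Units: "x \<in> lists S \<Longrightarrow> tw x \<in> Units H"
proof (induction x)
  case Nil
  then show ?case by (simp add: tw_Nil)
next
  case (Cons s x)
  then show ?case using tw_Cons[of s x] tw_gen_inverse(1)[of s] by simp
qed

lemma tinv_closed [simp]: "x \<in> lists S \<Longrightarrow> tinv x \<in> carrier H"
  by (simp add: tw_Units)

lemma tinv_right: "x \<in> lists S \<Longrightarrow> tw x \<odot> tinv x = \<one>\<^bsub>H\<^esub>"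
  and tinv_left: "x \<in> lists S \<Longrightarrow> tinv x \<odot> tw x = \<one>\<^bsub>H\<^esub>"
  by (simp_all add: tw_Units)

lemma tinv_right': "x \<in> lists S \<Longrightarrow> h \<in> carrier H \<Longrightarrow> tw x \<odot> (tinv x \<odot> h) = h"
  and tinv_left': "x \<in> lists S \<Longrightarrow> h \<in> carrier H \<Longrightarrow> tinv x \<odot> (tw x \<odot> h) = h"
  by (simp_all add: tinv_right tinv_left flip: H.m_assoc)

lemma tinv_append:
  assumes "x \<in> lists S" "y \<in> lists S"
  shows "tinv (x @ y) = tinv y \<odot> tinv x"
  by (rule H.inv_unique'[symmetric])
    (use assms in \<open>simp_all add: tw_append H.m_assoc tinv_right tinv_left tinv_right' tinv_left'\<close>)

lemma tinv_gen_square: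
  assumes s: "s \<in> S"
  shows "tinv [s] \<odot> tinv [s] = \<one>\<^bsub>H\<^esub> \<boxplus> sc (- var_q) (tinv [s])"
proof -
  have i: "tinv [s] \<in> carrier H" "tw [s] \<in> carrier H" using s by simp_all
  have "tinv [s] \<odot> tinv [s] = tinv [s] \<odot> (tw [s] \<boxplus> sc (- var_q) \<one>\<^bsub>H\<^esub>)"
    using tw_gen_inverse(2)[OF s] by simp
  also have "\<dots> = \<one>\<^bsub>H\<^esub> \<boxplus> sc (- var_q) (tinv [s])"
    using i s tinv_left[of "[s]"] by (simp add: H.r_distr sc_mult_one)
  finally show ?thesis .
qed

subsection \<open>Coordinates and semilinear maps\<close>

definition delta :: "'s list \<Rightarrow> 's list \<Rightarrow> qv" where
  "delta u x = (if x \<approx> u then 1 else 0)"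

lemma class_fun_delta: "class_fun (delta u)"
  unfolding class_fun_def delta_def
proof (intro conjI allI impI)
  fix x y assume "x \<approx> y"
  then have "x \<approx> u \<longleftrightarrow> y \<approx> u" by (blast intro: cox_eq.sym cox_eq.trans)
  then show "(if x \<approx> u then 1 else 0) = (if y \<approx> u then 1 else 0 :: qv)" by simp
qed (use eq_lists1 in auto)

text \<open>The common shape of the sums in \<open>hecke_coords\<close>, \<open>hecke_bar\<close>
  and \<open>hecke_anti\<close>; \<beta> is \<open>bar_A\<close> or the identity.\<close>

definition lincomb ::
    "(qv \<Rightarrow> qv) \<Rightarrow> ('s list set \<Rightarrow> ('s list \<Rightarrow>\<^sub>0 qv) set) \<Rightarrow> ('s list set \<Rightarrow>\<^sub>0 qv) \<Rightarrow> ('s list \<Rightarrow>\<^sub>0 qv) set" where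
  "lincomb \<beta> b c = (\<Oplus>\<^bsub>H\<^esub>w\<in>keys c. sc (\<beta> (lookup c w)) (b w))"

context
  fixes \<beta> :: "qv \<Rightarrow> qv" and b :: "'s list set \<Rightarrow> ('s list \<Rightarrow>\<^sub>0 qv) set"
  assumes \<beta>: "field_embedding \<beta>" and b: "b \<in> carrier W \<rightarrow> carrier H"
begin

lemma lincomb_superset:
  assumes "finite A" "keys c \<subseteq> A" "A \<subseteq> carrier W"
  shows "lincomb \<beta> b c = (\<Oplus>\<^bsub>H\<^esub>w\<in>A. sc (\<beta> (lookup c w)) (b w))"
  unfolding lincomb_def
proof (rule H.add.finprod_mono_neutral_cong_left)
  fix w assume "w \<in> A - keys c"
  then show "sc (\<beta> (lookup c w)) (b w) = \<zero>\<^bsub>H\<^esub>"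
    using assms(3) funcset_mem[OF b] by (auto simp: in_keys_iff field_embedding.zero[OF \<beta>])
qed (use assms funcset_mem[OF b] in auto)

lemma lincomb_closed: "keys c \<subseteq> carrier W \<Longrightarrow> lincomb \<beta> b c \<in> carrier H"
  unfolding lincomb_def using funcset_mem[OF b] by (intro H.finsum_closed) auto

lemma lincomb_add:
  assumes "keys c \<subseteq> carrier W" "keys c' \<subseteq> carrier W"
  shows "lincomb \<beta> b (c + c') = lincomb \<beta> b c \<boxplus> lincomb \<beta> b c'"
proof -
  let ?A = "keys c \<union> keys c' \<union> keys (c + c')"
  have A: "?A \<subseteq> carrier W" using assms Poly_Mapping.keys_add[of c c'] by blast
  have "lincomb \<beta> b (c + c') = (\<Oplus>\<^bsub>H\<^esub>w\<in>?A. sc (\<beta> (lookup c w)) (b w) \<boxplus> sc (\<beta> (lookup c' w)) (b w))"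
  proof (subst lincomb_superset[OF _ _ A])
    show "(\<Oplus>\<^bsub>H\<^esub>w\<in>?A. sc (\<beta> (lookup (c + c') w)) (b w)) =
        (\<Oplus>\<^bsub>H\<^esub>w\<in>?A. sc (\<beta> (lookup c w)) (b w) \<boxplus> sc (\<beta> (lookup c' w)) (b w))"
    proof (rule H.add.finprod_cong')
      fix w assume "w \<in> ?A"
      then have "b w \<in> carrier H" using A funcset_mem[OF b] by blast
      then show "sc (\<beta> (lookup (c + c') w)) (b w) = sc (\<beta> (lookup c w)) (b w) \<boxplus> sc (\<beta> (lookup c' w)) (b w)"
        by (simp add: lookup_add field_embedding.add[OF \<beta>] sc_add_left)
    next
      show "(\<lambda>w. sc (\<beta> (lookup c w)) (b w) \<boxplus> sc (\<beta> (lookup c' w)) (b w)) \<in> ?A \<rightarrow> carrier H"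
        using A funcset_mem[OF b] by (intro funcsetI H.a_closed sc_closed) blast+
    qed simp
  qed auto
  also have "\<dots> = (\<Oplus>\<^bsub>H\<^esub>w\<in>?A. sc (\<beta> (lookup c w)) (b w)) \<boxplus> (\<Oplus>\<^bsub>H\<^esub>w\<in>?A. sc (\<beta> (lookup c' w)) (b w))"
  proof (rule H.finsum_addf)
    show "(\<lambda>w. sc (\<beta> (lookup c w)) (b w)) \<in> ?A \<rightarrow> carrier H"
      and "(\<lambda>w. sc (\<beta> (lookup c' w)) (b w)) \<in> ?A \<rightarrow> carrier H"
      using A funcset_mem[OF b] by (intro funcsetI sc_closed; blast)+
  qed
  also have "\<dots> = lincomb \<beta> b c \<boxplus> lincomb \<beta> b c'"
  proof -
    have "keys c \<subseteq> ?A" "keys c' \<subseteq> ?A" by auto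
    then show ?thesis using lincomb_superset[OF _ _ A] by simp
  qed
  finally show ?thesis .
qed

lemma lincomb_single:
  assumes "w \<in> carrier W"
  shows "lincomb \<beta> b (single w a) = sc (\<beta> a) (b w)"
proof -
  have "lincomb \<beta> b (single w a) = (\<Oplus>\<^bsub>H\<^esub>w'\<in>{w}. sc (\<beta> (lookup (single w a) w')) (b w'))"
    by (rule lincomb_superset) (use assms in auto)
  also have "\<dots> = sc (\<beta> a) (b w)" using funcset_mem[OF b assms] by simp
  finally show ?thesis .
qed

end

abbreviation T where "T \<equiv> hecke_T S m"

lemma T_funcset: "T \<in> carrier W \<rightarrow> carrier H"
  using hecke_T_closed by blast

text \<open>The functional dual to t_u reads off one coefficient; for \<beta> the identity this is
  linear independence of the t_w.\<close>

lemma phi_lincomb_T: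
  assumes \<beta>: "field_embedding \<beta>" and c: "keys c \<subseteq> carrier W" and u: "u \<in> carrier W"
  shows "phi (delta (rep u)) (lincomb \<beta> T c) = \<beta> (lookup c u)"
proof -
  have ne: "carrier W \<noteq> {}" using u by blast
  from c ne show ?thesis
  proof (induction c rule: poly_mapping_carrier_induct)
    case (single w a)
    have "phi (delta (rep u)) (lincomb \<beta> T (single w a)) = phi (delta (rep u)) (sc (\<beta> a) (tw (rep w)))"
      using lincomb_single[OF \<beta> T_funcset single] hecke_T_cls[OF carrier_W_rep(1)[OF single]]
        carrier_W_rep(2)[OF single] by simp
    also have "\<dots> = \<beta> a * delta (rep u) (rep w)"
      by (rule phi_reduced[OF class_fun_delta carrier_W_rep(1)[OF single]])
    also have "\<dots> = \<beta> (lookup (single w a) u)"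
    proof -
      have "rep w \<approx> rep u \<longleftrightarrow> w = u"
        using cls_eq_iff[OF reduced_lists[OF carrier_W_rep(1)[OF single]], of "rep u"]
          carrier_W_rep(2)[OF single] carrier_W_rep(2)[OF u] by simp
      then show ?thesis by (simp add: delta_def lookup_single when_def field_embedding.zero[OF \<beta>])
    qed
    finally show ?case .
  next
    case (add f g)
    then show ?case
      by (simp add: lincomb_add[OF \<beta> T_funcset] phi_add class_fun_delta lookup_add
          lincomb_closed[OF \<beta> T_funcset] field_embedding.add[OF \<beta>])
  qed
qed

lemma id_field_embedding: "field_embedding (\<lambda>c :: qv. c)"
  by (rule id_embedding.field_embedding_axioms)

lemma hecke_coords_eq: "hecke_coords S m b h = (THE c. keys c \<subseteq> carrier W \<and> h = lincomb (\<lambda>c. c) b c)"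
  by (simp add: hecke_coords_def lincomb_def)

lemma hecke_coords_lincomb:
  assumes c: "keys c \<subseteq> carrier W"
  shows "hecke_coords S m T (lincomb (\<lambda>c. c) T c) = c"
  unfolding hecke_coords_eq
proof (rule the_equality)
  fix c' assume c': "keys c' \<subseteq> carrier W \<and> lincomb (\<lambda>c. c) T c = lincomb (\<lambda>c. c) T c'"
  show "c' = c"
  proof (rule poly_mapping_eqI)
    fix w
    show "lookup c' w = lookup c w"
    proof (cases "w \<in> carrier W")
      case True
      then show ?thesis
        using phi_lincomb_T[OF id_field_embedding c True] phi_lincomb_T[OF id_field_embedding _ True, of c'] c'
        by simp
    next
      case False
      then have "w \<notin> keys c" "w \<notin> keys c'" using c c' by blast+
      then show ?thesis by (simp add: in_keys_iff)
    qed
  qed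
qed (use c in simp)

lemma ex_coords: "h \<in> carrier H \<Longrightarrow> \<exists>c. keys c \<subseteq> carrier W \<and> h = lincomb (\<lambda>c. c) T c"
proof (induction h rule: H_reduced_induct)
  case (word x a)
  have "cls x \<in> carrier W" using word by (simp add: carrier_W reduced_lists)
  then show ?case
    using lincomb_single[OF id_field_embedding T_funcset, of "cls x" a] hecke_T_cls[OF word]
    by (intro exI[of _ "single (cls x) a"]) simp
next
  case (add h h')
  then obtain c c' where c: "keys c \<subseteq> carrier W" "h = lincomb (\<lambda>c. c) T c"
    "keys c' \<subseteq> carrier W" "h' = lincomb (\<lambda>c. c) T c'" by blast
  then show ?case
    using lincomb_add[OF id_field_embedding T_funcset c(1,3)] Poly_Mapping.keys_add[of c c']
    by (intro exI[of _ "c + c'"]) auto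
qed

lemma coords:
  assumes "h \<in> carrier H"
  shows "keys (hecke_coords S m T h) \<subseteq> carrier W" "lincomb (\<lambda>c. c) T (hecke_coords S m T h) = h"
proof -
  obtain c where c: "keys c \<subseteq> carrier W" "h = lincomb (\<lambda>c. c) T c" using ex_coords[OF assms] by blast
  show "keys (hecke_coords S m T h) \<subseteq> carrier W" "lincomb (\<lambda>c. c) T (hecke_coords S m T h) = h"
    using hecke_coords_lincomb[OF c(1)] c by simp_all
qed

lemma coords_add:
  assumes "h \<in> carrier H" "h' \<in> carrier H"
  shows "hecke_coords S m T (h \<boxplus> h') = hecke_coords S m T h + hecke_coords S m T h'"
proof -
  let ?c = "hecke_coords S m T h" and ?c' = "hecke_coords S m T h'"
  have "h \<boxplus> h' = lincomb (\<lambda>c. c) T (?c + ?c')"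
    using lincomb_add[OF id_field_embedding T_funcset, of ?c ?c'] coords[OF assms(1)] coords[OF assms(2)] by simp
  moreover have "keys (?c + ?c') \<subseteq> carrier W"
    using Poly_Mapping.keys_add[of ?c ?c'] coords(1)[OF assms(1)] coords(1)[OF assms(2)] by blast
  ultimately show ?thesis using hecke_coords_lincomb by simp
qed

lemma coords_sc_tw:
  assumes "reduced x"
  shows "hecke_coords S m T (sc a (tw x)) = single (cls x) a"
proof -
  have w: "cls x \<in> carrier W" using assms by (simp add: carrier_W reduced_lists)
  have "sc a (tw x) = lincomb (\<lambda>c. c) T (single (cls x) a)"
    using lincomb_single[OF id_field_embedding T_funcset w, of a] hecke_T_cls[OF assms] by simp
  then show ?thesis using hecke_coords_lincomb[of "single (cls x) a"] w by simp
qed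

section \<open>Semilinear maps prescribed on the basis, for the bar involution and the
  anti-involution\<close>

context
  fixes \<beta> :: "qv \<Rightarrow> qv" and b :: "'s list set \<Rightarrow> ('s list \<Rightarrow>\<^sub>0 qv) set"
    and F :: "('s list \<Rightarrow>\<^sub>0 qv) set \<Rightarrow> ('s list \<Rightarrow>\<^sub>0 qv) set"
  assumes \<beta>: "field_embedding \<beta>" and b: "b \<in> carrier W \<rightarrow> carrier H"
    and F: "\<And>h. F h = lincomb \<beta> b (hecke_coords S m T h)"
begin

lemma basis_ext_closed: "h \<in> carrier H \<Longrightarrow> F h \<in> carrier H"
  unfolding F by (rule lincomb_closed[OF \<beta> b coords(1)])

lemma basis_ext_add: "h \<in> carrier H \<Longrightarrow> h' \<in> carrier H \<Longrightarrow> F (h \<boxplus> h') = F h \<boxplus> F h'"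
  unfolding F by (simp add: coords_add lincomb_add[OF \<beta> b] coords(1))

lemma basis_ext_word: "reduced x \<Longrightarrow> F (sc a (tw x)) = sc (\<beta> a) (b (cls x))"
  unfolding F by (simp add: coords_sc_tw lincomb_single[OF \<beta> b] carrier_W reduced_lists)

lemma basis_ext_sc:
  assumes "h \<in> carrier H"
  shows "F (sc a h) = sc (\<beta> a) (F h)"
  using assms
proof (induction h rule: H_reduced_induct)
  case (word x c)
  have "b (cls x) \<in> carrier H" using word by (intro funcset_mem[OF b]) (simp add: carrier_W reduced_lists)
  then show ?case using word by (simp add: sc_sc reduced_lists basis_ext_word field_embedding.mult[OF \<beta>])
next
  case (add h h')
  then show ?case by (simp add: sc_add_right basis_ext_add basis_ext_closed)
qed

end

subsection \<open>The bar involution and the anti-involution\<close>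

abbreviation bar where "bar \<equiv> hecke_bar S m"
abbreviation anti where "anti \<equiv> hecke_anti S m"

lemma bar_lincomb: "bar h = lincomb bar_A (\<lambda>w. inv\<^bsub>H\<^esub> (T (inv\<^bsub>W\<^esub> w))) (hecke_coords S m T h)"
  by (simp add: hecke_bar_def lincomb_def Let_def)

lemma anti_lincomb: "anti h = lincomb (\<lambda>c. c) (\<lambda>w. T (inv\<^bsub>W\<^esub> w)) (hecke_coords S m T h)"
  by (simp add: hecke_anti_def lincomb_def Let_def)

lemma T_inv_cls: "reduced x \<Longrightarrow> T (inv\<^bsub>W\<^esub> (cls x)) = tw (rev x)"
  using hecke_T_cls[of "rev x"] by (simp add: inv_W reduced_lists reduced_rev)

lemma T_inv_closed:
  assumes "w \<in> carrier W"
  shows "T (inv\<^bsub>W\<^esub> w) \<in> carrier H" "inv\<^bsub>H\<^esub> (T (inv\<^bsub>W\<^esub> w)) \<in> carrier H"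
  using T_inv_cls[OF carrier_W_rep(1)[OF assms]] carrier_W_rep(2)[OF assms]
    reduced_lists[OF carrier_W_rep(1)[OF assms]] by simp_all

lemma T_inv_funcset:
  "(\<lambda>w. T (inv\<^bsub>W\<^esub> w)) \<in> carrier W \<rightarrow> carrier H" "(\<lambda>w. inv\<^bsub>H\<^esub> (T (inv\<^bsub>W\<^esub> w))) \<in> carrier W \<rightarrow> carrier H"
  using T_inv_closed by blast+

lemmas bar_embedding = bar_A.field_embedding_axioms

lemma bar_closed [simp]: "h \<in> carrier H \<Longrightarrow> bar h \<in> carrier H"
  by (rule basis_ext_closed[OF bar_embedding T_inv_funcset(2) bar_lincomb])

lemma bar_add: "h \<in> carrier H \<Longrightarrow> h' \<in> carrier H \<Longrightarrow> bar (h \<boxplus> h') = bar h \<boxplus> bar h'"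
  by (rule basis_ext_add[OF bar_embedding T_inv_funcset(2) bar_lincomb])

lemma bar_sc: "h \<in> carrier H \<Longrightarrow> bar (sc c h) = sc (bar_A c) (bar h)"
  by (rule basis_ext_sc[OF bar_embedding T_inv_funcset(2) bar_lincomb])

lemma bar_reduced: "reduced x \<Longrightarrow> bar (tw x) = tinv (rev x)"
  using basis_ext_word[OF bar_embedding T_inv_funcset(2) bar_lincomb, of x 1] T_inv_cls[of x]
  by (simp add: bar_A.one reduced_lists)

lemma anti_closed [simp]: "h \<in> carrier H \<Longrightarrow> anti h \<in> carrier H"
  by (rule basis_ext_closed[OF id_field_embedding T_inv_funcset(1) anti_lincomb])

lemma anti_add: "h \<in> carrier H \<Longrightarrow> h' \<in> carrier H \<Longrightarrow> anti (h \<boxplus> h') = anti h \<boxplus> anti h'"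
  by (rule basis_ext_add[OF id_field_embedding T_inv_funcset(1) anti_lincomb])

lemma anti_sc: "h \<in> carrier H \<Longrightarrow> anti (sc c h) = sc c (anti h)"
  by (rule basis_ext_sc[OF id_field_embedding T_inv_funcset(1) anti_lincomb])

lemma anti_reduced: "reduced x \<Longrightarrow> anti (tw x) = tw (rev x)"
  using basis_ext_word[OF id_field_embedding T_inv_funcset(1) anti_lincomb, of x 1] T_inv_cls[of x]
  by (simp add: reduced_lists)

lemma rev_descent:
  assumes x: "reduced x" and x': "reduced (s # x')" "x \<approx> s # x'"
  shows "tw (rev x) = tw (rev x') \<odot> tw [s]"
proof -
  have "rev x \<approx> rev (s # x')" using eq_rev[OF x'(2)] .
  moreover have "reduced (rev x)" "reduced (rev (s # x'))" using x x'(1) reduced_rev by blast+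
  ultimately have "tw (rev x) = tw (rev (s # x'))" using tw_eq by blast
  then show ?thesis using reduced_lists[OF x'(1)] by (simp add: tw_append)
qed

text \<open>\<open>bar\<close> is given on the basis only, so multiplicativity starts with t_s t_x.
  If s is a descent of x, the quadratic relation of t_s on one side is matched with that of t_s^-1
  on the other; they differ by the sign of q, which is the effect of \<open>bar_A\<close>.\<close>

lemma bar_gen_mult:
  assumes s: "s \<in> S" and h: "h \<in> carrier H"
  shows "bar (tw [s] \<odot> h) = tinv [s] \<odot> bar h"
  using h
proof (induction h rule: H_reduced_induct)
  case (word x c)
  have l: "x \<in> lists S" using word by (rule reduced_lists)
  have "bar (tw [s] \<odot> tw x) = tinv [s] \<odot> bar (tw x)"
  proof (cases "reduced (s # x)")
    case True
    then show ?thesis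
      using bar_reduced[OF True] bar_reduced[OF word] tw_Cons[OF s l] tinv_append[of "rev x" "[s]"] s l by simp
  next
    case False
    obtain x' where x': "reduced x'" "reduced (s # x')" "x \<approx> s # x'" "tw x = tw [s] \<odot> tw x'"
      using descent_word[OF s word False] by blast
    have l': "x' \<in> lists S" using x'(1) by (rule reduced_lists)
    let ?b = "tinv (rev x')" and ?i = "tinv [s]"
    have bi: "?b \<in> carrier H" "?i \<in> carrier H" using s l' by simp_all
    have bx: "tinv (rev x) = ?i \<odot> ?b"
      using rev_descent[OF word x'(2,3)] tinv_append[of "rev x'" "[s]"] tw_append[of "rev x'" "[s]"] s l' by simp
    have "bar (tw [s] \<odot> tw x) = bar (tw x') \<boxplus> sc (bar_A var_q) (bar (tw x))"
      using gen_mult_descent[OF s l' x'(4)] l l' by (simp add: bar_add bar_sc)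
    also have "\<dots> = ?b \<boxplus> sc (- var_q) (?i \<odot> ?b)"
      using bar_reduced[OF x'(1)] bar_reduced[OF word] bx by (simp add: bar_A_var_q)
    also have "\<dots> = (?i \<odot> ?i) \<odot> ?b"
      using bi by (simp add: tinv_gen_square[OF s] H.l_distr sc_mult_left)
    also have "\<dots> = ?i \<odot> bar (tw x)"
      using bar_reduced[OF word] bx bi by (simp add: H.m_assoc)
    finally show ?thesis .
  qed
  then show ?case using s l by (simp add: sc_mult_right bar_sc)
next
  case (add h h')
  then show ?case using s by (simp add: H.r_distr bar_add)
qed

lemma bar_tw_mult:
  assumes "x \<in> lists S" "h \<in> carrier H"
  shows "bar (tw x \<odot> h) = tinv (rev x) \<odot> bar h"
  using assms(1)
proof (induction x)
  case Nil
  then show ?case using assms(2) by (simp add: tw_Nil)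
next
  case (Cons s x)
  then have l: "s \<in> S" "x \<in> lists S" by auto
  have "bar (tw (s # x) \<odot> h) = bar (tw [s] \<odot> (tw x \<odot> h))"
    using tw_Cons[OF l] l assms(2) by (simp add: H.m_assoc)
  also have "\<dots> = tinv [s] \<odot> (tinv (rev x) \<odot> bar h)"
    using bar_gen_mult[OF l(1), of "tw x \<odot> h"] Cons.IH l assms(2) by simp
  also have "\<dots> = tinv (rev (s # x)) \<odot> bar h"
    using l assms(2) tinv_append[of "rev x" "[s]"] by (simp add: H.m_assoc)
  finally show ?case .
qed

lemma bar_one: "bar \<one>\<^bsub>H\<^esub> = \<one>\<^bsub>H\<^esub>"
  using bar_reduced[OF reduced_Nil] by (simp add: tw_Nil)

lemma bar_tw: "x \<in> lists S \<Longrightarrow> bar (tw x) = tinv (rev x)"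
  using bar_tw_mult[of x "\<one>\<^bsub>H\<^esub>"] by (simp add: bar_one)

lemma bar_mult:
  assumes "h \<in> carrier H" "h' \<in> carrier H"
  shows "bar (h \<odot> h') = bar h \<odot> bar h'"
  using assms(1)
proof (induction h rule: H_induct)
  case (word x c)
  then show ?case
    using assms(2) bar_tw_mult[OF word assms(2)] bar_tw[OF word] by (simp add: sc_mult_left bar_sc)
next
  case (add h k)
  then show ?case using assms(2) by (simp add: H.l_distr bar_add)
qed

lemma bar_tinv:
  assumes x: "x \<in> lists S"
  shows "bar (tinv x) = tw (rev x)"
proof -
  have "tinv (rev x) \<odot> bar (tinv x) = \<one>\<^bsub>H\<^esub>"
    using bar_tw_mult[OF x, of "tinv x"] x by (simp add: tinv_right bar_one)
  then have "tw (rev x) \<odot> (tinv (rev x) \<odot> bar (tinv x)) = tw (rev x)" using x by simp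
  then show ?thesis using x by (simp add: tinv_right')
qed

lemma bar_bar: "h \<in> carrier H \<Longrightarrow> bar (bar h) = h"
proof (induction h rule: H_induct)
  case (word x c)
  then show ?case by (simp add: bar_sc bar_tw bar_tinv bar_A_bar_A)
qed (simp add: bar_add)

lemma anti_gen_mult:
  assumes s: "s \<in> S" and h: "h \<in> carrier H"
  shows "anti (tw [s] \<odot> h) = anti h \<odot> tw [s]"
  using h
proof (induction h rule: H_reduced_induct)
  case (word x c)
  have l: "x \<in> lists S" using word by (rule reduced_lists)
  have "anti (tw [s] \<odot> tw x) = anti (tw x) \<odot> tw [s]"
  proof (cases "reduced (s # x)")
    case True
    then show ?thesis
      using anti_reduced[OF True] anti_reduced[OF word] tw_Cons[OF s l] tw_append[of "rev x" "[s]"] s l by simp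
  next
    case False
    obtain x' where x': "reduced x'" "reduced (s # x')" "x \<approx> s # x'" "tw x = tw [s] \<odot> tw x'"
      using descent_word[OF s word False] by blast
    have l': "x' \<in> lists S" using x'(1) by (rule reduced_lists)
    have t: "tw (rev x') \<in> carrier H" "tw [s] \<in> carrier H" using s l' by simp_all
    have "anti (tw [s] \<odot> tw x) = tw (rev x') \<boxplus> sc var_q (tw (rev x') \<odot> tw [s])"
      using gen_mult_descent[OF s l' x'(4)] l l' anti_reduced[OF x'(1)] anti_reduced[OF word]
        rev_descent[OF word x'(2,3)] by (simp add: anti_add anti_sc)
    also have "\<dots> = tw (rev x') \<odot> (tw [s] \<odot> tw [s])"
      using t by (simp add: tw_square[OF s] H.r_distr sc_mult_right)
    also have "\<dots> = anti (tw x) \<odot> tw [s]"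
      using anti_reduced[OF word] rev_descent[OF word x'(2,3)] t by (simp add: H.m_assoc)
    finally show ?thesis .
  qed
  then show ?case using s l by (simp add: sc_mult_right sc_mult_left anti_sc)
next
  case (add h h')
  then show ?case using s by (simp add: H.r_distr H.l_distr anti_add)
qed

definition theta :: "('s list \<Rightarrow>\<^sub>0 qv) set \<Rightarrow> ('s list \<Rightarrow>\<^sub>0 qv) set" where
  "theta h = anti (bar h)"

lemma theta_closed [simp]: "h \<in> carrier H \<Longrightarrow> theta h \<in> carrier H"
  and theta_add: "h \<in> carrier H \<Longrightarrow> h' \<in> carrier H \<Longrightarrow> theta (h \<boxplus> h') = theta h \<boxplus> theta h'"
  and theta_sc: "h \<in> carrier H \<Longrightarrow> theta (sc c h) = sc (bar_A c) (theta h)"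
  by (simp_all add: theta_def bar_add anti_add bar_sc anti_sc)

lemma theta_one: "theta \<one>\<^bsub>H\<^esub> = \<one>\<^bsub>H\<^esub>"
  using anti_reduced[OF reduced_Nil] by (simp add: theta_def bar_one tw_Nil)

text \<open>This carries a factor t_x of the first argument of the pairing over to a factor t_x^-1
  acting on the second.\<close>

lemma theta_tw_mult:
  assumes "x \<in> lists S" "h \<in> carrier H"
  shows "theta (tw x \<odot> h) = theta h \<odot> tinv x"
proof -
  have gen: "theta (tw [s] \<odot> h) = theta h \<odot> tinv [s]" if s: "s \<in> S" and h: "h \<in> carrier H" for s h
  proof -
    have "theta (tw [s] \<odot> h) = anti ((tw [s] \<boxplus> sc (- var_q) \<one>\<^bsub>H\<^esub>) \<odot> bar h)"
      using bar_gen_mult[OF s h] tw_gen_inverse(2)[OF s] by (simp add: theta_def)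
    also have "\<dots> = theta h \<odot> (tw [s] \<boxplus> sc (- var_q) \<one>\<^bsub>H\<^esub>)"
      using s h by (simp add: H.l_distr H.r_distr sc_mult_one anti_add anti_sc anti_gen_mult theta_def)
    finally show ?thesis using tw_gen_inverse(2)[OF s] by simp
  qed
  show ?thesis
    using assms(1)
  proof (induction x)
    case Nil
    then show ?case using assms(2) by (simp add: tw_Nil)
  next
    case (Cons s x)
    then have l: "s \<in> S" "x \<in> lists S" by auto
    have "theta (tw (s # x) \<odot> h) = theta (tw [s] \<odot> (tw x \<odot> h))"
      using tw_Cons[OF l] l assms(2) by (simp add: H.m_assoc)
    also have "\<dots> = (theta h \<odot> tinv x) \<odot> tinv [s]"
      using gen[OF l(1), of "tw x \<odot> h"] Cons.IH l assms(2) by simp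
    also have "\<dots> = theta h \<odot> tinv (s # x)"
      using l assms(2) tinv_append[of "[s]" x] by (simp add: H.m_assoc)
    finally show ?case .
  qed
qed

subsection \<open>The trace\<close>

text \<open>The coefficient of 1 in the basis t_w, in contrast to \<open>tau\<close>, which refers
  to the inverses.\<close>

definition tau0 :: "('s list \<Rightarrow>\<^sub>0 qv) set \<Rightarrow> qv" where
  "tau0 = phi (delta [])"

abbreviation tau where "tau \<equiv> hecke_tau S m"

lemma tau0_add: "h \<in> carrier H \<Longrightarrow> h' \<in> carrier H \<Longrightarrow> tau0 (h \<boxplus> h') = tau0 h + tau0 h'"
  and tau0_sc: "h \<in> carrier H \<Longrightarrow> tau0 (sc c h) = c * tau0 h"
  by (simp_all add: tau0_def phi_add phi_sc class_fun_delta)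

text \<open>\<open>bar\<close> turns t_w^-1 into t at the inverse of w, so the coordinate at u
  appears at the inverse of u.\<close>

lemma bar_lincomb_inverse:
  assumes "keys c \<subseteq> carrier W" "u \<in> carrier W"
  shows "phi (delta (rep (inv\<^bsub>W\<^esub> u))) (bar (lincomb (\<lambda>c. c) (\<lambda>w. inv\<^bsub>H\<^esub> (T w)) c)) = bar_A (lookup c u)"
proof -
  interpret W: group W by (rule group_W)
  have ne: "carrier W \<noteq> {}" using assms by blast
  have T: "(\<lambda>w. inv\<^bsub>H\<^esub> (T w)) \<in> carrier W \<rightarrow> carrier H"
  proof
    fix w assume "w \<in> carrier W"
    then show "inv\<^bsub>H\<^esub> (T w) \<in> carrier H" using T_inv_closed(2)[of "inv\<^bsub>W\<^esub> w"] by simp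
  qed
  let ?u = "inv\<^bsub>W\<^esub> u"
  have u: "?u \<in> carrier W" using assms(2) by simp
  from assms(1) ne show ?thesis
  proof (induction c rule: poly_mapping_carrier_induct)
    case (single w a)
    have rw: "reduced (rep w)" "cls (rep w) = w" using carrier_W_rep[OF single] by auto
    have l: "rep w \<in> lists S" using rw(1) by (rule reduced_lists)
    have "bar (lincomb (\<lambda>c. c) (\<lambda>w. inv\<^bsub>H\<^esub> (T w)) (single w a)) = bar (sc a (tinv (rep w)))"
      using lincomb_single[OF id_field_embedding T single, of a] hecke_T_cls[OF rw(1)] rw(2) by simp
    also have "\<dots> = sc (bar_A a) (tw (rev (rep w)))"
      using l by (simp add: bar_sc bar_tinv)
    finally have *: "bar (lincomb (\<lambda>c. c) (\<lambda>w. inv\<^bsub>H\<^esub> (T w)) (single w a)) = sc (bar_A a) (tw (rev (rep w)))" .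
    have "rev (rep w) \<approx> rep ?u \<longleftrightarrow> w = u"
    proof -
      have "rev (rep w) \<approx> rep ?u \<longleftrightarrow> inv\<^bsub>W\<^esub> w = ?u"
        using cls_eq_iff[of "rev (rep w)" "rep ?u"] inv_W[OF l] rw(2) carrier_W_rep(2)[OF u] l by simp
      also have "\<dots> \<longleftrightarrow> w = u" using W.inv_inj single assms(2) by (auto dest: inj_onD)
      finally show ?thesis .
    qed
    moreover have "phi (delta (rep ?u)) (sc (bar_A a) (tw (rev (rep w)))) = bar_A a * delta (rep ?u) (rev (rep w))"
      by (rule phi_reduced[OF class_fun_delta]) (simp add: reduced_rev rw(1))
    ultimately show ?case
      unfolding * by (simp add: delta_def[of _ "rev (rep w)"] lookup_single when_def bar_A.zero)
  next
    case (add f g)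
    then show ?case
      by (simp add: lincomb_add[OF id_field_embedding T] phi_add class_fun_delta lookup_add
          lincomb_closed[OF id_field_embedding T] bar_add bar_A.add)
  qed
qed

text \<open>Proved first for \<open>bar h\<close>, to which the expansion of h in the t_w can be
  transported; \<open>bar_bar\<close> then reaches every element.\<close>

lemma ex_coords_inverse:
  assumes "h \<in> carrier H"
  shows "\<exists>c. keys c \<subseteq> carrier W \<and> h = lincomb (\<lambda>c. c) (\<lambda>w. inv\<^bsub>H\<^esub> (T w)) c"
proof -
  interpret W: group W by (rule group_W)
  have T: "(\<lambda>w. inv\<^bsub>H\<^esub> (T w)) \<in> carrier W \<rightarrow> carrier H"
  proof
    fix w assume "w \<in> carrier W"
    then show "inv\<^bsub>H\<^esub> (T w) \<in> carrier H" using T_inv_closed(2)[of "inv\<^bsub>W\<^esub> w"] by simp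
  qed
  have "\<exists>c. keys c \<subseteq> carrier W \<and> bar h = lincomb (\<lambda>c. c) (\<lambda>w. inv\<^bsub>H\<^esub> (T w)) c" if "h \<in> carrier H" for h
    using that
  proof (induction h rule: H_reduced_induct)
    case (word x a)
    have red: "reduced (rev x)" using word reduced_rev by blast
    have w: "cls (rev x) \<in> carrier W" using reduced_lists[OF red] by (simp add: carrier_W)
    have "bar (sc a (tw x)) = sc (bar_A a) (tinv (rev x))"
      using word by (simp add: bar_sc bar_tw reduced_lists)
    then show ?case
      using lincomb_single[OF id_field_embedding T w, of "bar_A a"] hecke_T_cls[OF red] w
      by (intro exI[of _ "single (cls (rev x)) (bar_A a)"]) simp
  next
    case (add h h')
    then obtain c c' where c: "keys c \<subseteq> carrier W" "bar h = lincomb (\<lambda>c. c) (\<lambda>w. inv\<^bsub>H\<^esub> (T w)) c"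
      "keys c' \<subseteq> carrier W" "bar h' = lincomb (\<lambda>c. c) (\<lambda>w. inv\<^bsub>H\<^esub> (T w)) c'" by blast
    then show ?case
      using lincomb_add[OF id_field_embedding T c(1,3)] Poly_Mapping.keys_add[of c c'] add(1,2)
      by (intro exI[of _ "c + c'"]) (auto simp: bar_add)
  qed
  from this[of "bar h"] show ?thesis using assms by (simp add: bar_bar)
qed

text \<open>\<open>bar_lincomb_inverse\<close> computes the coordinates in the inverse basis and
  thereby makes them unique; at the identity it gives the formula.\<close>

lemma tau_eq:
  assumes "h \<in> carrier H"
  shows "tau h = bar_A (tau0 (bar h))"
proof -
  interpret W: group W by (rule group_W)
  obtain c where c: "keys c \<subseteq> carrier W" "h = lincomb (\<lambda>c. c) (\<lambda>w. inv\<^bsub>H\<^esub> (T w)) c"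
    using ex_coords_inverse[OF assms] by blast
  have val: "lookup c' u = bar_A (phi (delta (rep (inv\<^bsub>W\<^esub> u))) (bar h))"
    if "keys c' \<subseteq> carrier W" "h = lincomb (\<lambda>c. c) (\<lambda>w. inv\<^bsub>H\<^esub> (T w)) c'" "u \<in> carrier W" for c' u
    using bar_lincomb_inverse[OF that(1,3)] that(2) by (simp add: bar_A_bar_A)
  have "hecke_coords S m (\<lambda>w. inv\<^bsub>H\<^esub> (T w)) h = c"
    unfolding hecke_coords_eq
  proof (rule the_equality)
    fix c' assume c': "keys c' \<subseteq> carrier W \<and> h = lincomb (\<lambda>c. c) (\<lambda>w. inv\<^bsub>H\<^esub> (T w)) c'"
    show "c' = c"
    proof (rule poly_mapping_eqI)
      fix w
      show "lookup c' w = lookup c w"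
      proof (cases "w \<in> carrier W")
        case True
        then show ?thesis using val[OF c True] val[of c' w] c' by simp
      next
        case False
        then have "w \<notin> keys c" "w \<notin> keys c'" using c(1) c' by blast+
        then show ?thesis by (simp add: in_keys_iff)
      qed
    qed
  qed (use c in simp)
  then have "tau h = bar_A (phi (delta (rep \<one>\<^bsub>W\<^esub>)) (bar h))"
    using val[OF c W.one_closed] by (simp add: hecke_tau_def)
  moreover have "delta (rep \<one>\<^bsub>W\<^esub>) = delta []"
  proof -
    have "[] \<approx> rep \<one>\<^bsub>W\<^esub>" unfolding one_W by (rule rep_cls) simp
    then have "x \<approx> rep \<one>\<^bsub>W\<^esub> \<longleftrightarrow> x \<approx> []" for x by (blast intro: cox_eq.sym cox_eq.trans)
    then show ?thesis by (simp add: delta_def fun_eq_iff)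
  qed
  ultimately show ?thesis by (simp add: tau0_def)
qed

lemma tau_add: "h \<in> carrier H \<Longrightarrow> h' \<in> carrier H \<Longrightarrow> tau (h \<boxplus> h') = tau h + tau h'"
  by (simp add: tau_eq bar_add tau0_add bar_A.add)

lemma tau_sc: "h \<in> carrier H \<Longrightarrow> tau (sc c h) = c * tau h"
  by (simp add: tau_eq bar_sc tau0_sc bar_A.mult bar_A_bar_A)

lemma phi_tw_mult:
  assumes x: "x \<in> lists S" and h: "h \<in> carrier H" and g: "class_fun g"
  shows "phi g (tw x \<odot> h) = phi (fold left_op x g) h"
  using h
proof (induction h rule: H_induct)
  case (word y c)
  then show ?case
    using x g class_fun_fold_left[OF x g] by (simp add: sc_mult_right phi_sc_tw flip: tw_append)
next
  case (add h h')
  then show ?case using x g class_fun_fold_left[OF x g] by (simp add: H.r_distr phi_add)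
qed

lemma phi_mult_gen:
  assumes s: "s \<in> S" and h: "h \<in> carrier H" and g: "class_fun g"
  shows "phi g (h \<odot> tw [s]) = phi (right_op s g) h"
  using h
proof (induction h rule: H_induct)
  case (word x c)
  have "left_op s (fold left_op x g) [] = right_op s (fold left_op x g) []"
    by (simp add: left_op_def right_op_def)
  also have "\<dots> = fold left_op x (right_op s g) []"
    using fold_left_right_op_commute[OF word, of "[s]" g] s g by simp
  finally have "phi g (tw (x @ [s])) = phi (right_op s g) (tw x)"
    using word s g class_fun_right_op[OF s g] by (simp add: phi_tw)
  then show ?case
    using word s g class_fun_right_op[OF s g] by (simp add: sc_mult_left phi_sc flip: tw_append)
next
  case (add h h')
  then show ?case using s g class_fun_right_op[OF s g] by (simp add: H.l_distr phi_add)
qed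

text \<open>s x = 1 exactly if x s = 1, and the correction terms vanish because the identity has no
  descents.\<close>

lemma tau0_mult_gen:
  assumes s: "s \<in> S" and h: "h \<in> carrier H"
  shows "tau0 (tw [s] \<odot> h) = tau0 (h \<odot> tw [s])"
proof -
  have "left_op s (delta []) x = right_op s (delta []) x" for x
  proof (cases "x \<in> lists S")
    case True
    have "s # x \<approx> [] \<longleftrightarrow> x @ [s] \<approx> []"
    proof
      assume "s # x \<approx> []"
      then have "[] @ [s] \<approx> x" using eq_Cons_swap cox_eq.sym by fastforce
      then show "x @ [s] \<approx> []" using eq_snoc_swap cox_eq.sym by blast
    next
      assume "x @ [s] \<approx> []"
      then have "[s] \<approx> x" using eq_snoc_swap[of x s "[]"] by (simp add: cox_eq.sym)
      then show "s # x \<approx> []" using eq_Cons_swap cox_eq.sym by blast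
    qed
    moreover have "delta [] x = 0" if "len y < len x" for y
      using that len_cong[of x "[]"] by (auto simp: delta_def)
    ultimately show ?thesis using True by (simp add: left_op_def right_op_def) (simp add: delta_def)
  qed (simp add: left_op_def right_op_def)
  then have "left_op s (delta []) = right_op s (delta [])" by (simp add: fun_eq_iff)
  then show ?thesis
    using phi_tw_mult[of "[s]" h "delta []"] phi_mult_gen[OF s h, of "delta []"] s h
    by (simp add: tau0_def class_fun_delta)
qed

text \<open>The target ring and the scalar map \<rho> are left open so that the argument serves both
  \<open>tau0\<close> and \<open>prod_trace\<close>.\<close>

lemma trace_from_generators:
  fixes f :: "('s list \<Rightarrow>\<^sub>0 qv) set \<Rightarrow> 'b::ring"
  assumes add: "\<And>h h'. h \<in> carrier H \<Longrightarrow> h' \<in> carrier H \<Longrightarrow> f (h \<boxplus> h') = f h + f h'"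
    and sc: "\<And>c h. h \<in> carrier H \<Longrightarrow> f (sc c h) = \<rho> c * f h"
    and gen: "\<And>s h. s \<in> S \<Longrightarrow> h \<in> carrier H \<Longrightarrow> f (tw [s] \<odot> h) = f (h \<odot> tw [s])"
    and h: "h \<in> carrier H" and h': "h' \<in> carrier H"
  shows "f (h \<odot> h') = f (h' \<odot> h)"
  using h
proof (induction h rule: H_induct)
  case (word x c)
  have "f (tw x \<odot> k) = f (k \<odot> tw x)" if "x \<in> lists S" "k \<in> carrier H" for x k
    using that
  proof (induction x arbitrary: k)
    case Nil
    then show ?case by (simp add: tw_Nil)
  next
    case (Cons s x)
    then have l: "s \<in> S" "x \<in> lists S" by auto
    have "f (tw (s # x) \<odot> k) = f (tw x \<odot> (k \<odot> tw [s]))"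
      using gen[OF l(1), of "tw x \<odot> k"] tw_Cons[OF l] l Cons.prems by (simp add: H.m_assoc)
    also have "\<dots> = f (k \<odot> tw (s # x))"
      using Cons.IH[of "k \<odot> tw [s]"] tw_Cons[OF l] l Cons.prems by (simp add: H.m_assoc)
    finally show ?case .
  qed
  then show ?case using word h' by (simp add: sc_mult_left sc_mult_right sc)
next
  case (add h k)
  then show ?case using h' by (simp add: H.l_distr H.r_distr assms(1))
qed

lemma tau0_mult: "h \<in> carrier H \<Longrightarrow> h' \<in> carrier H \<Longrightarrow> tau0 (h \<odot> h') = tau0 (h' \<odot> h)"
  by (rule trace_from_generators[where \<rho> = "\<lambda>c. c"]) (simp_all add: tau0_add tau0_sc tau0_mult_gen)

lemma tau_mult: "h \<in> carrier H \<Longrightarrow> h' \<in> carrier H \<Longrightarrow> tau (h \<odot> h') = tau (h' \<odot> h)"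
  using tau0_mult[of "bar h" "bar h'"] by (simp add: tau_eq bar_mult)

text \<open>A correction term could only arise at the inverse of x if s were a left descent there,
  but x s is reduced.\<close>

lemma fold_left_op_delta:
  "reduced x \<Longrightarrow> y \<in> lists S \<Longrightarrow> fold left_op x (delta []) y = delta (rev x) y"
proof (induction x arbitrary: y rule: rev_induct)
  case (snoc s x)
  have red: "reduced x" using snoc.prems(1) by (rule reduced_append)
  have s: "s \<in> S" using reduced_lists[OF snoc.prems(1)] by simp
  have "delta (rev x) y = 0" if lt: "len (s # y) < len y"
  proof (rule ccontr)
    assume "\<not> ?thesis"
    then have y: "y \<approx> rev x" by (simp add: delta_def split: if_splits)
    have "reduced (s # rev x)" using snoc.prems(1) reduced_rev[of "x @ [s]"] by simp
    moreover have "reduced (rev x)" using red reduced_rev by blast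
    ultimately have "len (s # rev x) > len (rev x)" by (simp add: reduced_def)
    then show False using lt len_cong[OF y] len_cong[OF eq_Cons[OF y s]] by simp
  qed
  moreover have "delta (rev x) (s # y) = delta (s # rev x) y"
  proof -
    have "s # y \<approx> rev x \<longleftrightarrow> y \<approx> s # rev x"
    proof
      assume "y \<approx> s # rev x"
      then show "s # y \<approx> rev x" using eq_Cons_swap[of s "rev x" y] cox_eq.sym by blast
    qed (rule eq_Cons_swap)
    then show ?thesis by (simp add: delta_def)
  qed
  ultimately show ?case using snoc.IH[OF red] snoc.prems s by (simp add: left_op_def)
qed simp

lemma tau0_tw_tw:
  assumes "reduced x" "reduced y"
  shows "tau0 (tw x \<odot> tw y) = (if y \<approx> rev x then 1 else 0)"
proof -
  have l: "x \<in> lists S" "y \<in> lists S" using assms reduced_lists by auto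
  have g: "class_fun (fold left_op x (delta []))" using class_fun_fold_left[OF l(1) class_fun_delta] .
  have "tau0 (tw x \<odot> tw y) = phi (fold left_op x (delta [])) (tw y)"
    using phi_tw_mult[OF l(1) _ class_fun_delta] l by (simp add: tau0_def)
  also have "\<dots> = fold left_op x (delta []) y"
    using phi_reduced[OF g assms(2), of 1] l by simp
  finally show ?thesis using fold_left_op_delta[OF assms(1) l(2)] by (simp add: delta_def)
qed

lemma tau0_tw: "reduced x \<Longrightarrow> tau0 (tw x) = (if x = [] then 1 else 0)"
  using tau0_tw_tw[OF reduced_Nil, of x] reduced_eq_Nil[of x] by (simp add: tw_Nil reduced_lists)

end

section \<open>Parabolic subalgebras\<close>

locale parabolic = coxeter_words +
  fixes S' :: "'a set"
  assumes subset: "S' \<subseteq> S"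
begin

sublocale P: coxeter_words S' m
  using subset by (rule coxeter_words_subset)

abbreviation inc where "inc \<equiv> hecke_incl S m"

lemma lists_subset: "x \<in> lists S' \<Longrightarrow> x \<in> lists S"
  using lists_mono[OF subset] by blast

lemma carrier_FA_subset: "f \<in> carrier P.FA \<Longrightarrow> f \<in> carrier FA"
  using lists_mono[OF subset] by (auto simp: carrier_monoid_algebra)

lemma mult_FA: "f \<otimes>\<^bsub>P.FA\<^esub> g = f \<otimes>\<^bsub>FA\<^esub> g"
  by (simp add: monoid_algebra_def free_monoid_def)

text \<open>The contraction of the large ideal to the small free algebra is an ideal that contains
  the small relations.\<close>

lemma hecke_ideal_subset: "P.I \<subseteq> I"
proof -
  have "ideal (I \<inter> carrier P.FA) P.FA"
  proof (rule monoid.monoid_algebra_idealI[OF monoid_free_monoid])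
    show "0 \<in> I \<inter> carrier P.FA"
      using I.zero_closed P.FA.zero_closed by simp
    fix f g assume "f \<in> I \<inter> carrier P.FA" "g \<in> I \<inter> carrier P.FA"
    then show "f + g \<in> I \<inter> carrier P.FA"
      using I.a_closed[of f g] P.FA.a_closed[of f g] by simp
  next
    fix x a f assume x: "x \<in> carrier (free_monoid S')" and f: "f \<in> I \<inter> carrier P.FA"
    then have xc: "single x a \<in> carrier P.FA" by (simp add: P.single_FA)
    show "single x a \<otimes>\<^bsub>P.FA\<^esub> f \<in> I \<inter> carrier P.FA"
      using f I.I_l_closed[of f "single x a"] P.FA.m_closed[OF xc, of f] carrier_FA_subset[OF xc]
      by (simp add: mult_FA)
    show "f \<otimes>\<^bsub>P.FA\<^esub> single x a \<in> I \<inter> carrier P.FA"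
      using f I.I_r_closed[of f "single x a"] P.FA.m_closed[OF _ xc, of f] carrier_FA_subset[OF xc]
      by (simp add: mult_FA)
  qed simp
  moreover have "hecke_relations S' m \<subseteq> I \<inter> carrier P.FA"
  proof
    fix f assume f: "f \<in> hecke_relations S' m"
    then have "f \<in> hecke_relations S m"
      using subset unfolding hecke_relations_def P.quadratic_relation_expand quadratic_relation_expand by blast
    then have "f \<in> I" using FA.genideal_self[OF hecke_relations_carrier] by (auto simp: hecke_ideal_def)
    then show "f \<in> I \<inter> carrier P.FA" using f P.hecke_relations_carrier by blast
  qed
  ultimately have "P.I \<subseteq> I \<inter> carrier P.FA"
    unfolding hecke_ideal_def[of S'] by (rule P.FA.genideal_minimal)
  then show ?thesis by blast
qed

text \<open>\<open>hecke_incl\<close> is a union over all representatives; the cosets in it coincide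
  because the small ideal lies in the large one.\<close>

lemma inc_proj:
  assumes f: "f \<in> carrier P.FA"
  shows "inc (P.proj f) = proj f"
proof -
  have eq: "proj f' = proj f" if "f' \<in> P.proj f" for f'
    using that hecke_ideal_subset carrier_FA_subset[OF f] by (intro proj_eqI) (auto simp: P.mem_proj)
  have mem: "f \<in> P.proj f" using P.I.zero_closed by (simp add: P.mem_proj)
  have "inc (P.proj f) = (\<Union>f'\<in>P.proj f. proj f')" by (simp add: hecke_incl_def proj_def)
  also have "\<dots> = (\<Union>f'\<in>P.proj f. proj f)" by (rule SUP_cong[OF HOL.refl eq])
  also have "\<dots> = proj f" using mem by blast
  finally show ?thesis .
qed

lemma inc_closed [simp]: "h \<in> carrier P.H \<Longrightarrow> inc h \<in> carrier H"
  by (auto simp: P.carrier_H inc_proj proj_closed carrier_FA_subset)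

lemma inc_mult: "h \<in> carrier P.H \<Longrightarrow> h' \<in> carrier P.H \<Longrightarrow> inc (h \<otimes>\<^bsub>P.H\<^esub> h') = inc h \<odot> inc h'"
proof -
  assume "h \<in> carrier P.H" "h' \<in> carrier P.H"
  then obtain f f' where f: "h = P.proj f" "f \<in> carrier P.FA" "h' = P.proj f'" "f' \<in> carrier P.FA"
    by (auto simp: P.carrier_H)
  then have "inc (h \<otimes>\<^bsub>P.H\<^esub> h') = inc (P.proj (f \<otimes>\<^bsub>P.FA\<^esub> f'))" by (simp add: P.proj_mult)
  also have "\<dots> = proj (f \<otimes>\<^bsub>FA\<^esub> f')" using f P.FA.m_closed[of f f'] by (simp add: inc_proj mult_FA[symmetric])
  also have "\<dots> = inc h \<odot> inc h'" using f by (simp add: inc_proj proj_mult carrier_FA_subset)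
  finally show ?thesis .
qed

lemma inc_add: "h \<in> carrier P.H \<Longrightarrow> h' \<in> carrier P.H \<Longrightarrow> inc (h \<oplus>\<^bsub>P.H\<^esub> h') = inc h \<boxplus> inc h'"
proof -
  assume "h \<in> carrier P.H" "h' \<in> carrier P.H"
  then obtain f f' where f: "h = P.proj f" "f \<in> carrier P.FA" "h' = P.proj f'" "f' \<in> carrier P.FA"
    by (auto simp: P.carrier_H)
  then have "inc (h \<oplus>\<^bsub>P.H\<^esub> h') = inc (P.proj (f + f'))" by (simp add: P.proj_add)
  also have "\<dots> = proj (f + f')" using f P.FA.a_closed[of f f'] by (simp add: inc_proj)
  also have "\<dots> = inc h \<boxplus> inc h'" using f by (simp add: inc_proj proj_add carrier_FA_subset)
  finally show ?thesis .
qed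

lemma inc_tw: "x \<in> lists S' \<Longrightarrow> inc (P.tw x) = tw x"
  by (simp add: P.tw_def tw_def inc_proj P.single_FA)

lemma inc_one: "inc \<one>\<^bsub>P.H\<^esub> = \<one>\<^bsub>H\<^esub>"
  using inc_tw[of "[]"] by (simp add: tw_Nil P.tw_Nil)

lemma inc_sc: "h \<in> carrier P.H \<Longrightarrow> inc (P.sc c h) = sc c (inc h)"
  by (simp add: P.sc_eq sc_eq inc_mult) (simp add: P.scalar_def scalar_def inc_proj P.single_FA)

lemma inc_tinv:
  assumes x: "x \<in> lists S'"
  shows "inc (P.tinv x) = tinv x"
proof (rule H.inv_unique')
  show "tw x \<odot> inc (P.tinv x) = \<one>\<^bsub>H\<^esub>" "inc (P.tinv x) \<odot> tw x = \<one>\<^bsub>H\<^esub>"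
    using x inc_mult[of "P.tw x" "P.tinv x"] inc_mult[of "P.tinv x" "P.tw x"]
    by (simp_all add: inc_tw P.tinv_right P.tinv_left inc_one)
qed (use x lists_subset in simp_all)

lemma inc_bar: "h \<in> carrier P.H \<Longrightarrow> inc (P.bar h) = bar (inc h)"
proof (induction h rule: P.H_induct)
  case (word x c)
  then show ?case
    by (simp add: P.bar_sc P.bar_tw inc_sc inc_tinv inc_tw bar_sc bar_tw lists_subset)
next
  case (add h h')
  then show ?case by (simp add: P.bar_add inc_add bar_add)
qed

lemma tau0_inc: "h \<in> carrier P.H \<Longrightarrow> tau0 (inc h) = P.tau0 h"
proof (induction h rule: P.H_reduced_induct)
  case (word x c)
  have "x \<in> lists S'" using word by (rule P.reduced_lists)
  then show ?case
    using parabolic_reduced[OF subset word] word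
    by (simp add: inc_sc inc_tw lists_subset tau0_sc P.tau0_sc tau0_tw P.tau0_tw)
next
  case (add h h')
  then show ?case by (simp add: inc_add tau0_add P.tau0_add)
qed

lemma tau_inc: "h \<in> carrier P.H \<Longrightarrow> tau (inc h) = P.tau h"
  by (simp add: tau_eq P.tau_eq tau0_inc flip: inc_bar)

text \<open>Bar turns t_s into t_s^-1 = t_s - q. The product t_x t_s has coefficient 0 at 1, since x
  has no letter s; what remains is -q, which bar turns into q.\<close>

lemma tau_inc_gen:
  assumes s: "s \<in> S" "s \<notin> S'" and h: "h \<in> carrier P.H"
  shows "tau (inc h \<odot> tw [s]) = var_q * P.tau h"
proof -
  have "tau0 (inc k \<odot> tinv [s]) = - var_q * P.tau0 k" if "k \<in> carrier P.H" for k
    using that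
  proof (induction k rule: P.H_reduced_induct)
    case (word x c)
    have red: "reduced x" using parabolic_reduced[OF subset word] .
    have l: "x \<in> lists S'" "x \<in> lists S" using word by (auto intro: P.reduced_lists lists_subset)
    have reds: "reduced [s]" using s reducedI[of "[s]" "[s]"] len_parity[of "[s]"]
      by (simp add: cox_eq.refl) (metis even_Suc even_zero gr0I Suc_leI)
    have "\<not> [s] \<approx> rev x"
    proof
      assume e: "[s] \<approx> rev x"
      have "reduced (rev x)" using red reduced_rev by blast
      then have "braid_eq m [s] (rev x)" using matsumoto reds e by blast
      then have "set (rev x) = {s}" using braid_eq_set by fastforce
      then show False using l(1) s(2) by (auto simp: in_lists_conv_set)
    qed
    then have "tau0 (tw x \<odot> tw [s]) = 0" using tau0_tw_tw[OF red reds] by simp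
    then have "tau0 (tw x \<odot> tinv [s]) = - var_q * tau0 (tw x)"
      using l s by (simp add: tw_gen_inverse(2) H.r_distr sc_mult_one tau0_add tau0_sc)
    then show ?case
      using l s red word by (simp add: inc_sc inc_tw sc_mult_left tau0_sc P.tau0_sc tau0_tw P.tau0_tw)
  next
    case (add h h')
    then show ?case using s by (simp add: inc_add H.l_distr tau0_add P.tau0_add algebra_simps)
  qed
  from this[of "P.bar h"] show ?thesis
    using s h by (simp add: tau_eq P.tau_eq bar_mult bar_tw inc_bar bar_A.mult bar_A.minus bar_A_var_q)
qed

section \<open>Values of the trace attached to a minimal coset representative\<close>

context
  fixes d :: "'a list"
  assumes d: "d \<in> lists S" and minimal: "\<And>x. x \<in> lists S' \<Longrightarrow> length d \<le> len (x @ d)"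
begin

lemma reduced_coset: "P.reduced x \<Longrightarrow> reduced (x @ d)"
  by (rule minimal_coset_reduced[OF subset d minimal])

lemma reduced_rev_coset:
  assumes "P.reduced x"
  shows "reduced (rev d @ x)"
  using reduced_coset[of "rev x"] assms P.reduced_rev[of x] reduced_rev[of "rev d @ x"] by simp

text \<open>As \<open>d @ rev d\<close> is a palindrome, bar simply removes the inverse. The product
  of t for \<open>rev d\<close> and t_x is t of the reduced word \<open>rev d @ x\<close>, which is
  inverse to d only if x = 1.\<close>

lemma tau_double_coset_inc:
  assumes h: "h \<in> carrier P.H"
  shows "tau (tinv (d @ rev d) \<odot> inc h) = P.tau h"
proof -
  have "tau0 (tw (d @ rev d) \<odot> inc k) = P.tau0 k" if "k \<in> carrier P.H" for k
    using that
  proof (induction k rule: P.H_reduced_induct)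
    case (word x c)
    have l: "x \<in> lists S'" "x \<in> lists S" using word by (auto intro: P.reduced_lists lists_subset)
    have red: "reduced x" using parabolic_reduced[OF subset word] .
    have "reduced d" using reduced_coset[of "[]"] by simp
    then have "tau0 (tw d \<odot> tw (rev d @ x)) = (if rev d @ x \<approx> rev d then 1 else 0)"
      using tau0_tw_tw reduced_rev_coset[OF word] by blast
    moreover have "rev d @ x \<approx> rev d \<longleftrightarrow> x = []"
    proof
      assume "rev d @ x \<approx> rev d"
      then have "x \<approx> []" using eq_append_cancel[of "rev d" x "[]"] by simp
      then show "x = []" using reduced_eq_Nil[OF red] by simp
    qed (use d in \<open>simp add: cox_eq.refl\<close>)
    ultimately have "tau0 (tw (d @ rev d) \<odot> tw x) = tau0 (tw x)"
      using l d red by (simp add: tw_append H.m_assoc tau0_tw)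
    then show ?case
      using l d red word by (simp add: inc_sc inc_tw sc_mult_right tau0_sc P.tau0_sc tau0_tw P.tau0_tw)
  next
    case (add h h')
    then show ?case using d by (simp add: inc_add H.r_distr tau0_add P.tau0_add)
  qed
  from this[of "P.bar h"] show ?thesis
    using d h by (simp add: tau_eq P.tau_eq bar_mult bar_tinv inc_bar)
qed

text \<open>After bar, cyclicity lets t_s^-1 cancel the first letter of d. The remaining d' is too
  short to be inverse to \<open>rev d @ x\<close>, whose length is at least that of d.\<close>

lemma tau_double_coset_inc_gen:
  assumes ds: "d = s # d'" and s: "s \<in> S" and h: "h \<in> carrier P.H"
  shows "tau (tinv (d @ rev d) \<odot> (inc h \<odot> tw [s])) = 0"
proof -
  have d': "d' \<in> lists S" using d ds by simp
  have "tau0 (tw (d @ rev d) \<odot> (inc k \<odot> tinv [s])) = 0" if "k \<in> carrier P.H" for k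
    using that
  proof (induction k rule: P.H_reduced_induct)
    case (word x c)
    have l: "x \<in> lists S'" "x \<in> lists S" using word by (auto intro: P.reduced_lists lists_subset)
    have "reduced d" using reduced_coset[of "[]"] by simp
    then have red': "reduced d'" using ds reduced_Cons by simp
    have "\<not> rev d @ x \<approx> rev d'"
    proof
      assume "rev d @ x \<approx> rev d'"
      then have "len (rev (rev d @ x)) \<le> length d'" using len_le[OF eq_rev, of "rev d @ x" "rev d'"] by simp
      moreover have "length d \<le> len (rev x @ d)" using l by (intro minimal) simp
      ultimately show False using ds by simp
    qed
    then have 0: "tau0 (tw d' \<odot> tw (rev d @ x)) = 0"
      using tau0_tw_tw[OF red' reduced_rev_coset[OF word]] by simp
    have "tau0 (tw (d @ rev d) \<odot> (tw x \<odot> tinv [s])) = tau0 (tinv [s] \<odot> (tw (d @ rev d) \<odot> tw x))"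
      using tau0_mult[of "tw (d @ rev d) \<odot> tw x" "tinv [s]"] l s d by (simp add: H.m_assoc)
    also have "tinv [s] \<odot> (tw (d @ rev d) \<odot> tw x) = tw d' \<odot> tw (rev d @ x)"
    proof -
      have "tw (d @ rev d) \<odot> tw x = tw [s] \<odot> (tw d' \<odot> tw (rev d @ x))"
        using l s d' d tw_append[of "[s]" "d' @ rev d @ x"] tw_append[of d' "rev d @ x"]
          tw_append[of "d @ rev d" x] ds by simp
      then show ?thesis using l s d d' by (simp add: tinv_left')
    qed
    finally show ?case using 0 l s d by (simp add: inc_sc inc_tw sc_mult_right sc_mult_left tau0_sc)
  next
    case (add h h')
    then show ?case using d s by (simp add: inc_add H.r_distr H.l_distr tau0_add)
  qed
  from this[of "P.bar h"] show ?thesis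
    using d h s by (simp add: tau_eq bar_mult bar_tinv inc_bar bar_tw bar_A.zero)
qed

end

end

section \<open>Extension of scalars\<close>

context coxeter_words
begin

abbreviation MA :: "(('s list \<Rightarrow>\<^sub>0 qv) set \<Rightarrow>\<^sub>0 qva) ring" where "MA \<equiv> monoid_algebra H"
abbreviation TI where "TI \<equiv> tensor_ideal S m"
abbreviation HR where "HR \<equiv> hecke_R S m"

sublocale MA: ring MA by (rule H.ring_monoid_algebra)

lemma keys_carrier_MA: "f \<in> carrier MA \<longleftrightarrow> keys f \<subseteq> carrier H"
  by (simp add: carrier_monoid_algebra)

lemma tensor_relations_carrier: "tensor_relations S m \<subseteq> carrier MA"
proof -
  have d: "f - f' \<in> carrier MA" if "f \<in> carrier MA" "f' \<in> carrier MA" for f f' :: "('s list \<Rightarrow>\<^sub>0 qv) set \<Rightarrow>\<^sub>0 qva"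
    using that keys_diff[of f f'] by (auto simp: carrier_monoid_algebra)
  have s: "single w c \<in> carrier MA" if "w \<in> carrier H" for w and c :: qva
    using that by (simp add: single_carrier_monoid_algebra)
  show ?thesis
    unfolding tensor_relations_def by (auto intro!: d s)
qed

sublocale TI: ideal TI MA
  unfolding tensor_ideal_def by (rule MA.genideal_ideal[OF tensor_relations_carrier])

sublocale HR: ring HR
  unfolding hecke_R_def by (rule TI.quotient_is_ring)

definition semilinear :: "(qva \<Rightarrow> qva) \<Rightarrow> (('s list \<Rightarrow>\<^sub>0 qv) set \<Rightarrow> qva) \<Rightarrow> bool" where
  "semilinear \<beta> \<phi> \<longleftrightarrow> (\<forall>h\<in>carrier H. \<forall>h'\<in>carrier H. \<phi> (h \<boxplus> h') = \<phi> h + \<phi> h') \<and>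
     (\<forall>c. \<forall>h\<in>carrier H. \<phi> (sc c h) = \<beta> (A_to_R c) * \<phi> h)"

context
  fixes \<beta> :: "qva \<Rightarrow> qva"
  assumes \<beta>: "field_embedding \<beta>"
begin

lemma ext_add: "extend_semilinear \<beta> \<phi> (f + g) = extend_semilinear \<beta> \<phi> f + extend_semilinear \<beta> \<phi> g"
  by (rule extend_semilinear_add) (simp_all add: field_embedding.zero[OF \<beta>] field_embedding.add[OF \<beta>])

lemma ext_diff: "extend_semilinear \<beta> \<phi> (f - g) = extend_semilinear \<beta> \<phi> f - extend_semilinear \<beta> \<phi> g"
  using ext_add[of \<phi> "f - g" g] by simp

lemma ext_single: "extend_semilinear \<beta> \<phi> (single x a) = \<beta> a * \<phi> x"
  by (rule extend_semilinear_single) (rule field_embedding.zero[OF \<beta>])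

lemma ext_single_mult:
  assumes "f \<in> carrier MA"
  shows "extend_semilinear \<beta> \<phi> (single x a \<otimes>\<^bsub>MA\<^esub> f) = \<beta> a * extend_semilinear \<beta> (\<lambda>h. \<phi> (x \<odot> h)) f"
proof -
  have "keys f \<subseteq> carrier H" "carrier H \<noteq> {}" using assms H.one_closed by (auto simp: keys_carrier_MA simp del: H.one_closed)
  then show ?thesis
    by (induction f rule: poly_mapping_carrier_induct)
      (simp_all add: mult_monoid_algebra_single mult_monoid_algebra_add_right ext_add ext_single
        field_embedding.mult[OF \<beta>] algebra_simps)
qed

lemma ext_mult_single:
  assumes "f \<in> carrier MA"
  shows "extend_semilinear \<beta> \<phi> (f \<otimes>\<^bsub>MA\<^esub> single x a) = \<beta> a * extend_semilinear \<beta> (\<lambda>h. \<phi> (h \<odot> x)) f"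
proof -
  have "keys f \<subseteq> carrier H" "carrier H \<noteq> {}" using assms H.one_closed by (auto simp: keys_carrier_MA simp del: H.one_closed)
  then show ?thesis
    by (induction f rule: poly_mapping_carrier_induct)
      (simp_all add: mult_monoid_algebra_single mult_monoid_algebra_add_left ext_add ext_single
        field_embedding.mult[OF \<beta>] algebra_simps)
qed

text \<open>As for the Hecke relations: composing a semilinear functional with a left or right
  multiplication keeps it semilinear, so the common annihilator is an ideal.\<close>

lemma ext_tensor_ideal:
  assumes f: "f \<in> TI" and \<phi>: "semilinear \<beta> \<phi>"
  shows "extend_semilinear \<beta> \<phi> f = 0"
proof -
  define K where "K = {f \<in> carrier MA. \<forall>\<phi>. semilinear \<beta> \<phi> \<longrightarrow> extend_semilinear \<beta> \<phi> f = 0}"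
  have left: "semilinear \<beta> (\<lambda>h. \<phi> (x \<odot> h))" if "semilinear \<beta> \<phi>" "x \<in> carrier H" for \<phi> x
    using that by (simp add: semilinear_def H.r_distr sc_mult_right)
  have right: "semilinear \<beta> (\<lambda>h. \<phi> (h \<odot> x))" if "semilinear \<beta> \<phi>" "x \<in> carrier H" for \<phi> x
    using that by (simp add: semilinear_def H.l_distr sc_mult_left)
  have "ideal K MA"
  proof (rule H.monoid_algebra_idealI)
    fix x a f assume x: "x \<in> carrier H" and f: "f \<in> K"
    then have fc: "f \<in> carrier MA" and xc: "single x a \<in> carrier MA"
      by (simp_all add: K_def single_carrier_monoid_algebra)
    show "single x a \<otimes>\<^bsub>MA\<^esub> f \<in> K"
      using f left[OF _ x] MA.m_closed[OF xc fc] by (simp add: K_def ext_single_mult)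
    show "f \<otimes>\<^bsub>MA\<^esub> single x a \<in> K"
      using f right[OF _ x] MA.m_closed[OF fc xc] by (simp add: K_def ext_mult_single)
  next
    show "0 \<in> K" using MA.zero_closed by (simp add: K_def extend_semilinear_zero)
    fix f g assume "f \<in> K" "g \<in> K"
    then show "f + g \<in> K" using MA.a_closed[of f g] by (simp add: K_def ext_add)
  qed (auto simp: K_def)
  moreover have "tensor_relations S m \<subseteq> K"
  proof
    fix f assume f: "f \<in> tensor_relations S m"
    then have fc: "f \<in> carrier MA" using tensor_relations_carrier by blast
    have "extend_semilinear \<beta> \<phi> f = 0" if \<phi>: "semilinear \<beta> \<phi>" for \<phi>
    proof -
      from f consider
        (add) h h' where "h \<in> carrier H" "h' \<in> carrier H" "f = single (h \<boxplus> h') 1 - single h 1 - single h' 1"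
      | (sc) c h where "h \<in> carrier H" "f = single (sc c h) 1 - single h (A_to_R c)"
        unfolding tensor_relations_def by blast
      then show ?thesis
        by cases (use \<phi> in \<open>simp_all add: ext_diff ext_single semilinear_def field_embedding.one[OF \<beta>]\<close>)
    qed
    then show "f \<in> K" using fc by (simp add: K_def)
  qed
  ultimately have "TI \<subseteq> K" unfolding tensor_ideal_def by (rule MA.genideal_minimal)
  then show ?thesis using f \<phi> by (auto simp: K_def)
qed

lemma ext_coset:
  assumes f: "f \<in> carrier MA" and f': "f' \<in> TI +>\<^bsub>MA\<^esub> f" and \<phi>: "semilinear \<beta> \<phi>"
  shows "extend_semilinear \<beta> \<phi> f' = extend_semilinear \<beta> \<phi> f" "keys f' \<subseteq> carrier H"
proof -
  obtain i where i: "i \<in> TI" "f' = i + f" using f' by (auto simp: TI.mem_coset)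
  show "extend_semilinear \<beta> \<phi> f' = extend_semilinear \<beta> \<phi> f"
    using i ext_tensor_ideal[OF i(1) \<phi>] by (simp add: ext_add)
  have "f' \<in> carrier MA" using MA.a_closed[of i f] i f TI.Icarr[of i] by simp
  then show "keys f' \<subseteq> carrier H" by (simp add: keys_carrier_MA)
qed

end

text \<open>The chosen representatives are replaced one slot at a time: the linear one for each
  fixed h, then the antilinear one.\<close>

lemma hecke_R_pairing_eq:
  assumes f: "f \<in> carrier MA" and k: "k \<in> carrier H"
  shows "hecke_R_pairing S m (TI +>\<^bsub>MA\<^esub> f) (tensor S m k 1) =
    extend_semilinear bar_R (\<lambda>h. A_to_R (tau (theta h \<odot> k))) f"
proof -
  have kc: "single k 1 \<in> carrier MA" using k by (simp add: single_carrier_monoid_algebra)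
  let ?F = "SOME f'. f' \<in> TI +>\<^bsub>MA\<^esub> f" and ?G = "SOME g. g \<in> TI +>\<^bsub>MA\<^esub> single k 1"
  have mem: "g \<in> TI +>\<^bsub>MA\<^esub> g" for g
    using TI.zero_closed by (force simp: TI.mem_coset)
  have F: "?F \<in> TI +>\<^bsub>MA\<^esub> f" and G: "?G \<in> TI +>\<^bsub>MA\<^esub> single k 1"
    using someI[of "\<lambda>g. g \<in> TI +>\<^bsub>MA\<^esub> f", OF mem] someI[of "\<lambda>g. g \<in> TI +>\<^bsub>MA\<^esub> single k 1", OF mem] by auto
  have bar: "semilinear bar_R (\<lambda>h. A_to_R (tau (theta h \<odot> k)))"
    using k by (simp add: semilinear_def theta_add theta_sc H.l_distr sc_mult_left tau_add tau_sc
        const_fract.add const_fract.mult bar_R_A_to_R)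
  have lin: "semilinear (\<lambda>c. c) (\<lambda>k. A_to_R (tau (theta h \<odot> k)))" if "h \<in> carrier H" for h
    using that by (simp add: semilinear_def H.r_distr sc_mult_right tau_add tau_sc const_fract.add const_fract.mult)
  have id: "field_embedding (\<lambda>c :: qva. c)" by (rule id_embedding.field_embedding_axioms)
  have "hecke_R_pairing S m (TI +>\<^bsub>MA\<^esub> f) (tensor S m k 1) =
      (\<Sum>h\<in>keys ?F. bar_R (lookup ?F h) * extend_semilinear (\<lambda>c. c) (\<lambda>k. A_to_R (tau (theta h \<odot> k))) ?G)"
    by (simp add: hecke_R_pairing_def Let_def tensor_def extend_semilinear_def hecke_pairing_def theta_def
        sum_distrib_left mult.assoc)
  also have "\<dots> = (\<Sum>h\<in>keys ?F. bar_R (lookup ?F h) * A_to_R (tau (theta h \<odot> k)))"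
  proof (intro sum.cong refl arg_cong2[where f = "(*)"])
    fix h assume "h \<in> keys ?F"
    then have h: "h \<in> carrier H" using ext_coset(2)[OF bar_R.field_embedding_axioms f F bar] by blast
    show "extend_semilinear (\<lambda>c. c) (\<lambda>k. A_to_R (tau (theta h \<odot> k))) ?G = A_to_R (tau (theta h \<odot> k))"
      using ext_coset(1)[OF id kc G lin[OF h]] by (simp add: linear_ext_simps)
  qed simp_all
  also have "\<dots> = extend_semilinear bar_R (\<lambda>h. A_to_R (tau (theta h \<odot> k))) ?F"
    by (simp add: extend_semilinear_def)
  also have "\<dots> = extend_semilinear bar_R (\<lambda>h. A_to_R (tau (theta h \<odot> k))) f"
    by (rule ext_coset(1)[OF bar_R.field_embedding_axioms f F bar])
  finally show ?thesis .
qed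

text \<open>\<open>prod_trace xs h\<close> is the value at \<open>h\<close> of the pairing with the product of the \<open>1 + a\<^sup>-\<^sup>1 t\<^sub>x\<close>
  for the words \<open>x\<close> in \<open>xs\<close>: since \<open>theta\<close> is an antilinear antiautomorphism sending \<open>t\<^sub>s\<close> to its inverse,
  it equals \<open>\<tau>(\<Prod>(1 + a t\<^sub>x\<^sup>-\<^sup>1) h)\<close>.\<close>

fun prod_trace :: "'s list list \<Rightarrow> ('s list \<Rightarrow>\<^sub>0 qv) set \<Rightarrow> qva" where
  "prod_trace [] h = A_to_R (tau h)"
| "prod_trace (x # xs) h = prod_trace xs h + var_a * prod_trace xs (tinv x \<odot> h)"

lemma hecke_R_pairing_prod:
  assumes "set xs \<subseteq> lists S" "h \<in> carrier H"
  shows "hecke_R_pairing S m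
      (foldr (\<lambda>x z. (\<one>\<^bsub>HR\<^esub> \<oplus>\<^bsub>HR\<^esub> tensor S m (tw x) (inverse var_a)) \<otimes>\<^bsub>HR\<^esub> z) xs \<one>\<^bsub>HR\<^esub>) (tensor S m h 1) =
    prod_trace xs h"
proof -
  define F where "F h = extend_semilinear bar_R (\<lambda>k. A_to_R (tau (theta k \<odot> h)))" for h
  define Z where "Z xs = foldr (\<lambda>x z. (\<one>\<^bsub>HR\<^esub> \<oplus>\<^bsub>HR\<^esub> tensor S m (tw x) (inverse var_a)) \<otimes>\<^bsub>HR\<^esub> z) xs \<one>\<^bsub>HR\<^esub>" for xs
  have one: "\<one>\<^bsub>HR\<^esub> = TI +>\<^bsub>MA\<^esub> single \<one>\<^bsub>H\<^esub> 1"
    using ring_hom_one[OF TI.rcos_ring_hom] by (simp add: hecke_R_def one_monoid_algebra)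
  \<comment> \<open>One representative has to serve all \<open>h\<close> at once, since a new factor
    x evaluates the induction hypothesis both at \<open>h\<close> and at
    \<open>tinv x \<odot> h\<close>.\<close>
  have "\<exists>f\<in>carrier MA. Z xs = TI +>\<^bsub>MA\<^esub> f \<and> (\<forall>h\<in>carrier H. F h f = prod_trace xs h)"
    using assms(1)
  proof (induction xs)
    case Nil
    show ?case
      by (intro bexI[of _ "single \<one>\<^bsub>H\<^esub> 1"])
        (simp_all add: Z_def F_def one single_carrier_monoid_algebra ext_single[OF bar_R.field_embedding_axioms]
          bar_R.one theta_one)
  next
    case (Cons x xs)
    then obtain f where x: "x \<in> lists S" and f: "f \<in> carrier MA" "Z xs = TI +>\<^bsub>MA\<^esub> f"
      and IH: "\<And>h. h \<in> carrier H \<Longrightarrow> F h f = prod_trace xs h" by auto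
    define g :: "('s list \<Rightarrow>\<^sub>0 qv) set \<Rightarrow>\<^sub>0 qva"
      where "g = single \<one>\<^bsub>H\<^esub> 1 + single (tw x) (inverse var_a)"
    have g: "g \<in> carrier MA"
      unfolding g_def using x MA.a_closed[of "single \<one>\<^bsub>H\<^esub> 1" "single (tw x) (inverse var_a)"]
      by (simp add: single_carrier_monoid_algebra)
    have "\<one>\<^bsub>HR\<^esub> \<oplus>\<^bsub>HR\<^esub> tensor S m (tw x) (inverse var_a) = TI +>\<^bsub>MA\<^esub> g"
      using ring_hom_add[OF TI.rcos_ring_hom, of "single \<one>\<^bsub>H\<^esub> 1" "single (tw x) (inverse var_a)"] x
      unfolding one g_def by (simp add: hecke_R_def tensor_def single_carrier_monoid_algebra)
    then have "Z (x # xs) = TI +>\<^bsub>MA\<^esub> (g \<otimes>\<^bsub>MA\<^esub> f)"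
      using ring_hom_mult[OF TI.rcos_ring_hom g f(1)] f(2) by (simp add: Z_def hecke_R_def)
    moreover have "F h (g \<otimes>\<^bsub>MA\<^esub> f) = prod_trace (x # xs) h" if h: "h \<in> carrier H" for h
    proof -
      have cong: "extend_semilinear bar_R \<phi> f = extend_semilinear bar_R \<psi> f"
        if "\<And>k. k \<in> carrier H \<Longrightarrow> \<phi> k = \<psi> k" for \<phi> \<psi>
        unfolding extend_semilinear_def by (intro sum.cong HOL.refl) (use f(1) that in \<open>auto simp: keys_carrier_MA\<close>)
      have "F h (g \<otimes>\<^bsub>MA\<^esub> f) = extend_semilinear bar_R (\<lambda>k. A_to_R (tau (theta (\<one>\<^bsub>H\<^esub> \<odot> k) \<odot> h))) f +
          var_a * extend_semilinear bar_R (\<lambda>k. A_to_R (tau (theta (tw x \<odot> k) \<odot> h))) f"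
        by (simp add: F_def g_def mult_monoid_algebra_add_left ext_add[OF bar_R.field_embedding_axioms]
            ext_single_mult[OF bar_R.field_embedding_axioms f(1)] bar_R.one bar_R_inverse_var_a)
      also have "extend_semilinear bar_R (\<lambda>k. A_to_R (tau (theta (\<one>\<^bsub>H\<^esub> \<odot> k) \<odot> h))) f = F h f"
        unfolding F_def by (rule cong) simp
      also have "extend_semilinear bar_R (\<lambda>k. A_to_R (tau (theta (tw x \<odot> k) \<odot> h))) f = F (tinv x \<odot> h) f"
        unfolding F_def by (rule cong) (use x h in \<open>simp add: theta_tw_mult H.m_assoc\<close>)
      finally show ?thesis using IH x h by simp
    qed
    ultimately show ?case using MA.m_closed[OF g f(1)] by blast
  qed
  then show ?thesis
    using hecke_R_pairing_eq[OF _ assms(2)] assms(2) unfolding F_def Z_def by auto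
qed

end

subsection \<open>Symmetry of the product trace\<close>

context coxeter_words
begin

lemma prod_trace_add:
  "set xs \<subseteq> lists S \<Longrightarrow> h \<in> carrier H \<Longrightarrow> h' \<in> carrier H \<Longrightarrow>
    prod_trace xs (h \<boxplus> h') = prod_trace xs h + prod_trace xs h'"
proof (induction xs arbitrary: h h')
  case Nil
  then show ?case by (simp add: tau_add const_fract.add)
next
  case (Cons x xs)
  then show ?case by (simp add: H.r_distr algebra_simps)
qed

lemma prod_trace_sc:
  "set xs \<subseteq> lists S \<Longrightarrow> h \<in> carrier H \<Longrightarrow> prod_trace xs (sc c h) = A_to_R c * prod_trace xs h"
proof (induction xs arbitrary: h)
  case Nil
  then show ?case by (simp add: tau_sc const_fract.mult)
next
  case (Cons x xs)
  then show ?case by (simp add: sc_mult_right algebra_simps)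
qed

lemma tinv_commute:
  assumes x: "x \<in> lists S" and h: "h \<in> carrier H" and c: "h \<odot> tw x = tw x \<odot> h"
  shows "h \<odot> tinv x = tinv x \<odot> h"
proof -
  have "h \<odot> tinv x = tinv x \<odot> (tw x \<odot> h) \<odot> tinv x"
    using x h by (simp add: tinv_left')
  also have "\<dots> = tinv x \<odot> h"
    using x h by (simp add: c[symmetric] H.m_assoc tinv_right)
  finally show ?thesis .
qed

definition gen_symmetric :: "'s \<Rightarrow> 's list list \<Rightarrow> bool" where
  "gen_symmetric s xs \<longleftrightarrow> (\<forall>h\<in>carrier H. prod_trace xs (tw [s] \<odot> h) = prod_trace xs (h \<odot> tw [s]))"

lemma gen_symmetric_Nil: "s \<in> S \<Longrightarrow> gen_symmetric s []"
  by (simp add: gen_symmetric_def tau_mult)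

lemma gen_symmetric_Cons:
  assumes s: "s \<in> S" and x: "x \<in> lists S" and c: "tw [s] \<odot> tw x = tw x \<odot> tw [s]"
    and xs: "gen_symmetric s xs"
  shows "gen_symmetric s (x # xs)"
  unfolding gen_symmetric_def
proof
  fix h assume h: "h \<in> carrier H"
  have t: "tw [s] \<in> carrier H" using s by simp
  have "tinv x \<odot> (tw [s] \<odot> h) = tw [s] \<odot> (tinv x \<odot> h)"
    using tinv_commute[OF x t c] x t h by (simp flip: H.m_assoc)
  then show "prod_trace (x # xs) (tw [s] \<odot> h) = prod_trace (x # xs) (h \<odot> tw [s])"
    using xs x t h by (simp add: gen_symmetric_def H.m_assoc)
qed

text \<open>Neighbouring factors need not commute with \<open>t\<^sub>s\<close> separately, but the elementary symmetric
  functions of \<open>t\<^sub>x\<close> and \<open>t\<^sub>y\<close> do, hence so do those of the inverses.\<close>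

lemma gen_symmetric_Cons_Cons:
  assumes s: "s \<in> S" and x: "x \<in> lists S" and y: "y \<in> lists S" and xs: "set xs \<subseteq> lists S"
    and sum: "tw [s] \<odot> (tw x \<boxplus> tw y) = (tw x \<boxplus> tw y) \<odot> tw [s]"
    and prod: "tw [s] \<odot> (tw x \<odot> tw y) = (tw x \<odot> tw y) \<odot> tw [s]"
    and comm: "tw x \<odot> tw y = tw y \<odot> tw x"
    and sym: "gen_symmetric s xs"
  shows "gen_symmetric s (x # y # xs)"
  unfolding gen_symmetric_def
proof
  fix h assume h: "h \<in> carrier H"
  let ?B = "tinv (x @ y)" and ?A = "tinv x \<boxplus> tinv y"
  have t: "tw [s] \<in> carrier H" using s by simp
  have xy: "x @ y \<in> lists S" using x y by simp
  have B: "?B = tinv y \<odot> tinv x" "?B = tinv x \<odot> tinv y"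
    using tinv_append[OF x y] tinv_append[OF y x] comm x y by (simp_all flip: tw_append)
  have A: "?A = ?B \<odot> (tw x \<boxplus> tw y)"
  proof -
    have "?B \<odot> tw x = tinv y" unfolding B(1) using x y by (simp add: H.m_assoc tinv_left)
    moreover have "?B \<odot> tw y = tinv x" unfolding B(2) using x y by (simp add: H.m_assoc tinv_left)
    ultimately show ?thesis using x y by (simp add: H.r_distr H.a_comm)
  qed
  have cB: "?B \<odot> tw [s] = tw [s] \<odot> ?B"
    using tinv_commute[OF xy t] prod x y by (simp add: tw_append)
  have cA: "?A \<odot> tw [s] = tw [s] \<odot> ?A"
  proof -
    have "?A \<odot> tw [s] = ?B \<odot> (tw [s] \<odot> (tw x \<boxplus> tw y))"
      unfolding A sum using x y t xy by (simp add: H.m_assoc)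
    also have "\<dots> = tw [s] \<odot> ?A"
      unfolding A using x y t xy cB by (simp flip: H.m_assoc)
    finally show ?thesis .
  qed
  \<comment> \<open>Only the sum and the product of the two inverses enter, so it is enough that t_s
    commutes with these.\<close>
  have expand: "prod_trace (x # y # xs) k =
      prod_trace xs k + var_a * prod_trace xs (?A \<odot> k) + var_a * var_a * prod_trace xs (?B \<odot> k)"
    if k: "k \<in> carrier H" for k
    using x y xs k unfolding B(1) by (simp add: H.l_distr prod_trace_add H.m_assoc algebra_simps)
  have ABc: "?A \<in> carrier H" "?B \<in> carrier H" using x y xy by simp_all
  have A': "prod_trace xs (?A \<odot> (tw [s] \<odot> h)) = prod_trace xs (?A \<odot> (h \<odot> tw [s]))"
  proof -
    have "?A \<odot> (tw [s] \<odot> h) = tw [s] \<odot> (?A \<odot> h)" using ABc(1) t h cA by (simp flip: H.m_assoc)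
    then show ?thesis using sym ABc(1) t h by (simp add: gen_symmetric_def H.m_assoc)
  qed
  have B': "prod_trace xs (?B \<odot> (tw [s] \<odot> h)) = prod_trace xs (?B \<odot> (h \<odot> tw [s]))"
  proof -
    have "?B \<odot> (tw [s] \<odot> h) = tw [s] \<odot> (?B \<odot> h)" using ABc(2) t h cB by (simp flip: H.m_assoc)
    then show ?thesis using sym ABc(2) t h by (simp add: gen_symmetric_def H.m_assoc)
  qed
  show "prod_trace (x # y # xs) (tw [s] \<odot> h) = prod_trace (x # y # xs) (h \<odot> tw [s])"
    using expand[of "tw [s] \<odot> h"] expand[of "h \<odot> tw [s]"] A' B' sym t h
    by (simp add: gen_symmetric_def del: prod_trace.simps)
qed

lemma prod_trace_mult:
  assumes xs: "set xs \<subseteq> lists S" and sym: "\<And>s. s \<in> S \<Longrightarrow> gen_symmetric s xs"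
    and h: "h \<in> carrier H" "h' \<in> carrier H"
  shows "prod_trace xs (h \<odot> h') = prod_trace xs (h' \<odot> h)"
  by (rule trace_from_generators[where \<rho> = A_to_R])
    (use assms in \<open>simp_all add: prod_trace_add prod_trace_sc gen_symmetric_def\<close>)

text \<open>Writing t for t_s, L' = t L t and t^2 = 1 + q t give t L' = L t + q L' and L' t = t L +
  q L'; so both products with the sum are t L + L t + q L'.\<close>

lemma conj_gen_commute:
  assumes s: "s \<in> S" and L: "L \<in> carrier H" and L': "L' = tw [s] \<odot> (L \<odot> tw [s])"
    and comm: "L \<odot> L' = L' \<odot> L"
  shows "tw [s] \<odot> (L \<boxplus> L') = (L \<boxplus> L') \<odot> tw [s]" "tw [s] \<odot> (L \<odot> L') = (L \<odot> L') \<odot> tw [s]"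
proof -
  let ?t = "tw [s]"
  have t: "?t \<in> carrier H" using s by simp
  have tt: "?t \<odot> (?t \<odot> h) = h \<boxplus> sc var_q (?t \<odot> h)" if "h \<in> carrier H" for h
    using t that tw_square[OF s] by (simp add: H.l_distr sc_mult_left flip: H.m_assoc)
  have "?t \<odot> (L \<boxplus> L') = ?t \<odot> L \<boxplus> (L \<odot> ?t \<boxplus> sc var_q L')"
    unfolding L' using t L tt[of "L \<odot> ?t"] by (simp add: H.r_distr)
  moreover have "(L \<boxplus> L') \<odot> ?t = L \<odot> ?t \<boxplus> (?t \<odot> L \<boxplus> sc var_q L')"
    unfolding L' using t L tw_square[OF s] by (simp add: H.l_distr H.r_distr H.m_assoc sc_mult_right)
  ultimately show "?t \<odot> (L \<boxplus> L') = (L \<boxplus> L') \<odot> ?t"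
    using t L by (simp add: L' H.a_lcomm)
  have "?t \<odot> (L \<odot> L') = (?t \<odot> (L \<odot> ?t)) \<odot> (L \<odot> ?t)"
    unfolding L' using t L by (simp add: H.m_assoc)
  also have "\<dots> = (L' \<odot> L) \<odot> ?t" unfolding L' using t L by (simp add: H.m_assoc)
  finally show "?t \<odot> (L \<odot> L') = (L \<odot> L') \<odot> ?t" by (simp add: comm)
qed

text \<open>L^2 + L'^2 = (L + L')^2 - 2 L L' and L^2 L'^2 = (L L')^2, so the symmetric functions of
  the squares are polynomials in those of L and L'.\<close>

lemma square_commute:
  assumes t: "t \<in> carrier H" and L: "L \<in> carrier H" "L' \<in> carrier H"
    and comm: "L \<odot> L' = L' \<odot> L"
    and sum: "t \<odot> (L \<boxplus> L') = (L \<boxplus> L') \<odot> t" and prod: "t \<odot> (L \<odot> L') = (L \<odot> L') \<odot> t"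
  shows "t \<odot> (L \<odot> L \<boxplus> L' \<odot> L') = (L \<odot> L \<boxplus> L' \<odot> L') \<odot> t"
    "t \<odot> ((L \<odot> L) \<odot> (L' \<odot> L')) = ((L \<odot> L) \<odot> (L' \<odot> L')) \<odot> t"
proof -
  let ?A = "L \<boxplus> L'" and ?B = "L \<odot> L'" and ?Z = "L \<odot> L \<boxplus> L' \<odot> L'"
  have c: "?A \<in> carrier H" "?B \<in> carrier H" "?Z \<in> carrier H" using L by simp_all
  have AA: "?A \<odot> ?A = ?Z \<boxplus> (?B \<boxplus> ?B)"
    using L comm[symmetric] by (simp add: H.l_distr H.r_distr H.a_ac)
  have "t \<odot> (?A \<odot> ?A) = (?A \<odot> ?A) \<odot> t"
    using sum t c(1) by (metis H.m_assoc)
  then have "t \<odot> ?Z \<boxplus> t \<odot> (?B \<boxplus> ?B) = ?Z \<odot> t \<boxplus> (?B \<boxplus> ?B) \<odot> t"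
    unfolding AA using t c by (simp add: H.l_distr H.r_distr)
  moreover have "t \<odot> (?B \<boxplus> ?B) = (?B \<boxplus> ?B) \<odot> t"
    using t c prod by (simp add: H.l_distr H.r_distr)
  ultimately have "t \<odot> ?Z \<boxplus> (?B \<boxplus> ?B) \<odot> t = ?Z \<odot> t \<boxplus> (?B \<boxplus> ?B) \<odot> t" by simp
  then show "t \<odot> ?Z = ?Z \<odot> t"
    using H.add.right_cancel[of "(?B \<boxplus> ?B) \<odot> t" "t \<odot> ?Z" "?Z \<odot> t"] t c by simp
  have BB: "(L \<odot> L) \<odot> (L' \<odot> L') = ?B \<odot> ?B"
  proof -
    have "(L \<odot> L) \<odot> (L' \<odot> L') = L \<odot> ((L \<odot> L') \<odot> L')" using L by (simp add: H.m_assoc)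
    also have "\<dots> = L \<odot> ((L' \<odot> L) \<odot> L')" by (simp only: comm)
    also have "\<dots> = ?B \<odot> ?B" using L by (simp add: H.m_assoc)
    finally show ?thesis .
  qed
  show "t \<odot> ((L \<odot> L) \<odot> (L' \<odot> L')) = ((L \<odot> L) \<odot> (L' \<odot> L')) \<odot> t"
    unfolding BB using prod t c(2) by (metis H.m_assoc)
qed

end

context parabolic
begin

text \<open>The factors over \<open>S'\<close> are absorbed into \<open>h\<close> one by one, their
  inverses lying in the subalgebra. Only \<open>ys\<close> and the trailing element
  \<open>k\<close>, which will be 1 or a generator, remain to be evaluated.\<close>

lemma prod_trace_inc:
  assumes xs: "set xs \<subseteq> lists S'" and k: "k \<in> carrier H"
    and base: "\<And>h. h \<in> carrier P.H \<Longrightarrow> prod_trace ys (inc h \<odot> k) = r * A_to_R (P.tau h)"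
    and h: "h \<in> carrier P.H"
  shows "prod_trace (xs @ ys) (inc h \<odot> k) = r * P.prod_trace xs h"
  using xs h
proof (induction xs arbitrary: h)
  case Nil
  then show ?case using base by simp
next
  case (Cons x xs)
  then have x: "x \<in> lists S'" by simp
  have "tinv x \<odot> (inc h \<odot> k) = inc (P.tinv x \<otimes>\<^bsub>P.H\<^esub> h) \<odot> k"
    using x Cons.prems k by (simp add: inc_mult inc_tinv lists_subset H.m_assoc)
  then show ?case
    using Cons x by (simp add: algebra_simps)
qed

lemma prod_trace_markov:
  assumes xs: "set xs \<subseteq> lists S'" and h: "h \<in> carrier P.H"
    and d: "d \<in> lists S" "d = s # d'" and s: "s \<notin> S'"
    and minimal: "\<And>x. x \<in> lists S' \<Longrightarrow> length d \<le> len (x @ d)"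
  shows "prod_trace (xs @ [d @ rev d]) (inc h) = (1 + var_a) * P.prod_trace xs h"
    "prod_trace (xs @ [d @ rev d]) (inc h \<odot> tw [s]) = A_to_R var_q * P.prod_trace xs h"
proof -
  have sS: "s \<in> S" using d by simp
  have "prod_trace (xs @ [d @ rev d]) (inc h \<odot> \<one>\<^bsub>H\<^esub>) = (1 + var_a) * P.prod_trace xs h"
    using xs h
    by (intro prod_trace_inc)
      (simp_all add: tau_double_coset_inc[OF d(1) minimal] tau_inc algebra_simps)
  then show "prod_trace (xs @ [d @ rev d]) (inc h) = (1 + var_a) * P.prod_trace xs h"
    using h by simp
  show "prod_trace (xs @ [d @ rev d]) (inc h \<odot> tw [s]) = A_to_R var_q * P.prod_trace xs h"
    using xs h sS
    by (intro prod_trace_inc)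
      (simp_all add: tau_double_coset_inc_gen[OF d(1) minimal d(2) sS] tau_inc_gen[OF sS s]
        const_fract.mult const_fract.zero)
qed

end

section \<open>Types A, B and D\<close>

lemma braid_eq_rev: "braid_eq m x y \<Longrightarrow> braid_eq m (rev x) (rev y)"
proof (induction rule: braid_eq.induct)
  case (rel s t u v)
  show ?case
    using braid_eq.rel[of s t m "rev v" "rev u"] braid_eq.sym[OF braid_eq.rel[of s t m "rev v" "rev u"]] rel
    by (simp add: rev_alternating_word)
qed (blast intro: braid_eq.refl braid_eq.sym braid_eq.trans)+

lemma braid_eq_commute_letters: "s \<noteq> t \<Longrightarrow> m s t = 2 \<Longrightarrow> braid_eq m (u @ s # t # v) (u @ t # s # v)"
  using braid_eq.rel[of s t m u v] by (simp add: numeral_eq_Suc)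

lemma braid_eq_3: "s \<noteq> t \<Longrightarrow> m s t = 3 \<Longrightarrow> braid_eq m (u @ s # t # s # v) (u @ t # s # t # v)"
  using braid_eq.rel[of s t m u v] by (simp add: numeral_eq_Suc)

lemma braid_eq_commute_word:
  "\<forall>t\<in>set w. s \<noteq> t \<and> m s t = 2 \<Longrightarrow> braid_eq m (s # w) (w @ [s])"
proof (induction w)
  case (Cons t w)
  have "braid_eq m (s # t # w) (t # s # w)"
    using braid_eq_commute_letters[of s t m "[]" w] Cons.prems by simp
  moreover have "braid_eq m (t # s # w) (t # w @ [s])" using Cons braid_eq_Cons by simp
  ultimately show ?case by (simp add: braid_eq.trans)
qed (simp add: braid_eq.refl)

text \<open>The action by signed permutations serves two purposes: it shows that the entries of the Coxeter
  matrix are the true orders of the products of generators, and the point to which \<open>n\<close> is moved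
  bounds the lengths of coset representatives from below.\<close>

fun act_label :: "label \<Rightarrow> int \<Rightarrow> int" where
  "act_label (Node i) p =
     (if i = 0 then (if \<bar>p\<bar> = 1 then - p else p)
      else if p = int i then p + 1 else if p = int i + 1 then p - 1
      else if p = - int i then p - 1 else if p = - int i - 1 then p + 1 else p)"
| "act_label Prime1 p = (if p = 1 \<or> p = 2 then p - 3 else if p = - 1 \<or> p = - 2 then p + 3 else p)"

text \<open>The labels of a type for all indices at once. \<open>Node 0\<close> is kept out of types
  A and D, where its matrix entry with \<open>Node 1\<close> is 3 although the action has order
  4.\<close>

fun valid_label :: "cox_type \<Rightarrow> label \<Rightarrow> bool" where
  "valid_label X (Node i) \<longleftrightarrow> (X = TypeB \<or> i \<ge> 1)"
| "valid_label X Prime1 \<longleftrightarrow> X = TypeD"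

lemma labels_valid: "s \<in> labels X n \<Longrightarrow> valid_label X s"
  by (cases X) (auto split: if_splits)

lemma act_label_involution: "act_label s (act_label s p) = p"
  by (cases s) auto

fun support :: "label \<Rightarrow> int set" where
  "support (Node i) = (if i = 0 then {1, - 1} else {int i, int i + 1, - int i, - int i - 1})"
| "support Prime1 = {1, 2, - 1, - 2}"

lemma act_label_support: "p \<in> support s \<Longrightarrow> act_label s p \<in> support s"
proof (cases s)
  case (Node i)
  assume "p \<in> support s"
  then consider "i = 0" "p = 1" | "i = 0" "p = - 1" | "i \<noteq> 0" "p = int i" | "i \<noteq> 0" "p = int i + 1"
    | "i \<noteq> 0" "p = - int i" | "i \<noteq> 0" "p = - int i - 1" using Node by (auto split: if_splits)
  then show ?thesis using Node by cases simp_all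
qed auto

lemma act_label_fixed: "p \<notin> support s \<Longrightarrow> act_label s p = p"
  by (cases s) (auto split: if_splits)

text \<open>Commuting labels move disjoint sets of points, with the single exception of
  \<open>Node 1\<close> and \<open>Prime1\<close>.\<close>

lemma act_label_commute:
  assumes "s \<noteq> t" "cox_matrix X s t = 2" "valid_label X s" "valid_label X t"
  shows "act_label s (act_label t p) = act_label t (act_label s p)"
proof (cases "support s \<inter> support t = {}")
  case True
  then consider "p \<notin> support s" "p \<notin> support t" | "p \<in> support s" "p \<notin> support t" "act_label s p \<notin> support t"
    | "p \<in> support t" "p \<notin> support s" "act_label t p \<notin> support s"
    using act_label_support[of p s] act_label_support[of p t] by blast
  then show ?thesis by cases (simp_all add: act_label_fixed del: act_label.simps)
next
  case False
  have "s = Node 1 \<and> t = Prime1 \<or> s = Prime1 \<and> t = Node 1"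
    using assms False by (cases s; cases t) (auto split: if_splits)
  moreover have "act_label (Node 1) (act_label Prime1 p) = act_label Prime1 (act_label (Node 1) p)"
  proof -
    consider "p = 1" | "p = 2" | "p = - 1" | "p = - 2" | "p \<notin> {1, 2, - 1, - 2}" by blast
    then show ?thesis by cases auto
  qed
  ultimately show ?thesis by (elim disjE conjE) (simp_all del: act_label.simps)
qed

lemma act_label_braid3_Suc:
  assumes "i \<ge> 1"
  shows "act_label (Node i) (act_label (Node (Suc i)) (act_label (Node i) p)) =
    act_label (Node (Suc i)) (act_label (Node i) (act_label (Node (Suc i)) p))"
proof -
  consider "p = int i" | "p = int i + 1" | "p = int i + 2" | "p = - int i" | "p = - int i - 1" | "p = - int i - 2"
    | "p \<notin> {int i, int i + 1, int i + 2, - int i, - int i - 1, - int i - 2}" by blast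
  then show ?thesis using assms by cases auto
qed

lemma act_label_braid3_Prime1:
  "act_label (Node 2) (act_label Prime1 (act_label (Node 2) p)) =
    act_label Prime1 (act_label (Node 2) (act_label Prime1 p))"
proof -
  consider "p = 1" | "p = 2" | "p = 3" | "p = - 1" | "p = - 2" | "p = - 3" | "p \<notin> {1, 2, 3, - 1, - 2, - 3}" by blast
  then show ?thesis by cases auto
qed

lemma act_label_braid3:
  assumes "cox_matrix X s t = 3" "valid_label X s" "valid_label X t"
  shows "act_label s (act_label t (act_label s p)) = act_label t (act_label s (act_label t p))"
proof (cases s; cases t)
  fix i j assume st: "s = Node i" "t = Node j"
  then have "(i \<ge> 1 \<and> j = Suc i) \<or> (j \<ge> 1 \<and> i = Suc j)" using assms by (auto split: if_splits)
  then show ?thesis using st act_label_braid3_Suc[of i p] act_label_braid3_Suc[of j p]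
    by (elim disjE conjE) (simp_all del: act_label.simps)
next
  fix i assume st: "s = Node i" "t = Prime1"
  then have "i = 2" using assms by (auto split: if_splits)
  then show ?thesis using st act_label_braid3_Prime1[of p] by (simp del: act_label.simps)
next
  fix i assume st: "s = Prime1" "t = Node i"
  then have "i = 2" using assms by (auto split: if_splits)
  then show ?thesis using st act_label_braid3_Prime1[of p] by (simp del: act_label.simps)
qed (use assms in auto)

lemma cox_matrix_sym: "cox_matrix X s t = cox_matrix X t s"
  by (cases s; cases t) auto

lemma cox_matrix_cases:
  assumes "valid_label X s" "valid_label X t" "s \<noteq> t"
  obtains "cox_matrix X s t = 2" | "cox_matrix X s t = 3"
  | "cox_matrix X s t = 4" "s = Node 0 \<and> t = Node 1 \<or> s = Node 1 \<and> t = Node 0"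
proof -
  have "cox_matrix X s t = 2 \<or> cox_matrix X s t = 3 \<or>
      cox_matrix X s t = 4 \<and> (s = Node 0 \<and> t = Node 1 \<or> s = Node 1 \<and> t = Node 0)"
    using assms by (cases s; cases t) auto
  then show ?thesis using that by blast
qed

lemma act_label_braid4:
  fixes f g :: "int \<Rightarrow> int"
  defines "f \<equiv> act_label (Node 0)" and "g \<equiv> act_label (Node 1)"
  shows "g (f (g (f (g (f (g (f p))))))) = p" "f (g (f (g (f (g (f (g p))))))) = p"
proof -
  have v: "f 1 = - 1" "f 2 = 2" "f (- 1) = 1" "f (- 2) = - 2" "g 1 = 2" "g 2 = 1" "g (- 1) = - 2" "g (- 2) = - 1"
    by (simp_all add: f_def g_def)
  have w: "f p = p" "g p = p" if "p \<notin> {1, 2, - 1, - 2}"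
    using that by (auto simp: f_def g_def)
  consider "p = 1" | "p = 2" | "p = - 1" | "p = - 2" | "p \<notin> {1, 2, - 1, - 2}" by blast
  then show "g (f (g (f (g (f (g (f p))))))) = p" "f (g (f (g (f (g (f (g p))))))) = p"
    by (cases; simp only: v w)+
qed

lemma act_label_relation:
  assumes "valid_label X s" "valid_label X t"
  shows "((act_label t \<circ> act_label s) ^^ cox_matrix X s t) p = p"
proof (cases "s = t")
  case True
  then have "cox_matrix X s t = 1" by (cases s) auto
  then show ?thesis using True act_label_involution by simp
next
  case False
  from assms False show ?thesis
  proof (cases rule: cox_matrix_cases)
    case 1
    then show ?thesis
      using act_label_commute[OF False 1 assms] act_label_involution
      by (simp add: numeral_eq_Suc del: act_label.simps)
  next
    case 2
    then show ?thesis
      using act_label_braid3[OF 2 assms] act_label_involution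
      by (simp add: numeral_eq_Suc del: act_label.simps)
  next
    case 3
    have four: "(g ^^ 4) p = g (g (g (g p)))" for g :: "int \<Rightarrow> int"
      by (simp add: numeral_eq_Suc)
    show ?thesis
      using 3(2) act_label_braid4[of p] unfolding 3(1) four o_apply by (elim disjE conjE) (simp_all only:)
  qed
qed

lemma fold_act_relation: "fold act_label (concat (replicate k [s, t])) p = ((act_label t \<circ> act_label s) ^^ k) p"
  by (induction k arbitrary: p) (simp_all add: funpow_Suc_right del: funpow.simps(2) act_label.simps)

lemma fold_act_cox_eq:
  "cox_eq (labels X n) (cox_matrix X) x y \<Longrightarrow> fold act_label x p = fold act_label y p"
proof (induction arbitrary: p rule: cox_eq.induct)
  case (rel us vs s t)
  then have "valid_label X s" "valid_label X t" by (simp_all add: labels_valid)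
  then show ?case by (simp add: fold_act_relation act_label_relation)
qed simp_all

lemma act_label_distinct:
  assumes "valid_label X s" "valid_label X t" "s \<noteq> t"
  shows "\<exists>p. act_label t (act_label s p) \<noteq> p"
proof -
  have "\<exists>p. act_label s p \<noteq> act_label t p"
  proof (cases s; cases t)
    fix i j assume "s = Node i" "t = Node j"
    then show ?thesis using assms by (intro exI[of _ "int i + 1"]) auto
  next
    fix i assume "s = Node i" "t = Prime1"
    then show ?thesis using assms by (intro exI[of _ "int i + 1"]) auto
  next
    fix i assume "s = Prime1" "t = Node i"
    then show ?thesis using assms by (intro exI[of _ "int i + 1"]) auto
  qed (use assms in auto)
  then show ?thesis using act_label_involution by metis
qed

text \<open>If k is 1 or one less than the entry, a trivial k-th power would make st act trivially,
  against \<open>act_label_distinct\<close>. Only entry 4 with k = 2 is left, and it is refuted at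
  the point 1.\<close>

lemma act_label_order:
  assumes st: "valid_label X s" "valid_label X t" "s \<noteq> t" and k: "0 < k" "k < cox_matrix X s t"
  shows "\<exists>p. ((act_label t \<circ> act_label s) ^^ k) p \<noteq> p"
proof (rule ccontr)
  let ?g = "act_label t \<circ> act_label s"
  assume "\<not> ?thesis"
  then have gk: "(?g ^^ k) p = p" for p by blast
  have gm: "(?g ^^ cox_matrix X s t) p = p" for p by (rule act_label_relation[OF st(1,2)])
  have "?g p = p" for p
  proof (cases "Suc k = cox_matrix X s t")
    case True
    then have "(?g ^^ Suc k) p = p" using gm[of p] by simp
    then have "?g ((?g ^^ k) p) = p" by simp
    then show ?thesis by (simp only: gk)
  next
    case False
    show ?thesis
    proof (cases "k = 1")
      case True
      then show ?thesis using gk[of p] by simp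
    next
      case k1: False
      from st have "cox_matrix X s t = 4 \<and> (s = Node 0 \<and> t = Node 1 \<or> s = Node 1 \<and> t = Node 0)"
        by (cases rule: cox_matrix_cases) (use k k1 False in auto)
      then have "k = 2" "s = Node 0 \<and> t = Node 1 \<or> s = Node 1 \<and> t = Node 0" using k k1 False by auto
      moreover have "(g ^^ 2) r = g (g r)" for g :: "int \<Rightarrow> int" and r by (simp add: numeral_eq_Suc)
      ultimately show ?thesis using gk[of 1] by auto
    qed
  qed
  then show False using act_label_distinct[OF st] by auto
qed

lemma coxeter_words_labels: "coxeter_words (labels X n) (cox_matrix X)"
proof
  fix s t assume st: "s \<in> labels X n" "t \<in> labels X n"
  show "cox_matrix X s s = 1" by (cases s) auto
  show "cox_matrix X s t = cox_matrix X t s" by (rule cox_matrix_sym)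
  assume ne: "s \<noteq> t"
  have v: "valid_label X s" "valid_label X t" using st by (simp_all add: labels_valid)
  from v ne show "2 \<le> cox_matrix X s t" by (cases rule: cox_matrix_cases) simp_all
  fix k assume k: "0 < k" "k < cox_matrix X s t"
  obtain p where p: "((act_label t \<circ> act_label s) ^^ k) p \<noteq> p" using act_label_order[OF v ne k] by blast
  show "\<not> cox_eq (labels X n) (cox_matrix X) (alternating_word s t (2 * k)) []"
  proof
    assume "cox_eq (labels X n) (cox_matrix X) (alternating_word s t (2 * k)) []"
    from fold_act_cox_eq[OF this, of p] p show False
      by (simp only: alternating_word_double fold_act_relation) simp
  qed
qed

lemma labels_mono: "k \<le> n \<Longrightarrow> labels X k \<subseteq> labels X n"
  by (cases X) auto

subsection \<open>Distinguished coset representatives\<close>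

text \<open>\<open>coset_word X n\<close> represents the longest of the minimal representatives of the right cosets of the
  group of index \<open>n - 1\<close> in the group of index \<open>n\<close>; it moves the point \<open>n\<close> as far as possible.\<close>

fun coset_word :: "cox_type \<Rightarrow> nat \<Rightarrow> label list" where
  "coset_word X 0 = []"
| "coset_word TypeA (Suc n) = (if n = 0 then [] else Node n # coset_word TypeA n)"
| "coset_word TypeB (Suc n) = (if n = 0 then [Node 0] else Node n # coset_word TypeB n @ [Node n])"
| "coset_word TypeD (Suc n) = (if n = 0 then [] else if n = 1 then [Prime1, Node 1]
     else Node n # coset_word TypeD n @ [Node n])"

lemma coset_word_lists: "coset_word X n \<in> lists (labels X n)"
proof (induction n)
  case (Suc n)
  have "coset_word X n \<in> lists (labels X (Suc n))"
    using Suc lists_mono[OF labels_mono[of n "Suc n" X]] by auto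
  then show ?case by (cases X) auto
qed simp

text \<open>A coordinate on the orbit of \<open>n\<close> that every generator changes by at most 1.\<close>

fun height :: "cox_type \<Rightarrow> int \<Rightarrow> int" where
  "height TypeA p = p"
| "height TypeB p = (if p > 0 then p else p + 1)"
| "height TypeD p = (if p > 0 then p - 1 else p + 1)"

lemma act_label_nonzero: "p \<noteq> 0 \<Longrightarrow> act_label s p \<noteq> 0"
  by (cases s) auto

lemma height_step:
  assumes "valid_label X s" "p \<noteq> 0"
  shows "\<bar>height X (act_label s p) - height X p\<bar> \<le> 1"
  using assms by (cases X; cases s) auto

lemma height_fold_act:
  "\<forall>s\<in>set x. valid_label X s \<Longrightarrow> p \<noteq> 0 \<Longrightarrow> \<bar>height X (fold act_label x p) - height X p\<bar> \<le> int (length x)"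
proof (induction x arbitrary: p)
  case (Cons s x)
  have "\<bar>height X (fold act_label x (act_label s p)) - height X (act_label s p)\<bar> \<le> int (length x)"
    using Cons act_label_nonzero by simp
  moreover have "\<bar>height X (act_label s p) - height X p\<bar> \<le> 1" using Cons.prems height_step by simp
  ultimately show ?case by (simp del: act_label.simps)
qed simp

text \<open>The point n goes to 1 in type A and to -n in types B and D (for n at least 2 in type D);
  the distances in height are n - 1, 2n - 1 and 2n - 2.\<close>

lemma coset_word_height:
  assumes "n \<ge> 1"
  shows "\<bar>height X (fold act_label (coset_word X n) (int n)) - height X (int n)\<bar> = int (length (coset_word X n))"
proof (cases X)
  case TypeA
  have "fold act_label (coset_word TypeA n) (int n) = 1 \<and> int (length (coset_word TypeA n)) = int n - 1"
    using assms
  proof (induction n rule: dec_induct)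
    case (step n)
    then show ?case by (cases n) auto
  qed simp
  then show ?thesis using TypeA assms by simp
next
  case TypeB
  have "fold act_label (coset_word TypeB n) (int n) = - int n \<and> int (length (coset_word TypeB n)) = 2 * int n - 1"
    using assms
  proof (induction n rule: dec_induct)
    case (step n)
    then show ?case by (cases n) auto
  qed simp
  then show ?thesis using TypeB assms by simp
next
  case TypeD
  have "fold act_label (coset_word TypeD n) (int n) = - int n \<and> int (length (coset_word TypeD n)) = 2 * int n - 2"
    if "n \<ge> 2"
    using that
  proof (induction n rule: dec_induct)
    case (step n)
    then show ?case by (cases n) auto
  qed (simp add: numeral_eq_Suc)
  then show ?thesis using TypeD assms by (cases "n = 1") auto
qed

lemma fold_act_fixed: "x \<in> lists (labels X (n - 1)) \<Longrightarrow> fold act_label x (int n) = int n"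
proof (induction x)
  case (Cons s x)
  have "act_label s (int n) = int n" using Cons.prems by (cases X) (auto split: if_splits)
  then show ?case using Cons by simp
qed simp

text \<open>\<open>x\<close> acts first and fixes the point n. Hence every word for the product
  moves n as far as the coset word does, at a cost of at least one letter per unit of
  height.\<close>

lemma coset_word_minimal:
  assumes n: "n \<ge> 1" and x: "x \<in> lists (labels X (n - 1))"
  shows "length (coset_word X n) \<le> coxeter_words.len (labels X n) (cox_matrix X) (x @ coset_word X n)"
proof -
  interpret coxeter_words "labels X n" "cox_matrix X" by (rule coxeter_words_labels)
  have "x @ coset_word X n \<in> lists (labels X n)"
    using x lists_mono[OF labels_mono[of "n - 1" n X]] coset_word_lists by auto
  then obtain y where y: "eq (x @ coset_word X n) y" "reduced y" "length y = len (x @ coset_word X n)"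
    using ex_reduced by blast
  have "\<forall>s\<in>set y. valid_label X s"
    using reduced_lists[OF y(2)] labels_valid by (auto simp: in_lists_conv_set)
  then have "\<bar>height X (fold act_label y (int n)) - height X (int n)\<bar> \<le> int (length y)"
    using n by (intro height_fold_act) auto
  moreover have "fold act_label y (int n) = fold act_label (coset_word X n) (int n)"
    using fold_act_cox_eq[OF y(1), of "int n"] fold_act_fixed[OF x] by simp
  ultimately show ?thesis using coset_word_height[OF n, of X] y(3) by simp
qed

text \<open>Conjugation by the coset word d of the next index: j d = d (twist j). In type D the
  number of sign changes is even, so d negates the point 1 along with the largest point, which
  interchanges 1 and 1'.\<close>

fun twist :: "cox_type \<Rightarrow> label \<Rightarrow> label" where
  "twist TypeA (Node i) = Node (Suc i)"
| "twist TypeD Prime1 = Node 1"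
| "twist TypeD (Node i) = (if i = 1 then Prime1 else Node i)"
| "twist X s = s"

section \<open>Moving generators through the coset words\<close>

lemma far_labels: "t \<in> labels X n \<Longrightarrow> k > n \<Longrightarrow> Node k \<noteq> t \<and> cox_matrix X (Node k) t = 2"
  by (cases X) (auto split: if_splits)

lemma far_commute: "x \<in> lists (labels X n) \<Longrightarrow> k > n \<Longrightarrow> braid_eq (cox_matrix X) (Node k # x) (x @ [Node k])"
proof (rule braid_eq_commute_word, rule ballI)
  fix t assume "x \<in> lists (labels X n)" "k > n" "t \<in> set x"
  then show "Node k \<noteq> t \<and> cox_matrix X (Node k) t = 2"
    using far_labels[of t X n k] by (simp add: in_lists_conv_set)
qed

lemma far_commute1:
  "t \<in> labels X n \<Longrightarrow> k > n \<Longrightarrow> braid_eq (cox_matrix X) (u @ Node k # t # v) (u @ t # Node k # v)"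
  using far_labels[of t X n k] by (intro braid_eq_commute_letters) auto

lemma adjacent_braid:
  assumes "i \<ge> 1"
  shows "braid_eq (cox_matrix X) (u @ Node (Suc i) # Node i # Node (Suc i) # v) (u @ Node i # Node (Suc i) # Node i # v)"
  using assms by (intro braid_eq_3) auto

abbreviation braid :: "cox_type \<Rightarrow> label list \<Rightarrow> label list \<Rightarrow> bool" where
  "braid X \<equiv> braid_eq (cox_matrix X)"

declare braid_eq.trans [trans]

text \<open>The outer letters \<open>Node n\<close> commute with j and j', so the relation for the
  inner word lifts.\<close>

lemma twist_step_far:
  assumes n: "n \<ge> 1" and c: "coset_word X (Suc n) = Node n # c @ [Node n]"
    and IH: "braid X (c @ [j']) (j # c)" and j: "j \<in> labels X (n - 1)" "j' \<in> labels X (n - 1)"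
  shows "braid X (coset_word X (Suc n) @ [j']) (j # coset_word X (Suc n))"
proof -
  have "braid X (Node n # c @ [Node n, j']) (Node n # c @ [j', Node n])"
    using far_commute1[OF j(2), of n "Node n # c" "[]"] n by simp
  also have "braid X \<dots> (Node n # j # c @ [Node n])"
    using braid_eq_context[OF IH, of "[Node n]" "[Node n]"] by simp
  also have "braid X \<dots> (j # Node n # c @ [Node n])"
    using far_commute1[OF j(1), of n "[]" "c @ [Node n]"] n by simp
  finally show ?thesis by (simp add: c)
qed

text \<open>A braid relation of i and i + 1 at each end, with \<open>Node (Suc i)\<close> passing
  through \<open>c\<close> in between.\<close>

lemma twist_step_near:
  assumes i: "i \<ge> 1" and c: "coset_word X (Suc (Suc i)) = Node (Suc i) # Node i # c @ [Node i, Node (Suc i)]"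
    and cl: "c \<in> lists (labels X i)"
  shows "braid X (coset_word X (Suc (Suc i)) @ [Node i]) (Node i # coset_word X (Suc (Suc i)))"
proof -
  let ?k = "Suc i"
  have "braid X (Node ?k # Node i # c @ [Node i, Node ?k, Node i]) (Node ?k # Node i # c @ [Node ?k, Node i, Node ?k])"
    using braid_eq.sym[OF adjacent_braid[OF i, of X "Node ?k # Node i # c" "[]"]] by simp
  also have "braid X \<dots> (Node ?k # Node i # Node ?k # c @ [Node i, Node ?k])"
    using braid_eq_context[OF braid_eq.sym[OF far_commute[OF cl lessI]], of "[Node ?k, Node i]" "[Node i, Node ?k]"]
    by simp
  also have "braid X \<dots> (Node i # Node ?k # Node i # c @ [Node i, Node ?k])"
    using adjacent_braid[OF i, of X "[]" "c @ [Node i, Node ?k]"] by simp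
  finally show ?thesis by (simp add: c)
qed

lemma coset_word_twist_A:
  "1 \<le> i \<Longrightarrow> i < n \<Longrightarrow>
    braid TypeA (coset_word TypeA (Suc n) @ [Node (Suc i)]) (Node i # coset_word TypeA (Suc n))"
proof (induction n)
  case (Suc n)
  let ?c = "coset_word TypeA (Suc n)"
  have "braid TypeA (Node (Suc n) # ?c @ [Node (Suc i)]) (Node i # Node (Suc n) # ?c)"
  proof (cases "i < n")
    case True
    have "braid TypeA (Node (Suc n) # ?c @ [Node (Suc i)]) (Node (Suc n) # Node i # ?c)"
      using braid_eq_Cons[OF Suc.IH[OF Suc.prems(1) True]] by simp
    also have "braid TypeA \<dots> (Node i # Node (Suc n) # ?c)"
      using far_commute1[of "Node i" TypeA n "Suc n" "[]" ?c] True Suc.prems by simp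
    finally show ?thesis .
  next
    case False
    then have i: "i = n" "n \<ge> 1" using Suc.prems by auto
    then have c: "?c = Node n # coset_word TypeA n" by simp
    have "braid TypeA (Node (Suc n) # Node n # coset_word TypeA n @ [Node (Suc n)])
        (Node (Suc n) # Node n # Node (Suc n) # coset_word TypeA n)"
      using braid_eq_context[OF braid_eq.sym[OF far_commute[OF coset_word_lists lessI, of TypeA n]],
          of "[Node (Suc n), Node n]" "[]"]
      by simp
    also have "braid TypeA \<dots> (Node n # Node (Suc n) # Node n # coset_word TypeA n)"
      using adjacent_braid[OF i(2), of TypeA "[]" "coset_word TypeA n"] by simp
    finally show ?thesis using c i by simp
  qed
  then show ?case by simp
qed simp

lemma coset_word_twist_B:
  "j \<in> labels TypeB n \<Longrightarrow> braid TypeB (coset_word TypeB (Suc n) @ [j]) (j # coset_word TypeB (Suc n))"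
proof (induction n arbitrary: j)
  case (Suc n)
  show ?case
  proof (cases "n = 0")
    case True
    have "braid TypeB ([] @ alternating_word (Node 1) (Node 0) (cox_matrix TypeB (Node 1) (Node 0)) @ [])
        ([] @ alternating_word (Node 0) (Node 1) (cox_matrix TypeB (Node 1) (Node 0)) @ [])"
      by (rule braid_eq.rel) auto
    then show ?thesis using True Suc.prems by (simp add: numeral_eq_Suc)
  next
    case n: False
    show ?thesis
    proof (cases "j \<in> labels TypeB n")
      case True
      then show ?thesis
        using Suc.IH[OF True] n by (intro twist_step_far) auto
    next
      case False
      then have j: "j = Node n" using Suc.prems by auto
      show ?thesis
        unfolding j using n coset_word_lists[of TypeB n]
        by (intro twist_step_near[where c = "coset_word TypeB n"]) auto
    qed
  qed
qed simp

lemma twist_labels_D: "j \<in> labels TypeD n \<Longrightarrow> twist TypeD j \<in> labels TypeD n"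
  by (cases j) (auto split: if_splits)

lemma coset_word_twist_D:
  "j \<in> labels TypeD n \<Longrightarrow>
    braid TypeD (coset_word TypeD (Suc n) @ [twist TypeD j]) (j # coset_word TypeD (Suc n))"
proof (induction n arbitrary: j)
  case (Suc n)
  consider "n = 0" | "n = 1" | "n \<ge> 2" by linarith
  then show ?case
  proof cases
    case 1
    then show ?thesis using Suc.prems by simp
  next
    case 2
    \<comment> \<open>The branch vertex is the base case: conjugation by 2 1' 1 2 interchanges 1 and
      1'.\<close>
    let ?p = Prime1 and ?o = "Node 1" and ?t = "Node 2"
    have comm: "braid TypeD (u @ ?p # ?o # v) (u @ ?o # ?p # v)" for u v
      by (rule braid_eq_commute_letters) auto
    have b3: "braid TypeD (u @ ?t # ?p # ?t # v) (u @ ?p # ?t # ?p # v)"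
      "braid TypeD (u @ ?t # ?o # ?t # v) (u @ ?o # ?t # ?o # v)" for u v
      by (rule braid_eq_3; simp)+
    have "braid TypeD [?t, ?p, ?o, ?t, ?p] [?t, ?o, ?p, ?t, ?p]"
      using comm[of "[?t]" "[?t, ?p]"] by simp
    also have "braid TypeD \<dots> [?t, ?o, ?t, ?p, ?t]"
      using braid_eq.sym[OF b3(1)[of "[?t, ?o]" "[]"]] by simp
    also have "braid TypeD \<dots> [?o, ?t, ?o, ?p, ?t]"
      using b3(2)[of "[]" "[?p, ?t]"] by simp
    also have "braid TypeD \<dots> [?o, ?t, ?p, ?o, ?t]"
      using braid_eq.sym[OF comm[of "[?o, ?t]" "[?t]"]] by simp
    finally have one: "braid TypeD [?t, ?p, ?o, ?t, ?p] [?o, ?t, ?p, ?o, ?t]" .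
    have "braid TypeD [?t, ?p, ?o, ?t, ?o] [?t, ?p, ?t, ?o, ?t]"
      using braid_eq.sym[OF b3(2)[of "[?t, ?p]" "[]"]] by simp
    also have "braid TypeD \<dots> [?p, ?t, ?p, ?o, ?t]"
      using b3(1)[of "[]" "[?o, ?t]"] by simp
    finally have two: "braid TypeD [?t, ?p, ?o, ?t, ?o] [?p, ?t, ?p, ?o, ?t]" .
    have c: "coset_word TypeD (Suc (Suc n)) = [?t, ?p, ?o, ?t]" using 2 by (simp add: numeral_eq_Suc)
    have "j = ?p \<or> j = ?o" using Suc.prems 2 by (auto simp: numeral_eq_Suc less_Suc_eq)
    then show ?thesis using one two unfolding c by (elim disjE) simp_all
  next
    case 3
    show ?thesis
    proof (cases "j \<in> labels TypeD n")
      case True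
      then show ?thesis
        using Suc.IH[OF True] 3 twist_labels_D[OF True] by (intro twist_step_far) auto
    next
      case False
      then have j: "j = Node n" using Suc.prems 3 by auto
      have t: "twist TypeD j = Node n" using j 3 by simp
      show ?thesis
        unfolding t unfolding j using 3 coset_word_lists[of TypeD n]
        by (intro twist_step_near[where c = "coset_word TypeD n"]) auto
    qed
  qed
qed simp

lemma coset_word_twist:
  assumes "j \<in> labels X n"
  shows "braid X (coset_word X (Suc n) @ [twist X j]) (j # coset_word X (Suc n))"
proof (cases X)
  case TypeA
  then show ?thesis using assms coset_word_twist_A by auto
next
  case TypeB
  then show ?thesis using assms coset_word_twist_B[of j n] by (cases j) auto
next
  case TypeD
  then show ?thesis using assms coset_word_twist_D by simp
qed

lemma coset_word_twist_word:
  "w \<in> lists (labels X n) \<Longrightarrow> braid X (coset_word X (Suc n) @ map (twist X) w) (w @ coset_word X (Suc n))"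
proof (induction w)
  case (Cons j w)
  let ?c = "coset_word X (Suc n)"
  have "braid X (?c @ map (twist X) (j # w)) ((j # ?c) @ map (twist X) w)"
    using braid_eq_context[OF coset_word_twist, of j X n "[]" "map (twist X) w"] Cons.prems by simp
  also have "braid X \<dots> (j # w @ ?c)"
    using braid_eq_Cons[OF Cons.IH] Cons.prems by simp
  finally show ?case by simp
qed (simp add: braid_eq.refl)

text \<open>These are the two ways in which a generator becomes a right descent of the product of
  the smaller longest word and the coset word.\<close>

lemma coset_word_last:
  assumes "t \<in> labels X (Suc n)"
  shows "(\<exists>j\<in>labels X n. t = twist X j) \<or> (\<exists>w. braid X (coset_word X (Suc n)) (w @ [t]))"
proof (cases X)
  case TypeA
  then obtain i where i: "t = Node i" "1 \<le> i" "i \<le> n" using assms by auto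
  show ?thesis
  proof (cases "i = 1")
    case True
    have "\<exists>w. coset_word TypeA (Suc n) = w @ [Node 1]"
      using i(2,3)
    proof (induction n)
      case (Suc n)
      then show ?case by (cases "n = 0") (auto simp: True)
    qed simp
    then show ?thesis using TypeA i True braid_eq.refl by metis
  next
    case False
    then have "t = twist X (Node (i - 1))" "Node (i - 1) \<in> labels X n"
      using i TypeA by (auto intro!: imageI)
    then show ?thesis by blast
  qed
next
  case TypeB
  show ?thesis
  proof (cases "t = Node n")
    case True
    have "\<exists>w. coset_word TypeB (Suc n) = w @ [Node n]" by (cases "n = 0") auto
    then show ?thesis using TypeB True braid_eq.refl by metis
  next
    case False
    then have "t \<in> labels X n" "t = twist X t" using assms TypeB by auto
    then show ?thesis by blast
  qed
next
  case TypeD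
  consider "n = 0" | "n = 1" | "n \<ge> 2" by linarith
  then show ?thesis
  proof cases
    case 1
    then show ?thesis using assms TypeD by simp
  next
    case 2
    have "braid TypeD ([] @ Prime1 # Node 1 # []) ([] @ Node 1 # Prime1 # [])"
      by (rule braid_eq_commute_letters) auto
    then have "braid TypeD (coset_word TypeD (Suc n)) ([Node 1] @ [Prime1])"
      "braid TypeD (coset_word TypeD (Suc n)) ([Prime1] @ [Node 1])"
      using 2 by (simp_all add: braid_eq.refl)
    moreover have "t = Node 1 \<or> t = Prime1" using assms TypeD 2 by (auto simp: numeral_eq_Suc less_Suc_eq)
    ultimately show ?thesis using TypeD by blast
  next
    case 3
    show ?thesis
    proof (cases "t = Node n")
      case True
      have "coset_word TypeD (Suc n) = (Node n # coset_word TypeD n) @ [Node n]" using 3 by simp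
      then show ?thesis using TypeD True braid_eq.refl by metis
    next
      case False
      then have t: "t \<in> labels X n" using assms TypeD 3 by auto
      then have "twist X t \<in> labels X n" using twist_labels_D TypeD by simp
      moreover have "t = twist X (twist X t)" using TypeD by (cases t) auto
      ultimately show ?thesis by blast
    qed
  qed
qed

section \<open>Longest elements as products of coset words\<close>

fun longest_word :: "cox_type \<Rightarrow> nat \<Rightarrow> label list" where
  "longest_word X 0 = []"
| "longest_word X (Suc n) = longest_word X n @ coset_word X (Suc n)"

lemma labels_0: "labels X 0 = {}"
  by (cases X) auto

lemma parabolic_labels: "k \<le> n \<Longrightarrow> parabolic (labels X n) (cox_matrix X) (labels X k)"
  by (simp add: parabolic_def parabolic_axioms_def coxeter_words_labels labels_mono)

text \<open>Let w = u d. If t is the twist of j, then w t = u j d, and u j is shorter than u because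
  u is longest; otherwise a word for d ends in t.\<close>

lemma longest_longest_word:
  "coxeter_words.longest (labels X n) (cox_matrix X) (longest_word X n)"
proof (induction n)
  case 0
  interpret coxeter_words "labels X 0" "cox_matrix X" by (rule coxeter_words_labels)
  show ?case
    unfolding longest_def longest_word.simps
  proof (intro conjI ballI)
    fix s assume "s \<in> labels X 0"
    then show "len (s # []) < len []" using labels_0 by blast
  qed (rule reduced_Nil)
next
  case (Suc n)
  interpret C: parabolic "labels X (Suc n)" "cox_matrix X" "labels X n"
    by (rule parabolic_labels) simp
  let ?u = "longest_word X n" and ?d = "coset_word X (Suc n)"
  have u: "C.P.longest ?u" by (rule Suc.IH)
  have ur: "C.P.reduced ?u" "?u \<in> lists (labels X n)"
    using u C.P.longest_lists by (auto simp: C.P.longest_def)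
  have ul: "?u \<in> lists (labels X (Suc n))" using ur(2) by (rule C.lists_subset)
  have dl: "?d \<in> lists (labels X (Suc n))" by (rule coset_word_lists)
  have red: "C.reduced (?u @ ?d)"
    using C.minimal_coset_reduced[OF C.subset dl _ ur(1)] coset_word_minimal[of "Suc n" _ X] by simp
  have "C.longest (?u @ ?d)"
  proof (rule C.longestI_right[OF red])
    fix t assume t: "t \<in> labels X (Suc n)"
    from coset_word_last[OF t] consider (twist) j where "j \<in> labels X n" "t = twist X j"
      | (last) w where "braid X ?d (w @ [t])" by blast
    then have "C.len ((?u @ ?d) @ [t]) < length (?u @ ?d)"
    proof cases
      case twist
      have jl: "?u @ [j] \<in> lists (labels X n)" using ur(2) twist(1) by simp
      have "C.eq (?d @ [t]) (j # ?d)"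
        using coset_word_twist[OF twist(1)] dl t twist(2) by (intro C.braid_eq_imp_eq) auto
      then have "C.eq (?u @ (?d @ [t])) (?u @ (j # ?d))" using ul by (rule C.eq_append_left)
      then have "C.len ((?u @ ?d) @ [t]) = C.len ((?u @ [j]) @ ?d)" using C.len_cong by simp
      also have "\<dots> \<le> C.len (?u @ [j]) + C.len ?d"
        using C.lists_subset[OF jl] dl by (rule C.len_append)
      also have "C.len (?u @ [j]) \<le> C.P.len (?u @ [j])"
      proof -
        obtain y where y: "C.P.eq (?u @ [j]) y" "length y = C.P.len (?u @ [j])"
          using C.P.ex_reduced[OF jl] by blast
        then show ?thesis using C.len_le[OF cox_eq_mono[OF y(1) C.subset]] by simp
      qed
      also have "C.P.len (?u @ [j]) < length ?u"
        using C.P.len_le_longest[OF u jl] C.P.len_snoc_cases[OF twist(1) ur(2)] ur(1)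
        by (auto simp: C.P.reduced_def)
      also have "C.len ?d \<le> length ?d" using dl by (rule C.len_le_length)
      finally show ?thesis by simp
    next
      case last
      have w: "w \<in> lists (labels X (Suc n))" using braid_eq_lists[OF last dl] by simp
      have "C.eq ?d (w @ [t])" using last dl by (rule C.braid_eq_imp_eq)
      then have "C.eq w (?d @ [t])" using C.eq_snoc_swap[of w t ?d] cox_eq.sym by blast
      then have "C.eq (?u @ (?d @ [t])) (?u @ w)" using ul C.eq_append_left cox_eq.sym by blast
      then have "C.len (?u @ (?d @ [t])) \<le> length (?u @ w)" by (rule C.len_le)
      then show ?thesis using braid_eq_length[OF last] by simp
    qed
    then show "C.len ((?u @ ?d) @ [t]) < C.len (?u @ ?d)" using red by (simp add: C.reduced_def)
  qed
  then show ?case by simp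
qed

subsection \<open>Jucys-Murphy elements\<close>

definition jm_word :: "cox_type \<Rightarrow> nat \<Rightarrow> label list" where
  "jm_word X n = coset_word X n @ rev (coset_word X n)"

lemma jm_word_lists: "jm_word X n \<in> lists (labels X n)"
  using coset_word_lists by (simp add: jm_word_def)

text \<open>The reversed twist relation moves j through \<open>rev ?c\<close>, where it becomes its
  twist; the relation itself moves it through \<open>?c\<close> and restores j.\<close>

lemma jm_word_commute:
  assumes "j \<in> labels X n"
  shows "braid X (jm_word X (Suc n) @ [j]) (j # jm_word X (Suc n))"
proof -
  let ?c = "coset_word X (Suc n)"
  have tw: "braid X (?c @ [twist X j]) (j # ?c)" using assms by (rule coset_word_twist)
  have "braid X (rev (j # ?c)) (rev (?c @ [twist X j]))" using braid_eq.sym[OF tw] by (rule braid_eq_rev)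
  then have "braid X (?c @ rev ?c @ [j]) (?c @ twist X j # rev ?c)"
    using braid_eq_context[of "cox_matrix X" "rev ?c @ [j]" "twist X j # rev ?c" ?c "[]"] by simp
  also have "braid X \<dots> (j # ?c @ rev ?c)"
    using braid_eq_context[OF tw, of "[]" "rev ?c"] by simp
  finally show ?thesis by (simp add: jm_word_def)
qed

lemma jm_word_commute_word:
  "w \<in> lists (labels X n) \<Longrightarrow> braid X (jm_word X (Suc n) @ w) (w @ jm_word X (Suc n))"
proof (induction w)
  case (Cons j w)
  have "braid X (jm_word X (Suc n) @ j # w) (j # jm_word X (Suc n) @ w)"
    using braid_eq_context[OF jm_word_commute, of j X n "[]" w] Cons.prems by simp
  also have "braid X \<dots> (j # w @ jm_word X (Suc n))"
    using braid_eq_Cons[OF Cons.IH] Cons.prems by simp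
  finally show ?case by simp
qed (simp add: braid_eq.refl)

text \<open>The twist affects only the core 1' 1 of the word, and these two letters commute.\<close>

lemma map_twist_coset_word_D: "braid TypeD (map (twist TypeD) (coset_word TypeD n)) (coset_word TypeD n)"
proof (induction n)
  case (Suc n)
  consider "n = 0" | "n = 1" | "n \<ge> 2" by linarith
  then show ?case
  proof cases
    case 2
    have "braid TypeD ([] @ Node 1 # Prime1 # []) ([] @ Prime1 # Node 1 # [])"
      by (rule braid_eq_commute_letters) auto
    then show ?thesis using 2 by simp
  next
    case 3
    then show ?thesis using braid_eq_context[OF Suc.IH, of "[Node n]" "[Node n]"] by simp
  qed (simp add: braid_eq.refl)
qed (simp add: braid_eq.refl)

text \<open>Consequently, in types B and D, t_d for the coset word d is a square root of the
  Jucys-Murphy element.\<close>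

lemma rev_coset_word: "X \<noteq> TypeA \<Longrightarrow> braid X (rev (coset_word X n)) (coset_word X n)"
proof (induction n)
  case (Suc n)
  have step: ?case if "coset_word X (Suc n) = Node n # coset_word X n @ [Node n]"
    using braid_eq_context[OF Suc.IH[OF Suc.prems], of "[Node n]" "[Node n]"] that by simp
  show ?case
  proof (cases X)
    case TypeA
    then show ?thesis using Suc.prems by simp
  next
    case TypeB
    then show ?thesis using step by (cases "n = 0") (auto simp: braid_eq.refl)
  next
    case TypeD
    have "braid TypeD ([] @ Node 1 # Prime1 # []) ([] @ Prime1 # Node 1 # [])"
      by (rule braid_eq_commute_letters) auto
    then show ?thesis using step TypeD by (cases "n = 0"; cases "n = 1") (auto simp: braid_eq.refl)
  qed
qed (simp add: braid_eq.refl)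

text \<open>Passing through the larger coset word twists the smaller one, and the twist fixes it up
  to braid moves.\<close>

lemma coset_word_commute:
  assumes "X \<noteq> TypeA"
  shows "braid X (coset_word X (Suc n) @ coset_word X n) (coset_word X n @ coset_word X (Suc n))"
proof -
  have "braid X (map (twist X) (coset_word X n)) (coset_word X n)"
  proof (cases X)
    case TypeB
    have "twist TypeB = id"
    proof
      fix s show "twist TypeB s = id s" by (cases s) auto
    qed
    then show ?thesis using TypeB by (simp add: braid_eq.refl)
  qed (use assms map_twist_coset_word_D in auto)
  then have "braid X (coset_word X (Suc n) @ coset_word X n) (coset_word X (Suc n) @ map (twist X) (coset_word X n))"
    by (rule braid_eq_append[OF braid_eq.refl braid_eq.sym])
  also have "braid X \<dots> (coset_word X n @ coset_word X (Suc n))"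
    using coset_word_lists by (rule coset_word_twist_word)
  finally show ?thesis .
qed

lemma (in monoid) nat_pow_two: "x \<in> carrier G \<Longrightarrow> x [^] (2::nat) = x \<otimes> x"
  by (simp add: numeral_2_eq_2)

lemma bbS_eq:
  "bbS X n = inv\<^bsub>Hecke X n\<^esub> (coxeter_words.tw (labels X n) (cox_matrix X) (longest_word X n @ longest_word X n))"
proof -
  interpret C: coxeter_words "labels X n" "cox_matrix X" by (rule coxeter_words_labels)
  let ?w = "longest_word X n"
  have w: "C.longest ?w" by (rule longest_longest_word)
  have l: "?w \<in> lists (labels X n)" using w by (rule C.longest_lists)
  have "C.reduced ?w" using w by (simp add: C.longest_def)
  then have "hecke_T (labels X n) (cox_matrix X) (longest_element (labels X n) (cox_matrix X)) = C.tw ?w"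
    using C.longest_element_eq[OF w] C.hecke_T_cls by simp
  then show ?thesis
    using l by (simp add: bbS_def C.H.nat_pow_two C.tw_append)
qed

text \<open>Let w = u d be the longest words and J = d d^-1 as a word. Longest words may be
  reversed, so t_w^2 = t_u t_J t_u; J commutes with u, and cancelling t_u^2 leaves t_J.\<close>

lemma jucys_murphy_eq:
  assumes "i \<ge> 1"
  shows "jucys_murphy X i = coxeter_words.tw (labels X i) (cox_matrix X) (jm_word X i)"
proof (cases "i \<ge> 2")
  case True
  then obtain n where i: "i = Suc n" by (cases i) auto
  interpret C: parabolic "labels X (Suc n)" "cox_matrix X" "labels X n"
    by (rule parabolic_labels) simp
  let ?u = "longest_word X n" and ?d = "coset_word X (Suc n)"
  let ?w = "longest_word X (Suc n)"
  have w: "C.longest ?w" and u: "C.P.longest ?u" by (rule longest_longest_word)+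
  have l: "?w \<in> lists (labels X (Suc n))" "?u \<in> lists (labels X n)" "?d \<in> lists (labels X (Suc n))"
    using C.longest_lists[OF w] C.P.longest_lists[OF u] coset_word_lists by blast+
  have ul: "?u \<in> lists (labels X (Suc n))" using C.lists_subset[OF l(2)] .
  have jl: "jm_word X (Suc n) \<in> lists (labels X (Suc n))" by (rule jm_word_lists)
  have wr: "C.reduced ?w" and ur: "C.P.reduced ?u" using w u by (simp_all add: C.longest_def C.P.longest_def)
  have rev_w: "C.tw (rev ?w) = C.tw ?w"
    using C.tw_eq[OF _ wr C.longest_rev[OF w]] C.reduced_rev wr by blast
  have "C.P.tw (rev ?u) = C.P.tw ?u"
    using C.P.tw_eq[OF _ ur C.P.longest_rev[OF u]] C.P.reduced_rev ur by blast
  then have rev_u: "C.tw (rev ?u) = C.tw ?u"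
    using C.inc_tw[of "rev ?u"] C.inc_tw[of ?u] l by simp
  have "C.tw (?w @ ?w) = C.tw (?w @ rev ?w)"
    using l rev_w by (simp add: C.tw_append del: longest_word.simps)
  also have "\<dots> = C.tw ?u \<otimes>\<^bsub>C.H\<^esub> (C.tw (jm_word X (Suc n)) \<otimes>\<^bsub>C.H\<^esub> C.tw (rev ?u))"
  proof -
    have "?w @ rev ?w = ?u @ jm_word X (Suc n) @ rev ?u" by (simp add: jm_word_def)
    then show ?thesis using ul jl by (simp add: C.tw_append del: longest_word.simps)
  qed
  also have "\<dots> = C.tw (?u @ jm_word X (Suc n) @ ?u)"
    using ul jl by (simp add: C.tw_append rev_u)
  also have "\<dots> = C.tw (jm_word X (Suc n) @ ?u @ ?u)"
  proof (rule C.tw_braid_eq)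
    show "braid X (?u @ jm_word X (Suc n) @ ?u) (jm_word X (Suc n) @ ?u @ ?u)"
      using braid_eq_context[OF braid_eq.sym[OF jm_word_commute_word[OF l(2)]], of "[]" ?u] by simp
  qed (use ul jl in simp)
  also have "\<dots> = C.tw (jm_word X (Suc n)) \<otimes>\<^bsub>C.H\<^esub> C.tw (?u @ ?u)"
    using ul jl by (simp add: C.tw_append)
  finally have ww: "C.tw (?w @ ?w) = C.tw (jm_word X (Suc n)) \<otimes>\<^bsub>C.H\<^esub> C.tw (?u @ ?u)" .
  have "inv\<^bsub>C.H\<^esub> (bbS X (Suc n)) = C.tw (?w @ ?w)"
    using C.tw_Units[of "?w @ ?w"] l by (simp add: bbS_eq del: longest_word.simps)
  moreover have "incl X (Suc n) (bbS X n) = C.tinv (?u @ ?u)"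
    using C.inc_tinv[of "?u @ ?u"] l by (simp add: bbS_eq)
  moreover have "C.tw (jm_word X (Suc n)) \<otimes>\<^bsub>C.H\<^esub> C.tw (?u @ ?u) \<otimes>\<^bsub>C.H\<^esub> C.tinv (?u @ ?u) = C.tw (jm_word X (Suc n))"
    using ul jl C.tinv_right[of "?u @ ?u"] by (simp add: C.H.m_assoc)
  ultimately show ?thesis using True ww i by (simp add: jucys_murphy_def)
next
  case False
  then have i: "i = 1" using assms by simp
  interpret C: coxeter_words "labels X 1" "cox_matrix X" by (rule coxeter_words_labels)
  show ?thesis
  proof (cases "X = TypeB")
    case True
    then have g: "[Node 0] \<in> lists (labels X 1)" and J: "jm_word X 1 = [Node 0] @ [Node 0]"
      and "jucys_murphy X 1 = gen X 1 (Node 0) [^]\<^bsub>Hecke X 1\<^esub> (2::nat)"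
      by (simp_all add: jm_word_def jucys_murphy_def)
    then have "jucys_murphy X 1 = C.tw [Node 0] \<otimes>\<^bsub>C.H\<^esub> C.tw [Node 0]"
      by (simp only: C.hecke_gen_eq C.H.nat_pow_two[OF C.tw_closed[OF g]])
    then show ?thesis unfolding i J C.tw_append[OF g g] .
  next
    case False
    then have "jm_word X 1 = []" by (cases X) (simp_all add: jm_word_def)
    then show ?thesis using False i C.tw_Nil by (simp add: jucys_murphy_def)
  qed
qed

section \<open>The functional of the theorem as a product trace\<close>

abbreviation jm_trace :: "cox_type \<Rightarrow> nat \<Rightarrow> hecke_elt \<Rightarrow> qva" where
  "jm_trace X n \<equiv> coxeter_words.prod_trace (labels X n) (cox_matrix X) (map (jm_word X) [1..<Suc n])"

lemma jm_words_lists: "set (map (jm_word X) [1..<Suc n]) \<subseteq> lists (labels X n)"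
proof
  fix w assume "w \<in> set (map (jm_word X) [1..<Suc n])"
  then obtain i where i: "i \<in> set [1..<Suc n]" "w = jm_word X i" unfolding set_map by blast
  then have "i \<le> n" by auto
  then show "w \<in> lists (labels X n)"
    using jm_word_lists[of X i] lists_mono[OF labels_mono[of i n X]] unfolding i(2) by blast
qed

lemma tr_zeta_eq:
  assumes h: "h \<in> carrier (Hecke X n)"
  shows "tr_zeta X n h = jm_trace X n h"
proof -
  interpret C: coxeter_words "labels X n" "cox_matrix X" by (rule coxeter_words_labels)
  have J: "incl X n (jucys_murphy X i) = C.tw (jm_word X i)" if "i \<in> set [1..<Suc n]" for i
  proof -
    interpret P: parabolic "labels X n" "cox_matrix X" "labels X i"
      using that by (intro parabolic_labels) auto
    have "1 \<le> i" using that by auto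
    then show ?thesis using P.inc_tw[OF jm_word_lists] by (simp only: jucys_murphy_eq)
  qed
  have "zeta X n = foldr (\<lambda>i z. (\<one>\<^bsub>C.HR\<^esub> \<oplus>\<^bsub>C.HR\<^esub> tens X n (C.tw (jm_word X i)) (inverse var_a)) \<otimes>\<^bsub>C.HR\<^esub> z)
      [1..<Suc n] \<one>\<^bsub>C.HR\<^esub>"
    unfolding zeta_def by (rule foldr_cong) (simp_all only: J)
  then show ?thesis
    using C.hecke_R_pairing_prod[OF jm_words_lists h] by (simp add: tr_zeta_def foldr_map o_def)
qed

section \<open>Symmetry of the trace under each generator\<close>

context
  fixes X :: cox_type and n :: nat
begin

interpretation C: coxeter_words "labels X n" "cox_matrix X" by (rule coxeter_words_labels)

lemma tw_commute_braid:
  assumes "s \<in> labels X n" "w \<in> lists (labels X n)" "braid X (s # w) (w @ [s])"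
  shows "C.tw [s] \<otimes>\<^bsub>C.H\<^esub> C.tw w = C.tw w \<otimes>\<^bsub>C.H\<^esub> C.tw [s]"
  using C.tw_braid_eq[OF assms(3)] C.tw_append[of "[s]" w] C.tw_append[of w "[s]"] assms(1,2) by simp

lemma gen_symmetric_append:
  assumes s: "s \<in> labels X n" and "\<And>i. i \<in> set is \<Longrightarrow> i \<le> n \<and> braid X (s # jm_word X i) (jm_word X i @ [s])"
    and "C.gen_symmetric s ys"
  shows "C.gen_symmetric s (map (jm_word X) is @ ys)"
  using assms(2)
proof (induction "is")
  case Nil
  then show ?case using assms(3) by simp
next
  case (Cons i js)
  have i: "i \<le> n" "braid X (s # jm_word X i) (jm_word X i @ [s])" using Cons.prems[of i] by auto
  have l: "jm_word X i \<in> lists (labels X n)"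
    using jm_word_lists[of X i] lists_mono[OF labels_mono[OF i(1), of X]] by blast
  show ?case
    using C.gen_symmetric_Cons[OF s l tw_commute_braid[OF s l i(2)]] Cons by simp
qed

lemma jm_word_braid_large:
  assumes "s \<in> labels X (i - 1)" "i \<ge> 1"
  shows "braid X (s # jm_word X i) (jm_word X i @ [s])"
  using braid_eq.sym[OF jm_word_commute[OF assms(1)]] assms(2) by simp

lemma gen_symmetric_pair:
  assumes k: "1 \<le> k" "k < n" "X = TypeD \<Longrightarrow> k \<ge> 2"
    and xs: "set xs \<subseteq> lists (labels X n)" "C.gen_symmetric (Node k) xs"
  shows "C.gen_symmetric (Node k) (jm_word X k # jm_word X (Suc k) # xs)"
proof -
  have s: "Node k \<in> labels X n" using k by (cases X) auto
  have sub: "labels X k \<subseteq> labels X n" "labels X (Suc k) \<subseteq> labels X n" using k labels_mono by auto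
  have lists: "lists (labels X k) \<subseteq> lists (labels X n)" "lists (labels X (Suc k)) \<subseteq> lists (labels X n)"
    using sub lists_mono by blast+
  have x: "jm_word X k \<in> lists (labels X n)" and y: "jm_word X (Suc k) \<in> lists (labels X n)"
    using jm_word_lists lists by blast+
  let ?t = "C.tw [Node k]" and ?x = "C.tw (jm_word X k)" and ?y = "C.tw (jm_word X (Suc k))"
  have tl: "[Node k] \<in> lists (labels X n)" using s by simp
  have xy: "?x \<otimes>\<^bsub>C.H\<^esub> ?y = ?y \<otimes>\<^bsub>C.H\<^esub> ?x"
    using C.tw_braid_eq[OF jm_word_commute_word[OF jm_word_lists[of X k]]] x y by (simp add: C.tw_append)
  have "?t \<otimes>\<^bsub>C.H\<^esub> (?x \<oplus>\<^bsub>C.H\<^esub> ?y) = (?x \<oplus>\<^bsub>C.H\<^esub> ?y) \<otimes>\<^bsub>C.H\<^esub> ?t \<and>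
      ?t \<otimes>\<^bsub>C.H\<^esub> (?x \<otimes>\<^bsub>C.H\<^esub> ?y) = (?x \<otimes>\<^bsub>C.H\<^esub> ?y) \<otimes>\<^bsub>C.H\<^esub> ?t"
  proof (cases "X = TypeA")
    case True
    have "jm_word X (Suc k) = [Node k] @ jm_word X k @ [Node k]"
      using True k by (simp add: jm_word_def)
    then have "?y = ?t \<otimes>\<^bsub>C.H\<^esub> (?x \<otimes>\<^bsub>C.H\<^esub> ?t)" using x tl by (simp add: C.tw_append del: append_Cons)
    then show ?thesis using C.conj_gen_commute[OF s _ _ xy] x by simp
  next
    case False
    let ?d = "coset_word X k" and ?e = "coset_word X (Suc k)"
    have d: "?d \<in> lists (labels X n)" and e: "?e \<in> lists (labels X n)"
      using coset_word_lists lists by blast+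
    let ?L = "C.tw ?d" and ?M = "C.tw ?e"
    have rev: "C.tw (rev ?d) = ?L" "C.tw (rev ?e) = ?M"
      using C.tw_braid_eq[OF rev_coset_word[OF False]] d e by simp_all
    have xL: "?x = ?L \<otimes>\<^bsub>C.H\<^esub> ?L" "?y = ?M \<otimes>\<^bsub>C.H\<^esub> ?M"
      using d e rev by (simp_all add: jm_word_def C.tw_append del: coset_word.simps)
    \<comment> \<open>In type D this fails for k = 1, where the coset word of index 2 is 1' 1; hence
      the hypothesis on k.\<close>
    have "?e = [Node k] @ ?d @ [Node k]"
      using False k by (cases X) auto
    then have M: "?M = ?t \<otimes>\<^bsub>C.H\<^esub> (?L \<otimes>\<^bsub>C.H\<^esub> ?t)" using d tl by (simp add: C.tw_append del: append_Cons)
    have LM: "?L \<otimes>\<^bsub>C.H\<^esub> ?M = ?M \<otimes>\<^bsub>C.H\<^esub> ?L"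
      using C.tw_braid_eq[OF coset_word_commute[OF False, of k]] d e by (simp add: C.tw_append del: coset_word.simps)
    have Lc: "?L \<in> carrier C.H" "?M \<in> carrier C.H" "?t \<in> carrier C.H" using d e tl by simp_all
    show ?thesis
      unfolding xL
      using C.square_commute[OF Lc(3,1,2) LM] C.conj_gen_commute[OF s Lc(1) M LM] by blast
  qed
  then show ?thesis using C.gen_symmetric_Cons_Cons[OF s x y xs(1) _ _ xy xs(2)] by blast
qed

text \<open>Meant for the labels 0 in type B and 1, 1' in type D, which commute with each factor
  separately.\<close>

lemma gen_symmetric_special:
  assumes s: "s \<in> labels X n" and all: "\<And>i. 1 \<le> i \<Longrightarrow> i \<le> n \<Longrightarrow> braid X (s # jm_word X i) (jm_word X i @ [s])"
  shows "C.gen_symmetric s (map (jm_word X) [1..<Suc n])"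
proof -
  have "C.gen_symmetric s (map (jm_word X) [1..<Suc n] @ [])"
  proof (rule gen_symmetric_append[OF s])
    fix i assume "i \<in> set [1..<Suc n]"
    then have "1 \<le> i" "i \<le> n" by auto
    then show "i \<le> n \<and> braid X (s # jm_word X i) (jm_word X i @ [s])" using all by blast
  qed (rule C.gen_symmetric_Nil[OF s])
  then show ?thesis by simp
qed

text \<open>Factors of index below k use only labels that commute with k. For an index i above k +
  1, the label k belongs to index i - 1, so \<open>jm_word_commute\<close> applies. Only the factors
  k and k + 1 have to be treated as a pair.\<close>

lemma gen_symmetric_Node:
  assumes k: "1 \<le> k" "k < n" "X = TypeD \<Longrightarrow> k \<ge> 2"
  shows "C.gen_symmetric (Node k) (map (jm_word X) [1..<Suc n])"
proof -
  have s: "Node k \<in> labels X n" using k by (cases X) auto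
  have split: "[1..<Suc n] = [1..<k] @ [k, Suc k] @ [Suc (Suc k)..<Suc n]"
  proof -
    have "[1..<Suc n] = [1..<k] @ [k..<Suc n]" using k upt_add_eq_append[of 1 k "Suc n - k"] by simp
    moreover have "[k..<Suc n] = k # Suc k # [Suc (Suc k)..<Suc n]"
      using k by (simp add: upt_conv_Cons)
    ultimately show ?thesis by simp
  qed
  have tail: "C.gen_symmetric (Node k) (map (jm_word X) [Suc (Suc k)..<Suc n])"
  proof -
    have "C.gen_symmetric (Node k) (map (jm_word X) [Suc (Suc k)..<Suc n] @ [])"
    proof (rule gen_symmetric_append[OF s])
      fix i assume "i \<in> set [Suc (Suc k)..<Suc n]"
      then have i: "Suc (Suc k) \<le> i" "i \<le> n" by auto
      then have "Node k \<in> labels X (i - 1)" using k by (cases X) auto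
      then show "i \<le> n \<and> braid X (Node k # jm_word X i) (jm_word X i @ [Node k])"
        using jm_word_braid_large i by simp
    qed (rule C.gen_symmetric_Nil[OF s])
    then show ?thesis by simp
  qed
  have tail_lists: "set (map (jm_word X) [Suc (Suc k)..<Suc n]) \<subseteq> lists (labels X n)"
    using jm_words_lists[of X n] unfolding split by auto
  have "C.gen_symmetric (Node k) (map (jm_word X) [1..<k] @ jm_word X k # jm_word X (Suc k) # map (jm_word X) [Suc (Suc k)..<Suc n])"
  proof (rule gen_symmetric_append[OF s])
    fix i assume "i \<in> set [1..<k]"
    then have i: "i < k" by simp
    then show "i \<le> n \<and> braid X (Node k # jm_word X i) (jm_word X i @ [Node k])"
      using far_commute[OF jm_word_lists i] k by simp
  qed (rule gen_symmetric_pair[OF k tail_lists tail])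
  then show ?thesis unfolding split by simp
qed

lemma gen_symmetric_jm:
  assumes s: "s \<in> labels X n"
  shows "C.gen_symmetric s (map (jm_word X) [1..<Suc n])"
proof -
  consider (regular) k where "s = Node k" "1 \<le> k" "k < n" "X = TypeD \<Longrightarrow> k \<ge> 2"
    | (zero) "X = TypeB" "s = Node 0" | (fork) "X = TypeD" "n \<ge> 2" "s = Node 1 \<or> s = Prime1"
  proof (cases s)
    case (Node k)
    then have "k < n" "k \<ge> 1 \<or> X = TypeB" "X = TypeD \<longrightarrow> n \<ge> 2" using s by (cases X; auto split: if_splits)+
    then show ?thesis using that Node by (cases "k = 0"; cases "k = 1"; cases "X = TypeD") auto
  next
    case Prime1
    then have "X = TypeD" "n \<ge> 2" using s by (cases X; auto split: if_splits)+
    then show ?thesis using that Prime1 by blast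
  qed
  then show ?thesis
  proof cases
    case regular
    then show ?thesis using gen_symmetric_Node by blast
  next
    case zero
    show ?thesis
    proof (rule gen_symmetric_special[OF s])
      fix i assume i: "1 \<le> i" "i \<le> n"
      show "braid X (s # jm_word X i) (jm_word X i @ [s])"
      proof (cases "i = 1")
        case True
        then show ?thesis using zero by (simp add: jm_word_def braid_eq.refl)
      next
        case False
        then show ?thesis using zero i by (intro jm_word_braid_large) auto
      qed
    qed
  next
    case fork
    show ?thesis
    proof (rule gen_symmetric_special[OF s])
      fix i assume i: "1 \<le> i" "i \<le> n"
      consider "i = 1" | "i = 2" | "i \<ge> 3" using i by linarith
      then show "braid X (s # jm_word X i) (jm_word X i @ [s])"
      proof cases
        case 1
        then show ?thesis using fork by (simp add: jm_word_def braid_eq.refl)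
      next
        case 2
        \<comment> \<open>The label set of index 1 is empty in type D, so
          \<open>jm_word_braid_large\<close> does not reach index 2.\<close>
        let ?p = "Prime1" and ?o = "Node 1"
        have c: "braid X (u @ ?p # ?o # v) (u @ ?o # ?p # v)" for u v
          by (rule braid_eq_commute_letters) auto
        have J: "jm_word X i = [?p, ?o, ?o, ?p]" using 2 fork by (simp add: jm_word_def numeral_eq_Suc)
        have "braid X [?o, ?p, ?o, ?o, ?p] [?p, ?o, ?o, ?o, ?p]"
          using braid_eq.sym[OF c[of "[]" "[?o, ?o, ?p]"]] by simp
        also have "braid X \<dots> [?p, ?o, ?o, ?p, ?o]"
          using braid_eq.sym[OF c[of "[?p, ?o, ?o]" "[]"]] by simp
        finally have o: "braid X [?o, ?p, ?o, ?o, ?p] [?p, ?o, ?o, ?p, ?o]" .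
        have "braid X [?p, ?p, ?o, ?o, ?p] [?p, ?o, ?p, ?o, ?p]"
          using c[of "[?p]" "[?o, ?p]"] by simp
        also have "braid X \<dots> [?p, ?o, ?o, ?p, ?p]"
          using c[of "[?p, ?o]" "[?p]"] by simp
        finally have p: "braid X [?p, ?p, ?o, ?o, ?p] [?p, ?o, ?o, ?p, ?p]" .
        show ?thesis unfolding J using fork(3) o p by (elim disjE) simp_all
      next
        case 3
        then have "s \<in> labels X (i - 1)" using fork by auto
        then show ?thesis using i by (intro jm_word_braid_large) auto
      qed
    qed
  qed
qed

lemma jm_trace_mult:
  "h \<in> carrier C.H \<Longrightarrow> h' \<in> carrier C.H \<Longrightarrow> jm_trace X n (h \<otimes>\<^bsub>C.H\<^esub> h') = jm_trace X n (h' \<otimes>\<^bsub>C.H\<^esub> h)"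
  by (rule C.prod_trace_mult[OF jm_words_lists gen_symmetric_jm])

lemma tr_zeta_linear: "A_linear X n (tr_zeta X n)"
  unfolding A_linear_def
proof (intro conjI ballI allI)
  fix h h' c assume h: "h \<in> carrier C.H"
  show "tr_zeta X n (C.sc c h) = A_to_R c * tr_zeta X n h"
    by (simp only: tr_zeta_eq[OF h] tr_zeta_eq[OF C.sc_closed[OF h]] C.prod_trace_sc[OF jm_words_lists h])
  assume h': "h' \<in> carrier C.H"
  show "tr_zeta X n (h \<oplus>\<^bsub>C.H\<^esub> h') = tr_zeta X n h + tr_zeta X n h'"
    by (simp only: tr_zeta_eq[OF h] tr_zeta_eq[OF h'] tr_zeta_eq[OF C.H.a_closed[OF h h']]
        C.prod_trace_add[OF jm_words_lists h h'])
qed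

end

lemma jm_trace_markov:
  assumes n: "n > first_index X" and h: "h \<in> carrier (Hecke X (n - 1))"
  shows "jm_trace X n (incl X n h) = (1 + var_a) * jm_trace X (n - 1) h"
    "jm_trace X n (incl X n h \<otimes>\<^bsub>Hecke X n\<^esub> gen X n (Node (n - 1))) = A_to_R var_q * jm_trace X (n - 1) h"
proof -
  obtain k where k: "n = Suc k" "k \<ge> first_index X" using n by (cases n) auto
  have k1: "k \<ge> 1" "X = TypeD \<Longrightarrow> k \<ge> 2" using k(2) by (auto simp: first_index_def split: if_splits)
  interpret C: parabolic "labels X (Suc k)" "cox_matrix X" "labels X k"
    by (rule parabolic_labels) simp
  have s: "Node k \<notin> labels X k" by (cases X) auto
  \<comment> \<open>The first letter is the generator of the second Markov property, as the
    cancellation there requires; in type D this uses that k is at least 2.\<close>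
  have "\<exists>d'. coset_word X (Suc k) = Node k # d'" using k1 by (cases X) auto
  then obtain d' where d': "coset_word X (Suc k) = Node k # d'" by blast
  have list: "map (jm_word X) [1..<Suc (Suc k)] =
      map (jm_word X) [1..<Suc k] @ [coset_word X (Suc k) @ rev (coset_word X (Suc k))]"
    by (simp add: jm_word_def del: coset_word.simps)
  have hk: "h \<in> carrier C.P.H" using h k by simp
  note markov = C.prod_trace_markov[OF jm_words_lists hk coset_word_lists d' s]
  have min: "length (coset_word X (Suc k)) \<le> C.len (x @ coset_word X (Suc k))" if "x \<in> lists (labels X k)" for x
    using coset_word_minimal[of "Suc k" x X] that by simp
  show "jm_trace X n (incl X n h) = (1 + var_a) * jm_trace X (n - 1) h"
    unfolding k(1) list using markov(1)[OF min] by simp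
  show "jm_trace X n (incl X n h \<otimes>\<^bsub>Hecke X n\<^esub> gen X n (Node (n - 1))) = A_to_R var_q * jm_trace X (n - 1) h"
    unfolding k(1) list using markov(2)[OF min] by (simp add: C.hecke_gen_eq)
qed

theorem theorem3p1p4:
  fixes X :: cox_type
  shows "markov_trace X (tr_zeta X) (1 + var_a) (A_to_R (var_v - inverse var_v))"
  unfolding markov_trace_def
proof (intro conjI allI impI ballI)
  fix n
  interpret C: coxeter_words "labels X n" "cox_matrix X" by (rule coxeter_words_labels)
  show "A_linear X n (tr_zeta X n)" by (rule tr_zeta_linear)
  fix h h' assume "h \<in> carrier (Hecke X n)" "h' \<in> carrier (Hecke X n)"
  then show "tr_zeta X n (h \<otimes>\<^bsub>Hecke X n\<^esub> h') = tr_zeta X n (h' \<otimes>\<^bsub>Hecke X n\<^esub> h)"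
    using jm_trace_mult[of h X n h'] by (simp only: tr_zeta_eq C.H.m_closed)
next
  fix n h assume n: "n > first_index X" and h: "h \<in> carrier (Hecke X (n - 1))"
  interpret C: parabolic "labels X n" "cox_matrix X" "labels X (n - 1)"
    by (rule parabolic_labels) simp
  have i: "incl X n h \<in> carrier (Hecke X n)" using h by (rule C.inc_closed)
  show "tr_zeta X n (incl X n h) = (1 + var_a) * tr_zeta X (n - 1) h"
    using jm_trace_markov(1)[OF n h] by (simp only: tr_zeta_eq[OF i] tr_zeta_eq[OF h])
  have "Node (n - 1) \<in> labels X n" using n by (cases X) (auto simp: first_index_def)
  then have g: "incl X n h \<otimes>\<^bsub>Hecke X n\<^esub> gen X n (Node (n - 1)) \<in> carrier (Hecke X n)"
    using i C.tw_closed[of "[Node (n - 1)]"] by (simp add: C.hecke_gen_eq)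
  show "tr_zeta X n (incl X n h \<otimes>\<^bsub>Hecke X n\<^esub> gen X n (Node (n - 1))) =
      A_to_R (var_v - inverse var_v) * tr_zeta X (n - 1) h"
    using jm_trace_markov(2)[OF n h] by (simp only: tr_zeta_eq[OF g] tr_zeta_eq[OF h] var_q_def)
qed

end
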